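(* Let $A$ and $B$ be locally convex subcomplexes in a weakly special cube complex $X$, and let $G=\pi_1(X)$. Let $\widetilde{X}\to X$ be the universal cover and let $\widetilde{A},\widetilde{B}\subset\widetilde{X}$ be elevations of $A$ and $B$. Let $\widetilde{C}=\Pi_{\widetilde{A}}(\widetilde{B})$. Then $G_{\widetilde{C}}=G_{\widetilde{A}}\cap G_{\widetilde{B}}$ and $\widetilde{C}/G_{\widetilde{C}}$ embeds in $X$.
   Context: All cube complexes (and subcomplexes viewed as such) are connected. $G=\pi_1(X)$ acts on $\widetilde{X}$ by deck transformations, and for a convex subcomplex $\widetilde{D}\subset\widetilde{X}$, $G_{\widetilde{D}}$ denotes its (setwise) stabilizer in $G$. "$\widetilde{C}/G_{\widetilde{C}}$ embeds in $X$" means that the natural map $\widetilde{C}/G_{\widetilde{C}}\to\widetilde{X}/G=X$ is injective. A subcomplex $Y$ of a non-positively curved cube complex $X$ is locally convex if the inclusion induces on each vertex link an embedding onto a full subcomplex of the link in $X$ (a subcomplex of a simplicial complex is full if it contains every simplex all of whose vertices it contains); if $X$ is CAT(0), such a subcomplex is called convex. The elevations of a locally convex subcomplex $A\subset X$ to $\widetilde{X}$ are the components of the preimage of $A$ in $\widetilde{X}$; they are convex subcomplexes. Two edges of a cube complex are elementary parallel if they are opposite edges of a square; parallelism is the equivalence relation generated, and hyperplanes correspond to parallelism classes, $H(e)$ denoting the hyperplane dual to an edge $e$. A hyperplane $H$ self-intersects if there are distinct edges $e_1,e_2$ dual to $H$, incident at a vertex $x$, that form the corner of a square at $x$. It self-osculates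 if there are distinct edges $e_1,e_2$ dual to $H$ incident at a vertex $x$ that do not form the corner of a square at $x$, or an edge dual to $H$ with both ends at the same vertex. A non-positively curved cube complex is weakly special if no hyperplane self-intersects or self-osculates. For a convex subcomplex $\widetilde{A}$ of a CAT(0) cube complex $\widetilde{X}$, the projection $\Pi_{\widetilde{A}}:\widetilde{X}\to\widetilde{A}$ is the combinatorial map (possibly collapsing cubes to lower-dimensional cubes) that sends each vertex of $\widetilde{X}$ to the unique closest vertex of $\widetilde{A}$ in the combinatorial metric. The image $\Pi_{\widetilde{A}}(\widetilde{B})$ of a convex subcomplex is a convex subcomplex of $\widetilde{A}$. *)

theory Defs
  imports "HOL-Analysis.Analysis"
begin

section \<open>Cubes and cube complexes\<close>

definition cube :: "nat \<Rightarrow> (nat \<Rightarrow> real) set" where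
  "cube n = {t. (\<forall>i<n. 0 \<le> t i \<and> t i \<le> 1) \<and> (\<forall>i\<ge>n. t i = 0)}"

definition open_cube :: "nat \<Rightarrow> (nat \<Rightarrow> real) set" where
  "open_cube n = {t. (\<forall>i<n. 0 < t i \<and> t i < 1) \<and> (\<forall>i\<ge>n. t i = 0)}"

abbreviation origin :: "nat \<Rightarrow> real" where
  "origin \<equiv> (\<lambda>_. 0)"

text \<open>Isometries of the m-cube onto an m-dimensional face of the n-cube; for \<open>m = n\<close> these are
  the symmetries of the n-cube.\<close>

definition face_map :: "nat \<Rightarrow> nat \<Rightarrow> ((nat \<Rightarrow> real) \<Rightarrow> (nat \<Rightarrow> real)) \<Rightarrow> bool" where
  "face_map m n f \<longleftrightarrow>
     (\<exists>\<iota>. inj_on \<iota> {..<m} \<and> \<iota> ` {..<m} \<subseteq> {..<n} \<and>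
        (\<forall>j<m. (\<forall>t\<in>cube m. f t (\<iota> j) = t j) \<or> (\<forall>t\<in>cube m. f t (\<iota> j) = 1 - t j)) \<and>
        (\<forall>i\<in>{..<n} - \<iota> ` {..<m}. (\<forall>t\<in>cube m. f t i = 0) \<or> (\<forall>t\<in>cube m. f t i = 1)) \<and>
        (\<forall>i\<ge>n. \<forall>t\<in>cube m. f t i = 0))"

text \<open>\<open>X n\<close> is the set of all characteristic maps of n-cubes, each cube occurring with all its
  parametrisations: the \<open>2 ^ n * fact n\<close> maps that differ by a symmetry of the cube
  belong to the same cube. Cubes need not be embedded along their boundary, and different
  cubes may have the same boundary. As for Delta-complexes, the open cubes are disjoint and
  restricting a characteristic map to a face yields a characteristic map.\<close>

type_synonym 'a cube_complex = "nat \<Rightarrow> ((nat \<Rightarrow> real) \<Rightarrow> 'a) set"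

definition is_cube_complex :: "'a cube_complex \<Rightarrow> bool" where
  "is_cube_complex X \<longleftrightarrow>
     (\<forall>n. X n \<subseteq> extensional (cube n)) \<and>
     (\<forall>m n f. \<forall>\<sigma>\<in>X n. face_map m n f \<longrightarrow> compose (cube m) \<sigma> f \<in> X m) \<and>
     (\<forall>n. \<forall>\<sigma>\<in>X n. inj_on \<sigma> (open_cube n)) \<and>
     (\<forall>m n. \<forall>\<sigma>\<in>X m. \<forall>\<tau>\<in>X n. \<forall>s\<in>open_cube m. \<forall>t\<in>open_cube n. \<sigma> s = \<tau> t \<longrightarrow>
        m = n \<and> (\<exists>f. face_map n n f \<and> \<tau> = compose (cube n) \<sigma> f))"

definition points :: "'a cube_complex \<Rightarrow> 'a set" where
  "points X = (\<Union>n. \<Union>\<sigma>\<in>X n. \<sigma> ` cube n)"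

definition vertices :: "'a cube_complex \<Rightarrow> 'a set" where
  "vertices X = (\<lambda>\<sigma>. \<sigma> origin) ` X 0"

text \<open>The weak topology.\<close>

definition cc_topology :: "'a cube_complex \<Rightarrow> 'a topology" where
  "cc_topology X = topology (\<lambda>U. U \<subseteq> points X \<and>
     (\<forall>n. \<forall>\<sigma>\<in>X n. openin (top_of_set (cube n)) {t \<in> cube n. \<sigma> t \<in> U}))"

lemma openin_cc_topology:
  "openin (cc_topology X) U \<longleftrightarrow> U \<subseteq> points X \<and>
     (\<forall>n. \<forall>\<sigma>\<in>X n. openin (top_of_set (cube n)) {t \<in> cube n. \<sigma> t \<in> U})"
proof -
  let ?P = "\<lambda>U. U \<subseteq> points X \<and>
     (\<forall>n. \<forall>\<sigma>\<in>X n. openin (top_of_set (cube n)) {t \<in> cube n. \<sigma> t \<in> U})"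
  have int: "?P (S \<inter> T)" if "?P S" "?P T" for S T
  proof -
    have "{t \<in> cube n. \<sigma> t \<in> S \<inter> T} = {t \<in> cube n. \<sigma> t \<in> S} \<inter> {t \<in> cube n. \<sigma> t \<in> T}"
      for n and \<sigma> :: "(nat \<Rightarrow> real) \<Rightarrow> 'a"
      by auto
    with that show ?thesis by (auto intro!: openin_Int)
  qed
  have un: "?P (\<Union>K)" if "\<forall>U\<in>K. ?P U" for K
  proof -
    have "{t \<in> cube n. \<sigma> t \<in> \<Union>K} = (\<Union>U\<in>K. {t \<in> cube n. \<sigma> t \<in> U})"
      for n and \<sigma> :: "(nat \<Rightarrow> real) \<Rightarrow> 'a"
      by auto
    with that show ?thesis by (auto intro!: openin_Union)
  qed
  have "istopology ?P"
    unfolding istopology_def using int un by blast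
  then show ?thesis
    unfolding cc_topology_def by (simp add: topology_inverse')
qed

section \<open>Subcomplexes, links and non-positive curvature\<close>

text \<open>A subcomplex is represented by its set of points; \<open>sub_cc X A\<close> is \<open>A\<close> as a cube complex.\<close>

definition subcomplex :: "'a cube_complex \<Rightarrow> 'a set \<Rightarrow> bool" where
  "subcomplex X A \<longleftrightarrow> A \<subseteq> points X \<and>
     (\<forall>x\<in>A. \<exists>n. \<exists>\<sigma>\<in>X n. x \<in> \<sigma> ` cube n \<and> \<sigma> ` cube n \<subseteq> A)"

definition sub_cc :: "'a cube_complex \<Rightarrow> 'a set \<Rightarrow> 'a cube_complex" where
  "sub_cc X A = (\<lambda>n. {\<sigma>\<in>X n. \<sigma> ` cube n \<subseteq> A})"

text \<open>The i-th edge at the origin of the cube \<open>\<sigma>\<close>, parametrised as starting at the origin.\<close>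

definition corner_edge :: "((nat \<Rightarrow> real) \<Rightarrow> 'a) \<Rightarrow> nat \<Rightarrow> ((nat \<Rightarrow> real) \<Rightarrow> 'a)" where
  "corner_edge \<sigma> i = compose (cube 1) \<sigma> (\<lambda>t. origin(i := t 0))"

text \<open>The simplices of the link of \<open>v\<close>, as sets of vertices. A vertex of the link is an edge
  oriented away from \<open>v\<close>, so that a loop contributes two vertices. Every corner of a cube is
  the corner at the origin in a suitable parametrisation. The empty simplex is included.\<close>

definition link :: "'a cube_complex \<Rightarrow> 'a \<Rightarrow> ((nat \<Rightarrow> real) \<Rightarrow> 'a) set set" where
  "link X v = {corner_edge \<sigma> ` {..<n} | n \<sigma>. \<sigma> \<in> X n \<and> \<sigma> origin = v}"

definition flag :: "'s set set \<Rightarrow> bool" where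
  "flag K \<longleftrightarrow> (\<forall>S. finite S \<and> (\<forall>a\<in>S. \<forall>b\<in>S. {a, b} \<in> K) \<longrightarrow> S \<in> K)"

definition full_simplicial_subcomplex :: "'s set set \<Rightarrow> 's set set \<Rightarrow> bool" where
  "full_simplicial_subcomplex L K \<longleftrightarrow>
     L \<subseteq> K \<and> (\<forall>S\<in>K. (\<forall>a\<in>S. {a} \<in> L) \<longrightarrow> S \<in> L)"

text \<open>Links are simplicial complexes, that is, the corner of an n-cube is a simplex with n
  different vertices and no two corners span the same simplex, and they are flag.\<close>

definition nonpositively_curved :: "'a cube_complex \<Rightarrow> bool" where
  "nonpositively_curved X \<longleftrightarrow>
     (\<forall>n. \<forall>\<sigma>\<in>X n. inj_on (corner_edge \<sigma>) {..<n}) \<and>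
     (\<forall>n. \<forall>\<sigma>\<in>X n. \<forall>\<tau>\<in>X n. \<sigma> origin = \<tau> origin \<and>
        (\<forall>i<n. corner_edge \<sigma> i = corner_edge \<tau> i) \<longrightarrow> \<sigma> = \<tau>) \<and>
     (\<forall>v\<in>vertices X. flag (link X v))"

definition locally_convex :: "'a cube_complex \<Rightarrow> 'a set \<Rightarrow> bool" where
  "locally_convex X A \<longleftrightarrow> subcomplex X A \<and>
     (\<forall>v\<in>vertices X \<inter> A. full_simplicial_subcomplex (link (sub_cc X A) v) (link X v))"

section \<open>Hyperplanes and weakly special cube complexes\<close>

text \<open>Unoriented edges are represented by their sets of points, which determine them.\<close>

definition edges :: "'a cube_complex \<Rightarrow> 'a set set" where
  "edges X = (\<lambda>d. d ` cube 1) ` X 1"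

definition elementary_parallel :: "'a cube_complex \<Rightarrow> ('a set \<times> 'a set) set" where
  "elementary_parallel X =
     {(\<sigma> ` {t \<in> cube 2. t 1 = 0}, \<sigma> ` {t \<in> cube 2. t 1 = 1}) | \<sigma>. \<sigma> \<in> X 2}"

definition parallel :: "'a cube_complex \<Rightarrow> ('a set \<times> 'a set) set" where
  "parallel X = (elementary_parallel X \<union> (elementary_parallel X)\<inverse>)\<^sup>*"

text \<open>A hyperplane is identified with the class of the edges dual to it.\<close>

definition hyperplanes :: "'a cube_complex \<Rightarrow> 'a set set set" where
  "hyperplanes X = edges X // parallel X"

definition square_corner :: "'a cube_complex \<Rightarrow> 'a \<Rightarrow> 'a set \<Rightarrow> 'a set \<Rightarrow> bool" where
  "square_corner X x e1 e2 \<longleftrightarrow> (\<exists>\<sigma>\<in>X 2. \<sigma> origin = x \<and>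
     e1 = \<sigma> ` {t \<in> cube 2. t 1 = 0} \<and> e2 = \<sigma> ` {t \<in> cube 2. t 0 = 0})"

definition self_intersects :: "'a cube_complex \<Rightarrow> 'a set set \<Rightarrow> bool" where
  "self_intersects X H \<longleftrightarrow> (\<exists>e1\<in>H. \<exists>e2\<in>H. \<exists>x\<in>vertices X.
     e1 \<noteq> e2 \<and> x \<in> e1 \<and> x \<in> e2 \<and> square_corner X x e1 e2)"

definition self_osculates :: "'a cube_complex \<Rightarrow> 'a set set \<Rightarrow> bool" where
  "self_osculates X H \<longleftrightarrow>
     (\<exists>e1\<in>H. \<exists>e2\<in>H. \<exists>x\<in>vertices X.
        e1 \<noteq> e2 \<and> x \<in> e1 \<and> x \<in> e2 \<and> \<not> square_corner X x e1 e2) \<or>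
     (\<exists>d\<in>X 1. d ` cube 1 \<in> H \<and> d origin = d (origin(0 := 1)))"

definition weakly_special :: "'a cube_complex \<Rightarrow> bool" where
  "weakly_special X \<longleftrightarrow> is_cube_complex X \<and> nonpositively_curved X \<and>
     (\<forall>H\<in>hyperplanes X. \<not> self_intersects X H \<and> \<not> self_osculates X H)"

section \<open>Universal cover, deck transformations and elevations\<close>

text \<open>The next two definitions transfer \<^const>\<open>covering_space\<close> and \<^const>\<open>simply_connected\<close>
  to abstract topologies.\<close>

definition covering_map :: "'b topology \<Rightarrow> ('b \<Rightarrow> 'a) \<Rightarrow> 'a topology \<Rightarrow> bool" where
  "covering_map T p S \<longleftrightarrow>
     continuous_map T S p \<and> p ` topspace T = topspace S \<and>
     (\<forall>x\<in>topspace S. \<exists>U. x \<in> U \<and> openin S U \<and>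
        (\<exists>\<V>. \<Union>\<V> = {y \<in> topspace T. p y \<in> U} \<and> (\<forall>V\<in>\<V>. openin T V) \<and>
             pairwise disjnt \<V> \<and>
             (\<forall>V\<in>\<V>. homeomorphic_map (subtopology T V) (subtopology S U) p)))"

definition simply_connected_space :: "'a topology \<Rightarrow> bool" where
  "simply_connected_space T \<longleftrightarrow>
     (\<forall>f g. pathin T f \<and> f 1 = f 0 \<and> pathin T g \<and> g 1 = g 0 \<longrightarrow>
        homotopic_with (\<lambda>r. r 1 = r 0) (top_of_set {0..1}) T f g)"

text \<open>The last two conjuncts say that \<open>Y\<close> carries the cube structure lifted from \<open>X\<close>.\<close>

definition universal_cover :: "'b cube_complex \<Rightarrow> ('b \<Rightarrow> 'a) \<Rightarrow> 'a cube_complex \<Rightarrow> bool" where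
  "universal_cover Y p X \<longleftrightarrow>
     is_cube_complex Y \<and>
     simply_connected_space (cc_topology Y) \<and>
     covering_map (cc_topology Y) p (cc_topology X) \<and>
     (\<forall>n. \<forall>s\<in>Y n. compose (cube n) p s \<in> X n) \<and>
     (\<forall>n. \<forall>\<sigma>\<in>X n. \<forall>t\<in>cube n. \<forall>y\<in>points Y. p y = \<sigma> t \<longrightarrow>
        (\<exists>!s. s \<in> Y n \<and> s t = y \<and> compose (cube n) p s = \<sigma>))"

text \<open>For the universal cover \<open>p\<close> this is the fundamental group of the base, acting on \<open>Y\<close>.\<close>

definition deck_group :: "'b cube_complex \<Rightarrow> ('b \<Rightarrow> 'a) \<Rightarrow> ('b \<Rightarrow> 'b) set" where
  "deck_group Y p = {g \<in> extensional (points Y).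
     homeomorphic_map (cc_topology Y) (cc_topology Y) g \<and> (\<forall>y\<in>points Y. p (g y) = p y)}"

definition stabilizer :: "('b \<Rightarrow> 'b) set \<Rightarrow> 'b set \<Rightarrow> ('b \<Rightarrow> 'b) set" where
  "stabilizer G D = {g \<in> G. g ` D = D}"

definition elevations :: "'b cube_complex \<Rightarrow> ('b \<Rightarrow> 'a) \<Rightarrow> 'a set \<Rightarrow> 'b set set" where
  "elevations Y p A =
     connected_components_of (subtopology (cc_topology Y) {y \<in> points Y. p y \<in> A})"

definition orbit_space :: "('b \<Rightarrow> 'b) set \<Rightarrow> 'b set \<Rightarrow> 'b set set" where
  "orbit_space G D = (\<lambda>x. (\<lambda>g. g x) ` G) ` D"

text \<open>The natural map from \<open>orbit_space G D\<close> to the base of \<open>p\<close>, where \<open>G\<close> consists of deck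
  transformations: \<open>p\<close> is constant on every orbit.\<close>

definition orbit_to_base :: "('b \<Rightarrow> 'a) \<Rightarrow> 'b set \<Rightarrow> 'a" where
  "orbit_to_base p Q = the_elem (p ` Q)"

section \<open>Projection to a convex subcomplex\<close>

definition adjacent :: "'a cube_complex \<Rightarrow> ('a \<times> 'a) set" where
  "adjacent X = (\<lambda>d. (d origin, d (origin(0 := 1)))) ` X 1"

definition edge_dist :: "'a cube_complex \<Rightarrow> 'a \<Rightarrow> 'a \<Rightarrow> nat" where
  "edge_dist X u v = (LEAST k. (u, v) \<in> adjacent X ^^ k)"

text \<open>Coordinate projections from the n-cube onto the m-cube.\<close>

definition collapse_map :: "nat \<Rightarrow> nat \<Rightarrow> ((nat \<Rightarrow> real) \<Rightarrow> (nat \<Rightarrow> real)) \<Rightarrow> bool" where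
  "collapse_map n m q \<longleftrightarrow>
     (\<exists>\<iota>. inj_on \<iota> {..<m} \<and> \<iota> ` {..<m} \<subseteq> {..<n} \<and>
        (\<forall>t\<in>cube n. q t = (\<lambda>j. if j < m then t (\<iota> j) else 0)))"

definition combinatorial_map :: "'a cube_complex \<Rightarrow> 'b cube_complex \<Rightarrow> ('a \<Rightarrow> 'b) \<Rightarrow> bool" where
  "combinatorial_map X Z f \<longleftrightarrow>
     (\<forall>n. \<forall>\<sigma>\<in>X n. \<exists>m. \<exists>\<tau>\<in>Z m. \<exists>q. collapse_map n m q \<and> (\<forall>t\<in>cube n. f (\<sigma> t) = \<tau> (q t)))"

definition is_projection :: "'a cube_complex \<Rightarrow> 'a set \<Rightarrow> ('a \<Rightarrow> 'a) \<Rightarrow> bool" where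
  "is_projection X A pr \<longleftrightarrow> combinatorial_map X (sub_cc X A) pr \<and>
     (\<forall>v\<in>vertices X. pr v \<in> vertices X \<inter> A \<and>
        (\<forall>w\<in>vertices X \<inter> A. w \<noteq> pr v \<longrightarrow> edge_dist X v (pr v) < edge_dist X v w))"

end

theory Submission
  imports Defs
begin

text \<open>
Write \<open>Y\<close> for the universal cover. Two facts about a deck transformation \<open>g\<close> carry the theorem. If \<open>x\<close> and
\<open>g x\<close> both lie in an elevation, then \<open>g\<close> maps that elevation to itself, because elevations are connected
components of a preimage. And deck transformations are transitive on the fibres of the covering. So both
claims follow once it is shown that \<open>x\<close> and \<open>g x\<close> can lie together in \<open>Ct = pr ` Bt\<close> only if \<open>g\<close>
stabilises both \<open>At\<close> and \<open>Bt\<close>, together with the converse that such a \<open>g\<close> commutes with the projection.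
For \<open>At\<close> the first fact suffices, since \<open>Ct\<close> is contained in \<open>At\<close>. The point is \<open>Bt\<close>.

Colour every edge of \<open>Y\<close> by the hyperplane of \<open>X\<close> dual to its image. Weak specialness implies that
at each vertex there is at most one edge of each colour, so a path is determined by its starting vertex and
its word of colours, and deck transformations preserve words. Take a shortest word \<open>w0\<close> that leads from some
vertex of \<open>At\<close> to some vertex of \<open>Bt\<close>. The key statement, \<open>shortest_bridge_everywhere\<close>, is that \<open>w0\<close> leads
from \<^emph>\<open>every\<close> vertex of the form \<open>pr b\<close> to a vertex of \<open>Bt\<close>: geometrically, the hyperplanes that separate
\<open>At\<close> from \<open>Bt\<close> cross all hyperplanes of \<open>Ct\<close>, so the shortest path can be translated along \<open>Ct\<close>. Hence if
\<open>v\<close> and \<open>g v\<close> are both such vertices, the path with word \<open>w0\<close> from \<open>v\<close> ends at a vertex \<open>y\<close> of \<open>Bt\<close>, and \<open>g y\<close>,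
the end of the path with the same word from \<open>g v\<close>, is in \<open>Bt\<close> as well.

The key statement is proved in an abstract setting of vertices, colours and squares. There, flagness of links
is the cube condition, and the geometry of CAT(0) cube complexes is replaced by one fact, \<open>reduced_unique\<close>:
reduced words with the same endpoints differ only by shuffling commuting letters. It follows, as in van der
Waerden's proof of the normal form theorem for free products, by letting edges act on classes of reduced
words, provided that closed words can be contracted combinatorially.

That combinatorial contractibility is deduced from the topological simple connectivity of \<open>Y\<close> by building
the combinatorial universal cover \<open>E\<close> of \<open>Y\<close>, whose points are points of \<open>Y\<close> with a homotopy class of words. Two
general results make it work: maps of cube complexes with unique lifting of cubes are coverings in the weak
topology (\<open>cubical_cover.covering\<close>), and a path in a covering space that lies over a null-homotopic loop is
closed (\<open>nullhomotopic_lift_closed\<close>). The latter also shows that deck transformations act transitively on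
fibres.
\<close>

section \<open>Words in edge-coloured square complexes\<close>

lemma append_eq_ConsD:
  "u @ v = x @ c # z \<Longrightarrow> length x < length u \<Longrightarrow> \<exists>t. u = x @ c # t \<and> z = t @ v"
  by (auto simp: append_eq_append_conv2 append_eq_Cons_conv)

text \<open>The combinatorial shadow of a cube complex whose edges are coloured so that every vertex has at most one edge
of each colour: \<open>ed v c\<close> says that an edge of colour \<open>c\<close> leaves \<open>v\<close>, \<open>mv v c\<close> is its other end, and \<open>sq v c d\<close>
says that the edges of colours \<open>c\<close> and \<open>d\<close> at \<open>v\<close> are the corner of a square, whose opposite edges have equal
colours. The last assumption is what remains of the flag condition: three squares that pairwise share the
edges at a corner \<open>v\<close> bound a cube, and this cube also has a square at the other end of the edge \<open>a\<close>. A path is encoded by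
its starting vertex and its word of colours.\<close>

locale coloured_squares =
  fixes ed :: "'v \<Rightarrow> 'c \<Rightarrow> bool" and mv :: "'v \<Rightarrow> 'c \<Rightarrow> 'v" and sq :: "'v \<Rightarrow> 'c \<Rightarrow> 'c \<Rightarrow> bool"
  assumes ed_mv: "ed v c \<Longrightarrow> ed (mv v c) c"
    and mv_mv: "ed v c \<Longrightarrow> mv (mv v c) c = v"
    and sq_ed: "sq v c d \<Longrightarrow> ed v c"
    and sq_neq: "sq v c d \<Longrightarrow> c \<noteq> d"
    and sq_sym: "sq v c d \<Longrightarrow> sq v d c"
    and sq_mv: "sq v c d \<Longrightarrow> sq (mv v c) c d"
    and sq_comm: "sq v c d \<Longrightarrow> mv (mv v c) d = mv (mv v d) c"
    and sq_cube: "sq v a b \<Longrightarrow> sq v b c \<Longrightarrow> sq v a c \<Longrightarrow> sq (mv v a) b c"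
begin

lemma sq_ed2: "sq v c d \<Longrightarrow> ed v d"
  using sq_ed sq_sym by blast

lemma sq_mv2: "sq v c d \<Longrightarrow> sq (mv v d) c d"
  using sq_mv sq_sym by blast

lemma sq_ed_mv: "sq v c d \<Longrightarrow> ed (mv v c) d"
  using sq_ed2 sq_mv by blast

fun is_path :: "'v \<Rightarrow> 'c list \<Rightarrow> bool" where
  "is_path v [] \<longleftrightarrow> True"
| "is_path v (c # w) \<longleftrightarrow> ed v c \<and> is_path (mv v c) w"

fun end_of :: "'v \<Rightarrow> 'c list \<Rightarrow> 'v" where
  "end_of v [] = v"
| "end_of v (c # w) = end_of (mv v c) w"

lemma is_path_append: "is_path v (x @ y) \<longleftrightarrow> is_path v x \<and> is_path (end_of v x) y"
  by (induction x arbitrary: v) auto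

lemma end_of_append: "end_of v (x @ y) = end_of (end_of v x) y"
  by (induction x arbitrary: v) auto

lemma is_path_rev: "is_path v w \<Longrightarrow> is_path (end_of v w) (rev w) \<and> end_of (end_of v w) (rev w) = v"
  by (induction w arbitrary: v) (auto simp: is_path_append end_of_append ed_mv mv_mv)

text \<open>The edge of colour \<open>c\<close> at \<open>v\<close> can be translated along the path \<open>w\<close> through a ladder of squares.\<close>

fun cross :: "'v \<Rightarrow> 'c list \<Rightarrow> 'c \<Rightarrow> bool" where
  "cross v [] c \<longleftrightarrow> True"
| "cross v (d # w) c \<longleftrightarrow> sq v d c \<and> cross (mv v d) w c"

text \<open>The first occurrence of \<open>c\<close> in \<open>w\<close> can be shuffled to the front. Since the two colours of a square differ,
this can only concern the first occurrence, so the word that remains is \<open>remove1 c w\<close>.\<close>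

fun initial :: "'v \<Rightarrow> 'c \<Rightarrow> 'c list \<Rightarrow> bool" where
  "initial v c [] \<longleftrightarrow> False"
| "initial v c (d # w) \<longleftrightarrow> c = d \<or> sq v d c \<and> initial (mv v d) c w"

text \<open>No letter cancels against a later one: if \<open>c\<close> were initial in the path that follows a letter \<open>c\<close>, its second
occurrence could be shuffled next to the first, and the two edges would backtrack.\<close>

fun reduced :: "'v \<Rightarrow> 'c list \<Rightarrow> bool" where
  "reduced v [] \<longleftrightarrow> True"
| "reduced v (c # w) \<longleftrightarrow> ed v c \<and> reduced (mv v c) w \<and> \<not> initial (mv v c) c w"

lemma reduced_is_path: "reduced v w \<Longrightarrow> is_path v w"
  by (induction w arbitrary: v) auto

lemma cross_is_path:
  "ed v c \<Longrightarrow> is_path v w \<Longrightarrow> cross v w c \<Longrightarrow>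
    is_path (mv v c) w \<and> ed (end_of v w) c \<and> end_of (mv v c) w = mv (end_of v w) c"
proof (induction w arbitrary: v)
  case (Cons d w)
  have s: "sq v d c" using Cons.prems by simp
  have "ed (mv v d) c" using s sq_ed_mv by blast
  from Cons.IH[OF this] Cons.prems s show ?case
    using sq_comm[OF s] sq_ed_mv[OF sq_sym[OF s]] by auto
qed simp

lemma initial_append: "initial v c (x @ y) \<longleftrightarrow> initial v c x \<or> cross v x c \<and> initial (end_of v x) c y"
  by (induction x arbitrary: v) (auto dest: sq_neq)

lemma initial_remove1:
  "is_path v w \<Longrightarrow> initial v c w \<Longrightarrow>
    is_path (mv v c) (remove1 c w) \<and> end_of (mv v c) (remove1 c w) = end_of v w \<and>
    length w = Suc (length (remove1 c w))"
proof (induction w arbitrary: v)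
  case (Cons d w)
  show ?case
  proof (cases "c = d")
    case False
    then have s: "sq v d c" and i: "initial (mv v d) c w" using Cons.prems by auto
    then show ?thesis
      using Cons.IH[OF _ i] Cons.prems False sq_comm[OF s] sq_ed_mv[OF sq_sym[OF s]] by auto
  qed (use Cons.prems in auto)
qed simp

text \<open>One move across a square. Words related by such moves describe the same path up to shuffling.\<close>

inductive swap :: "'v \<Rightarrow> 'c list \<Rightarrow> 'c list \<Rightarrow> bool" where
  swap_here: "sq v c d \<Longrightarrow> swap v (c # d # w) (d # c # w)"
| swap_cons: "swap (mv v c) w w' \<Longrightarrow> swap v (c # w) (c # w')"

abbreviation eqv :: "'v \<Rightarrow> 'c list \<Rightarrow> 'c list \<Rightarrow> bool" where
  "eqv v \<equiv> (swap v)\<^sup>*\<^sup>*"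

lemma swap_sym: "swap v w w' \<Longrightarrow> swap v w' w"
  by (induction rule: swap.induct) (auto intro: swap.intros sq_sym)

lemma eqv_sym: "eqv v w w' \<Longrightarrow> eqv v w' w"
  by (induction rule: rtranclp_induct) (auto intro: converse_rtranclp_into_rtranclp swap_sym)

lemma eqv_cons: "eqv (mv v c) w w' \<Longrightarrow> eqv v (c # w) (c # w')"
  by (induction rule: rtranclp_induct) (auto intro: rtranclp.rtrancl_into_rtrancl swap_cons)

text \<open>The cube condition, used at two different corners of one cube: the squares on which \<open>c\<close> passes \<open>a\<close> and then
\<open>b\<close> meet at the end of the edge \<open>a\<close> and span a cube with the given square; the opposite faces let \<open>c\<close> pass
\<open>b\<close> and then \<open>a\<close>.\<close>

lemma initial_swap_aux:
  assumes "sq v a b" "c \<noteq> a" "c \<noteq> b" "sq v a c" "sq (mv v a) b c"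
  shows "sq v b c \<and> sq (mv v b) a c"
proof -
  have 1: "sq (mv v a) a b" "sq (mv v a) a c" using assms sq_mv by auto
  have e: "mv (mv v a) a = v" using assms(1) mv_mv sq_ed by blast
  have 2: "sq v b c" using sq_cube[OF 1(1) assms(5) 1(2)] e by simp
  moreover have "sq (mv v b) a c"
    using sq_cube[of v b a c] 2 assms(1,4) sq_sym by blast
  ultimately show ?thesis by blast
qed

text \<open>Shuffling does not change which letters can be brought to the front, nor, up to shuffling, what is left when
one of them is removed. The case of a letter different from the two swapped ones is where cubes are used.\<close>

lemma swap_initial:
  "swap v w w' \<Longrightarrow> initial v c w \<Longrightarrow> initial v c w' \<and> eqv (mv v c) (remove1 c w) (remove1 c w')"
proof (induction arbitrary: c rule: swap.induct)
  case (swap_here v a b w)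
  have s: "sq v b a" using swap_here sq_sym by blast
  show ?case
  proof (cases "c = a \<or> c = b")
    case True
    then show ?thesis using swap_here s sq_neq[OF s] by auto
  next
    case False
    then have p: "sq v a c" "sq (mv v a) b c" "initial (mv (mv v a) b) c w"
      using swap_here by auto
    have q: "sq v b c" "sq (mv v b) a c" using initial_swap_aux[OF swap_here(1) _ _ p(1,2)] False by auto
    have "sq (mv v c) a b"
      using sq_cube[of v c a b] p(1) q(1) swap_here(1) sq_sym by blast
    then show ?thesis
      using p q False swap.swap_here sq_comm[OF swap_here(1)] by auto
  qed
next
  case (swap_cons v d w w')
  show ?case
  proof (cases "c = d")
    case True
    then show ?thesis using swap_cons by auto
  next
    case False
    then have p: "sq v d c" "initial (mv v d) c w" using swap_cons by auto
    then have "eqv (mv (mv v d) c) (remove1 c w) (remove1 c w')" "initial (mv v d) c w'"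
      using swap_cons.IH by auto
    then show ?thesis
      using False p sq_comm[OF p(1)] eqv_cons[of "mv v c" d] by auto
  qed
qed

lemma eqv_initial:
  "eqv v w w' \<Longrightarrow> initial v c w \<Longrightarrow> initial v c w' \<and> eqv (mv v c) (remove1 c w) (remove1 c w')"
  by (induction rule: rtranclp_induct) (auto dest: swap_initial intro: rtranclp_trans)

lemma eqv_initial_iff: "eqv v w w' \<Longrightarrow> initial v c w \<longleftrightarrow> initial v c w'"
  using eqv_initial eqv_sym by blast

lemma initial_eqv: "is_path v w \<Longrightarrow> initial v c w \<Longrightarrow> eqv v w (c # remove1 c w)"
proof (induction w arbitrary: v)
  case (Cons d w)
  show ?case
  proof (cases "c = d")
    case False
    then have s: "sq v d c" and i: "initial (mv v d) c w" using Cons.prems by auto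
    have "eqv v (d # w) (d # c # remove1 c w)"
      using Cons.IH[OF _ i] Cons.prems eqv_cons by auto
    moreover have "swap v (d # c # remove1 c w) (c # d # remove1 c w)"
      using s by (rule swap_here)
    ultimately show ?thesis using False by auto
  qed auto
qed simp

text \<open>For the two swapped letters the conditions on the left and on the right are the same three conditions, because
the square between them lets each pass the other.\<close>

lemma swap_reduced: "swap v w w' \<Longrightarrow> reduced v w \<Longrightarrow> reduced v w'"
proof (induction rule: swap.induct)
  case (swap_here v a b w)
  have s: "sq v b a" using swap_here sq_sym by blast
  have t: "sq (mv v a) b a" "sq (mv v b) a b" using sq_mv sq_mv2 s swap_here(1) by auto
  show ?case
    using swap_here s t sq_ed[OF s] sq_ed_mv[OF s] sq_comm[OF s] sq_neq[OF s] by auto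
next
  case (swap_cons v c w w')
  then show ?case using eqv_initial_iff[of "mv v c" w w' c] by auto
qed

lemma eqv_reduced: "eqv v w w' \<Longrightarrow> reduced v w \<Longrightarrow> reduced v w'"
  by (induction rule: rtranclp_induct) (auto dest: swap_reduced)

text \<open>How a reduced path from \<open>v\<close> to a fixed base vertex changes when its starting point is moved along the edge
of colour \<open>c\<close>: that edge is prepended backwards, and cancelled if possible.\<close>

definition carry :: "'v \<Rightarrow> 'c \<Rightarrow> 'c list \<Rightarrow> 'c list" where
  "carry v c w = (if initial v c w then remove1 c w else c # w)"

lemma reduced_remove1: "reduced v w \<Longrightarrow> initial v c w \<Longrightarrow>
   reduced (mv v c) (remove1 c w) \<and> \<not> initial (mv v c) c (remove1 c w)"
  using eqv_reduced[OF initial_eqv] reduced_is_path by fastforce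

lemma carry_reduced: "reduced v w \<Longrightarrow> ed v c \<Longrightarrow> reduced (mv v c) (carry v c w)"
  by (auto simp: carry_def reduced_remove1 ed_mv mv_mv)

lemma carry_eqv: "eqv v w w' \<Longrightarrow> ed v c \<Longrightarrow> eqv (mv v c) (carry v c w) (carry v c w')"
  using eqv_initial[of v w w' c] eqv_initial_iff[of v w w' c] eqv_cons[of "mv v c" c w w']
  by (auto simp: carry_def mv_mv)

lemma carry_carry: "reduced v w \<Longrightarrow> ed v c \<Longrightarrow> eqv v (carry (mv v c) c (carry v c w)) w"
  using reduced_remove1[of v w c] initial_eqv[of v w c] reduced_is_path[of v w] eqv_sym[of v w]
  by (auto simp: carry_def)

lemma carry_square_aux:
  assumes "reduced v w" "sq v c d" "initial v c w" "\<not> initial v d w"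
  shows "carry (mv v c) d (carry v c w) = carry (mv v d) c (carry v d w)"
proof -
  have dc: "d \<noteq> c" using assms sq_neq by blast
  have e: "eqv v w (c # remove1 c w)" using assms initial_eqv reduced_is_path by blast
  have "\<not> initial (mv v c) d (remove1 c w)"
    using eqv_initial_iff[OF e, of d] assms dc by auto
  moreover have "sq (mv v d) d c" using assms sq_mv sq_sym by blast
  moreover have "mv (mv v d) d = v" using assms mv_mv sq_ed2 by blast
  ultimately show ?thesis using assms dc by (auto simp: carry_def)
qed

text \<open>Together with \<open>carry_carry\<close> this says that \<open>carry\<close> is an action of paths up to homotopy on classes of reduced
words; the four cases are distinguished by which of the two letters cancel.\<close>

lemma carry_square:
  assumes "reduced v w" "sq v c d"
  shows "eqv (mv (mv v c) d) (carry (mv v c) d (carry v c w)) (carry (mv v d) c (carry v d w))"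
proof -
  have dc: "d \<noteq> c" using assms sq_neq by blast
  have e: "mv (mv v d) d = v" "mv (mv v c) c = v" using assms mv_mv sq_ed2 sq_ed by auto
  have cm: "mv (mv v c) d = mv (mv v d) c" using assms sq_comm by blast
  consider "initial v c w" "\<not> initial v d w" | "\<not> initial v c w" "initial v d w"
    | "initial v c w" "initial v d w" | "\<not> initial v c w" "\<not> initial v d w" by blast
  then show ?thesis
  proof cases
    case 1
    then show ?thesis using carry_square_aux[OF assms] by simp
  next
    case 2
    then show ?thesis using carry_square_aux[OF assms(1) sq_sym[OF assms(2)]] by simp
  next
    case 3
    have "eqv v w (c # remove1 c w)" "eqv v w (d # remove1 d w)"
      using assms 3 initial_eqv reduced_is_path by blast+
    from eqv_initial_iff[OF this(1), of d] eqv_initial_iff[OF this(2), of c]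
    have "initial (mv v c) d (remove1 c w)" "initial (mv v d) c (remove1 d w)"
      using 3 dc by auto
    then show ?thesis using 3 by (simp add: carry_def remove1_commute)
  next
    case 4
    have "sq (mv (mv v c) d) d c"
      using assms(2) sq_mv sq_mv2 sq_sym by blast
    then show ?thesis using 4 e dc by (auto simp: carry_def intro!: r_into_rtranclp swap_here)
  qed
qed

inductive hom :: "'v \<Rightarrow> 'c list \<Rightarrow> 'c list \<Rightarrow> bool" where
  hom_refl: "hom v w w"
| hom_sym: "hom v w w' \<Longrightarrow> hom v w' w"
| hom_trans: "hom v w w' \<Longrightarrow> hom v w' w'' \<Longrightarrow> hom v w w''"
| hom_swap: "sq v c d \<Longrightarrow> hom v (c # d # w) (d # c # w)"
| hom_cancel: "ed v c \<Longrightarrow> hom v (c # c # w) w"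
| hom_cons: "ed v c \<Longrightarrow> hom (mv v c) w w' \<Longrightarrow> hom v (c # w) (c # w')"

lemma hom_append: "hom v w w' \<Longrightarrow> hom v (w @ z) (w' @ z)"
  by (induction rule: hom.induct) (auto intro: hom.intros)

lemma hom_prepend: "is_path v x \<Longrightarrow> hom (end_of v x) w w' \<Longrightarrow> hom v (x @ w) (x @ w')"
  by (induction x arbitrary: v) (auto intro: hom.intros)

lemma hom_is_path: "hom v w w' \<Longrightarrow> (is_path v w \<longleftrightarrow> is_path v w') \<and> end_of v w = end_of v w'"
proof (induction rule: hom.induct)
  case (hom_swap v c d w)
  then show ?case
    using sq_comm[OF hom_swap] sq_sym[OF hom_swap] by (auto dest: sq_ed sq_ed_mv)
qed (auto simp: mv_mv ed_mv)

lemma hom_rev: "is_path v w \<Longrightarrow> hom (end_of v w) (rev w @ w) []"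
proof (induction w arbitrary: v)
  case (Cons c w)
  let ?u = "end_of (mv v c) w"
  have p: "is_path (mv v c) w" "ed v c" using Cons.prems by auto
  have "hom ?u (rev w @ ([c, c] @ w)) (rev w @ w)"
    using is_path_rev[OF p(1)] p(2) by (intro hom_prepend) (auto intro: hom_cancel ed_mv)
  then show ?case using Cons.IH[OF p(1)] hom_trans by auto
qed (simp add: hom_refl)

fun normal_form :: "'v \<Rightarrow> 'c list \<Rightarrow> 'c list" where
  "normal_form v [] = []"
| "normal_form v (c # w) = carry (mv v c) c (normal_form (mv v c) w)"

lemma normal_form_reduced: "is_path v w \<Longrightarrow> reduced v (normal_form v w)"
proof (induction w arbitrary: v)
  case (Cons c w)
  then show ?case using carry_reduced[of "mv v c" "normal_form (mv v c) w" c] by (auto simp: ed_mv mv_mv)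
qed simp

lemma reduced_normal_form: "reduced v w \<Longrightarrow> normal_form v w = w"
  by (induction w arbitrary: v) (auto simp: carry_def)

text \<open>A homotopy cannot change the reduced form: a swap is absorbed by \<open>carry_square\<close>, a backtrack by \<open>carry_carry\<close>.\<close>

lemma hom_normal_form: "hom v w w' \<Longrightarrow> is_path v w \<Longrightarrow> eqv v (normal_form v w) (normal_form v w')"
proof (induction rule: hom.induct)
  case (hom_sym v w w')
  then show ?case using hom_is_path eqv_sym by blast
next
  case (hom_trans v w w' w'')
  then show ?case using hom_is_path rtranclp_trans by metis
next
  case (hom_swap v c d w)
  have s: "sq (mv (mv v c) d) d c" using hom_swap(1) sq_mv sq_mv2 sq_sym by blast
  have e: "mv (mv (mv v c) d) d = mv v c" "mv (mv (mv v d) c) c = mv v d" "mv (mv v c) c = v"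
    "mv (mv v c) d = mv (mv v d) c"
    using hom_swap(1) mv_mv sq_ed sq_ed_mv sq_sym sq_comm by blast+
  have "reduced (mv (mv v c) d) (normal_form (mv (mv v c) d) w)" using normal_form_reduced hom_swap(2) by auto
  from carry_square[OF this s] show ?case using e by auto
next
  case (hom_cancel v c w)
  then have "reduced v (normal_form v w)" using normal_form_reduced by (auto simp: mv_mv)
  from carry_carry[OF this hom_cancel(1)] show ?case using hom_cancel(1) by (simp add: mv_mv)
next
  case (hom_cons v c w w')
  then show ?case using carry_eqv[of "mv v c" _ _ c] by (auto simp: ed_mv mv_mv)
qed auto

end

locale simply_connected_squares = coloured_squares +
  assumes closed_hom: "is_path v w \<Longrightarrow> end_of v w = v \<Longrightarrow> hom v w []"
begin

text \<open>Reduced words are their own normal forms, and simple connectivity makes any two words with the same endpoints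
homotopic.\<close>

lemma reduced_unique:
  assumes "reduced v w" "reduced v w'" "end_of v w = end_of v w'"
  shows "eqv v w w'"
proof -
  have p: "is_path v w" "is_path v w'" using assms reduced_is_path by auto
  have "is_path v (w @ rev w')" "end_of v (w @ rev w') = v"
    using p is_path_rev[OF p(2)] assms(3) by (auto simp: is_path_append end_of_append)
  then have "hom v (w @ rev w') []" by (rule closed_hom)
  then have "hom v (w @ rev w' @ w') w'" using hom_append by fastforce
  moreover have "hom v (w @ rev w' @ w') (w @ [])"
    using hom_prepend[OF p(1)] hom_rev[OF p(2)] assms(3) by metis
  ultimately have "hom v w w'" using hom_trans hom_sym by (metis append_Nil2)
  then show ?thesis using hom_normal_form[OF _ p(1)] reduced_normal_form assms by metis
qed

lemma edge_unique:
  assumes "ed v c" "ed v d" "mv v c = mv v d"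
  shows "c = d"
proof -
  have "eqv v [c] [d]" by (rule reduced_unique) (use assms in auto)
  then have "initial v c [d]" using eqv_initial_iff[of v "[c]" "[d]" c] by simp
  then show ?thesis by simp
qed

lemma not_reduced_shorten:
  assumes "is_path v w" "\<not> reduced v w"
  obtains x c y where "w = x @ c # y" "initial (end_of v (x @ [c])) c y"
  using assms
proof (induction w arbitrary: v thesis)
  case (Cons c w)
  show ?case
  proof (cases "initial (mv v c) c w")
    case True
    then show ?thesis using Cons.prems(1)[of "[]" c w] by auto
  next
    case False
    then have "\<not> reduced (mv v c) w" "is_path (mv v c) w" using Cons.prems by auto
    from Cons.IH[OF _ this(2,1)] obtain x d y where
      "w = x @ d # y" "initial (end_of (mv v c) (x @ [d])) d y" by blast
    then show ?thesis using Cons.prems(1)[of "c # x" d y] by auto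
  qed
qed simp

end

section \<open>Locally convex pieces and shortest connecting words\<close>

text \<open>A locally convex subcomplex is given by its vertices \<open>V\<close> and by the predicate \<open>K v c\<close> that the edge of
colour \<open>c\<close> at \<open>v\<close> belongs to it. The last assumption is local convexity: a square belongs to the subcomplex
as soon as two edges at a corner do.\<close>

locale convex_part = coloured_squares +
  fixes V :: "'a set" and K :: "'a \<Rightarrow> 'b \<Rightarrow> bool"
  assumes K_ed: "K v c \<Longrightarrow> ed v c"
    and K_mv: "K v c \<Longrightarrow> K (mv v c) c"
    and K_V: "K v c \<Longrightarrow> v \<in> V"
    and K_sq: "K v c \<Longrightarrow> K v d \<Longrightarrow> sq v c d \<Longrightarrow> K (mv v c) d"
begin

fun path_in :: "'a \<Rightarrow> 'b list \<Rightarrow> bool" where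
  "path_in v [] \<longleftrightarrow> v \<in> V"
| "path_in v (c # w) \<longleftrightarrow> K v c \<and> path_in (mv v c) w"

lemma path_in_is_path: "path_in v w \<Longrightarrow> is_path v w"
  by (induction w arbitrary: v) (auto simp: K_ed)

lemma path_in_V: "path_in v w \<Longrightarrow> v \<in> V \<and> end_of v w \<in> V"
  by (induction w arbitrary: v) (auto simp: K_V)

lemma path_in_append: "path_in v (x @ y) \<longleftrightarrow> path_in v x \<and> path_in (end_of v x) y"
  using path_in_V by (induction x arbitrary: v) auto

lemma path_in_cross: "path_in v w \<Longrightarrow> cross v w c \<Longrightarrow> K v c \<Longrightarrow> K (end_of v w) c"
  by (induction w arbitrary: v) (auto intro: K_sq)

text \<open>Local convexity keeps shuffled paths inside: each square used to bring \<open>c\<close> to the front has two adjacent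
edges in the subcomplex.\<close>

lemma path_in_initial: "path_in v w \<Longrightarrow> initial v c w \<Longrightarrow> K v c \<and> path_in (mv v c) (remove1 c w)"
proof (induction w arbitrary: v)
  case (Cons d w)
  show ?case
  proof (cases "c = d")
    case False
    then have s: "sq v d c" and i: "initial (mv v d) c w" using Cons.prems by auto
    have k: "K v d" "K (mv v d) c" "path_in (mv (mv v d) c) (remove1 c w)"
      using Cons.IH[OF _ i] Cons.prems by auto
    have e: "mv (mv v d) d = v" using K_ed k mv_mv by blast
    have "K v c" using K_sq[OF K_mv[OF k(1)] k(2) sq_mv[OF s]] e by simp
    moreover have "K (mv v c) d" using K_sq[OF \<open>K v c\<close> k(1) sq_sym[OF s]] .
    ultimately show ?thesis using False k sq_comm[OF s] by auto
  qed (use Cons.prems in auto)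
qed simp

end

locale convex_pair = simply_connected_squares +
  A: convex_part ed mv sq VA KA + B: convex_part ed mv sq VB KB
  for VA KA VB KB +
  assumes A_conn: "u \<in> VA \<Longrightarrow> v \<in> VA \<Longrightarrow> \<exists>w. A.path_in u w \<and> end_of u w = v"
    and B_conn: "u \<in> VB \<Longrightarrow> v \<in> VB \<Longrightarrow> \<exists>w. B.path_in u w \<and> end_of u w = v"
begin

definition bridge :: "'a \<Rightarrow> 'b list \<Rightarrow> bool" where
  "bridge a w \<longleftrightarrow> a \<in> VA \<and> is_path a w \<and> end_of a w \<in> VB"

text \<open>Among all translates of the shortest path \<open>w0\<close>, starting at some \<open>a\<close> in \<open>VA\<close>, choose one whose end is
joined to \<open>b\<close> by a path \<open>Q\<close> inside the second subcomplex of minimal length. Then \<open>w0 @ Q\<close> is reduced, and so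
is \<open>al @ g\<close>, where \<open>al\<close> is a shortest path inside the first subcomplex from \<open>a\<close> to the point \<open>a'\<close> nearest to \<open>b\<close>.
By uniqueness of reduced words these are shuffles of each other. If \<open>al\<close> had a first letter \<open>f\<close>, it would be
initial in \<open>w0 @ Q\<close>; it is not initial in \<open>w0\<close>, which is shortest, so it comes from \<open>Q\<close> and crosses \<open>w0\<close>.
Translating \<open>w0\<close> along \<open>f\<close> then shortens \<open>Q\<close>. Hence \<open>a = a'\<close>.\<close>

theorem shortest_bridge_everywhere:
  assumes w0: "bridge a0 w0" "\<And>a w. bridge a w \<Longrightarrow> length w0 \<le> length w"
    and b: "b \<in> VB"
    and g: "a' \<in> VA" "is_path a' g" "end_of a' g = b"
    and nearest: "\<And>a w. a \<in> VA \<Longrightarrow> is_path a w \<Longrightarrow> end_of a w = b \<Longrightarrow> length g \<le> length w"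
  shows "bridge a' w0"
proof -
  define S where "S = {(a, Q). bridge a w0 \<and> B.path_in (end_of a w0) Q \<and> end_of (end_of a w0) Q = b}"
  obtain Q0 where "(a0, Q0) \<in> S"
    using B_conn[of "end_of a0 w0" b] w0 b by (auto simp: S_def bridge_def)
  then obtain z where "z \<in> S" and z: "\<And>z'. z' \<in> S \<Longrightarrow> length (snd z) \<le> length (snd z')"
    using ex_has_least_nat[of "\<lambda>z. z \<in> S" "(a0, Q0)" "\<lambda>z. length (snd z)"] by blast
  then obtain a Q where aQ: "(a, Q) \<in> S"
    and Qmin: "\<And>a1 Q1. (a1, Q1) \<in> S \<Longrightarrow> length Q \<le> length Q1"
    by (metis prod.exhaust snd_conv)
  define y where "y = end_of a w0"
  have a: "bridge a w0" "a \<in> VA" "is_path a w0" "y \<in> VB" "B.path_in y Q" "end_of y Q = b"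
    using aQ by (auto simp: S_def bridge_def y_def)
  obtain al where al: "A.path_in a al" "end_of a al = a'"
    and almin: "\<And>w. A.path_in a w \<Longrightarrow> end_of a w = a' \<Longrightarrow> length al \<le> length w"
    using ex_has_least_nat[of "\<lambda>w. A.path_in a w \<and> end_of a w = a'" _ length] A_conn[OF a(2) g(1)] by blast
  have p1: "is_path a (al @ g)" "is_path a (w0 @ Q)"
    using al g a A.path_in_is_path B.path_in_is_path by (auto simp: is_path_append y_def)
  \<comment> \<open>A cancelling pair shortens \<open>al\<close>, or \<open>g\<close>, or moves \<open>a'\<close> to a vertex nearer to \<open>b\<close>.\<close>
  have r1: "reduced a (al @ g)"
  proof (rule ccontr)
    assume "\<not> reduced a (al @ g)"
    from not_reduced_shorten[OF p1(1) this] obtain x c z where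
      x: "al @ g = x @ c # z" and i: "initial (end_of a (x @ [c])) c z" by blast
    define v where "v = end_of a (x @ [c])"
    have edc: "ed (end_of a x) c" and pz: "is_path v z"
      using p1(1) x by (auto simp: is_path_append end_of_append v_def)
    have vc: "mv v c = end_of a x" using edc by (simp add: v_def end_of_append mv_mv)
    note iz = i[folded v_def]
    note rz = initial_remove1[OF pz iz]
    show False
    proof (cases "length x < length al")
      case True
      then obtain al2 where al2: "al = x @ c # al2" "z = al2 @ g"
        using append_eq_ConsD[OF x True] by blast
      have k: "A.path_in a x" "KA (end_of a x) c" "A.path_in v al2" "end_of v al2 = a'"
        using al al2 by (auto simp: A.path_in_append v_def end_of_append)
      have kv: "KA v c" using A.K_mv[OF k(2)] by (simp add: v_def end_of_append)
      show False
      proof (cases "initial v c al2")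
        case True
        have "A.path_in (mv v c) (remove1 c al2)" using A.path_in_initial[OF k(3) True] by simp
        moreover have "end_of (mv v c) (remove1 c al2) = a'" "length al2 = Suc (length (remove1 c al2))"
          using initial_remove1[OF A.path_in_is_path[OF k(3)] True] k by auto
        ultimately have "length al \<le> length (x @ remove1 c al2)"
          by (intro almin) (use k vc in \<open>auto simp: A.path_in_append end_of_append\<close>)
        then show False using al2 \<open>length al2 = _\<close> by simp
      next
        case False
        then have cr: "cross v al2 c" "initial a' c g" using iz al2 k by (auto simp: initial_append)
        have "KA a' c" using A.path_in_cross[OF k(3) cr(1) kv] k by simp
        then have "mv a' c \<in> VA" using A.K_mv A.K_V by blast
        moreover note initial_remove1[OF g(2) cr(2)]
        ultimately show False using nearest[of "mv a' c" "remove1 c g"] g by auto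
      qed
    next
      case False
      then obtain x2 where x2: "x = al @ x2" "g = x2 @ c # z"
        using x by (metis append_eq_append_conv_if append_take_drop_id not_less)
      have "is_path a' (x2 @ remove1 c z)" "end_of a' (x2 @ remove1 c z) = b"
        using g x2 al rz vc by (auto simp: is_path_append end_of_append v_def)
      then show False using nearest[OF g(1)] x2 rz by fastforce
    qed
  qed
  \<comment> \<open>A cancelling pair shortens \<open>w0\<close>, or \<open>Q\<close>, or yields a bridge that is one letter shorter.\<close>
  have r2: "reduced a (w0 @ Q)"
  proof (rule ccontr)
    assume "\<not> reduced a (w0 @ Q)"
    from not_reduced_shorten[OF p1(2) this] obtain x c z where
      x: "w0 @ Q = x @ c # z" and i: "initial (end_of a (x @ [c])) c z" by blast
    define v where "v = end_of a (x @ [c])"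
    have edc: "ed (end_of a x) c" and pz: "is_path v z" and px: "is_path a x"
      using p1(2) x by (auto simp: is_path_append end_of_append v_def)
    have vc: "mv v c = end_of a x" using edc by (simp add: v_def end_of_append mv_mv)
    have edv: "ed v c" using edc by (simp add: v_def end_of_append ed_mv)
    note iz = i[folded v_def]
    note rz = initial_remove1[OF pz iz]
    show False
    proof (cases "length x < length w0")
      case True
      then obtain w2 where w2: "w0 = x @ c # w2" "z = w2 @ Q"
        using append_eq_ConsD[OF x True] by blast
      have k: "is_path v w2" "end_of v w2 = y"
        using a w2 by (auto simp: is_path_append v_def y_def end_of_append)
      show False
      proof (cases "initial v c w2")
        case True
        note r = initial_remove1[OF k(1) True]
        have "bridge a (x @ remove1 c w2)"
          using a px r vc k by (auto simp: bridge_def is_path_append end_of_append)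
        then show False using w0(2) w2 r by fastforce
      next
        case False
        then have cr: "cross v w2 c" "initial y c Q" using iz w2 k by (auto simp: initial_append)
        have "mv y c \<in> VB" using B.path_in_initial[OF a(5) cr(2)] B.K_mv B.K_V by blast
        then have "bridge a (x @ w2)"
          using a px vc k cross_is_path[OF edv k(1) cr(1)] by (auto simp: bridge_def is_path_append end_of_append)
        then show False using w0(2) w2 by fastforce
      qed
    next
      case False
      then obtain x2 where x2: "x = w0 @ x2" "Q = x2 @ c # z"
        using x by (metis append_eq_append_conv_if append_take_drop_id not_less)
      have k: "B.path_in y x2" "B.path_in v z"
        using a x2 by (auto simp: B.path_in_append v_def end_of_append y_def)
      have "B.path_in y (x2 @ remove1 c z)" "end_of y (x2 @ remove1 c z) = b"
        using a x2 rz vc k B.path_in_initial[OF k(2) iz] by (auto simp: B.path_in_append end_of_append v_def y_def)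
      then have "(a, x2 @ remove1 c z) \<in> S" using a by (auto simp: S_def y_def)
      then show False using Qmin x2 rz by fastforce
    qed
  qed
  have eq: "eqv a (al @ g) (w0 @ Q)"
    by (rule reduced_unique[OF r1 r2]) (use al g a in \<open>auto simp: end_of_append y_def\<close>)
  show ?thesis
  proof (cases al)
    case Nil
    then show ?thesis using al a by simp
  next
    case (Cons f al')
    then have "initial a f (w0 @ Q)" using eqv_initial[OF eq, of f] by simp
    moreover have KA: "KA a f" "mv a f \<in> VA" using al Cons A.K_mv A.K_V by auto
    moreover have "\<not> initial a f w0"
    proof
      assume f: "initial a f w0"
      have "bridge (mv a f) (remove1 f w0)"
        using initial_remove1[OF a(3) f] KA a by (auto simp: bridge_def y_def)
      then show False using w0(2) initial_remove1[OF a(3) f] by fastforce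
    qed
    ultimately have cr: "cross a w0 f" "initial y f Q" by (auto simp: initial_append y_def)
    have "B.path_in (mv y f) (remove1 f Q)" "mv y f \<in> VB"
      using B.path_in_initial[OF a(5) cr(2)] B.path_in_V by auto
    moreover have "end_of (mv y f) (remove1 f Q) = b" "length Q = Suc (length (remove1 f Q))"
      using initial_remove1[OF B.path_in_is_path[OF a(5)] cr(2)] a by auto
    moreover have "is_path (mv a f) w0" "end_of (mv a f) w0 = mv y f"
      using cross_is_path[OF A.K_ed[OF KA(1)] a(3) cr(1)] by (auto simp: y_def)
    ultimately have "(mv a f, remove1 f Q) \<in> S" using KA by (auto simp: S_def bridge_def)
    then show ?thesis using Qmin \<open>length Q = _\<close> by fastforce
  qed
qed

end

section \<open>Lifting homotopies through coverings of abstract spaces\<close>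

lemma covering_sheets:
  assumes "covering_map E q S" "x \<in> topspace S"
  obtains U \<V> where "x \<in> U" "openin S U" "\<Union>\<V> = {y \<in> topspace E. q y \<in> U}"
    "\<forall>V\<in>\<V>. openin E V" "pairwise disjnt \<V>"
    "\<forall>V\<in>\<V>. homeomorphic_map (subtopology E V) (subtopology S U) q"
  using assms(1)[unfolded covering_map_def, THEN conjunct2, THEN conjunct2, rule_format, OF assms(2)]
  by (elim exE conjE) (rule that)

text \<open>Locally two lifts either agree or are disjoint, according to whether their values are in the same sheet.\<close>

lemma covering_lift_unique:
  fixes K :: "'k::topological_space set"
  assumes cov: "covering_map E q S" and K: "connected K"
    and f: "continuous_map (top_of_set K) E f" and g: "continuous_map (top_of_set K) E g"
    and eq: "\<And>k. k \<in> K \<Longrightarrow> q (f k) = q (g k)" and k0: "k0 \<in> K" "f k0 = g k0" and k: "k \<in> K"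
  shows "f k = g k"
proof -
  have loc: "\<exists>W. openin (top_of_set K) W \<and> k \<in> W \<and>
      ((\<forall>l\<in>W. f l = g l) \<or> (\<forall>l\<in>W. f l \<noteq> g l))" if k: "k \<in> K" for k
  proof -
    have fk: "f k \<in> topspace E" "g k \<in> topspace E"
      using f g k by (auto simp: continuous_map_def)
    then have "q (f k) \<in> topspace S" using cov by (auto simp: covering_map_def)
    from covering_sheets[OF cov this] obtain U \<V> where U: "q (f k) \<in> U" "openin S U"
      "\<Union>\<V> = {y \<in> topspace E. q y \<in> U}" "\<forall>V\<in>\<V>. openin E V" "pairwise disjnt \<V>"
      "\<forall>V\<in>\<V>. homeomorphic_map (subtopology E V) (subtopology S U) q" .
    have "f k \<in> \<Union>\<V>" "g k \<in> \<Union>\<V>" using U(1,3) fk eq[OF k] by auto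
    then obtain V V' where V: "V \<in> \<V>" "f k \<in> V" and V': "V' \<in> \<V>" "g k \<in> V'" by blast
    define W where "W = {l \<in> K. f l \<in> V} \<inter> {l \<in> K. g l \<in> V'}"
    have "openin (top_of_set K) W"
      unfolding W_def using f g U(4) V V'
      by (intro openin_Int) (auto simp: continuous_map_def)
    moreover have "k \<in> W" using k V V' by (auto simp: W_def)
    moreover have "(\<forall>l\<in>W. f l = g l) \<or> (\<forall>l\<in>W. f l \<noteq> g l)"
    proof (cases "V = V'")
      case True
      have "inj_on q (topspace (subtopology E V))"
        using homeomorphic_imp_injective_map[OF bspec[OF U(6) V(1)]] .
      moreover have "V \<subseteq> topspace E" using U(4) V openin_subset by blast
      ultimately have "inj_on q V" by (simp add: Int_absorb1)
      then show ?thesis using eq True by (auto simp: W_def dest: inj_onD)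
    next
      case False
      then have "V \<inter> V' = {}" using U(5) V V' by (auto simp: pairwise_def disjnt_def)
      then show ?thesis by (auto simp: W_def)
    qed
    ultimately show ?thesis by blast
  qed
  have loc': "\<exists>W. openin (top_of_set K) W \<and> k \<in> W \<and> W \<subseteq> K \<and>
      ((\<forall>l\<in>W. f l = g l) \<or> (\<forall>l\<in>W. f l \<noteq> g l))" if "k \<in> K" for k
    using loc[OF that] openin_imp_subset by metis
  have 1: "openin (top_of_set K) {k \<in> K. f k = g k}"
  proof (subst openin_subopen, clarify)
    fix k assume k: "k \<in> K" "f k = g k"
    obtain W where "openin (top_of_set K) W" "k \<in> W" "W \<subseteq> K"
      "(\<forall>l\<in>W. f l = g l) \<or> (\<forall>l\<in>W. f l \<noteq> g l)"
      using loc'[OF k(1)] by (elim exE conjE)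
    then show "\<exists>T. openin (top_of_set K) T \<and> k \<in> T \<and> T \<subseteq> {k \<in> K. f k = g k}"
      using k by (intro exI[of _ W]) auto
  qed
  have 2: "openin (top_of_set K) {k \<in> K. f k \<noteq> g k}"
  proof (subst openin_subopen, clarify)
    fix k assume k: "k \<in> K" "f k \<noteq> g k"
    obtain W where "openin (top_of_set K) W" "k \<in> W" "W \<subseteq> K"
      "(\<forall>l\<in>W. f l = g l) \<or> (\<forall>l\<in>W. f l \<noteq> g l)"
      using loc'[OF k(1)] by (elim exE conjE)
    then show "\<exists>T. openin (top_of_set K) T \<and> k \<in> T \<and> T \<subseteq> {k \<in> K. f k \<noteq> g k}"
      using k by (intro exI[of _ W]) auto
  qed
  have "K - {k \<in> K. f k = g k} = {k \<in> K. f k \<noteq> g k}" by blast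
  then have "closedin (top_of_set K) {k \<in> K. f k = g k}"
    using 2 unfolding closedin_def by auto
  with 1 have "{k \<in> K. f k = g k} = {} \<or> {k \<in> K. f k = g k} = K"
    using K unfolding connected_clopen by blast
  then show ?thesis using k0 k by blast
qed

text \<open>Every lift of the left edge of a rectangle extends to a lift of the whole rectangle. This form is stable under
gluing rectangles in both directions, which is what the compactness argument below needs.\<close>

definition strip_lift :: "'e topology \<Rightarrow> ('e \<Rightarrow> 's) \<Rightarrow> (real \<times> real \<Rightarrow> 's) \<Rightarrow> real \<Rightarrow> real \<Rightarrow> real \<Rightarrow> real \<Rightarrow> bool" where
  "strip_lift E q h a b c d \<longleftrightarrow>
     (\<forall>l. continuous_map (top_of_set {c..d}) E l \<and> (\<forall>t\<in>{c..d}. q (l t) = h (a, t)) \<longrightarrow>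
       (\<exists>H. continuous_map (top_of_set ({a..b} \<times> {c..d})) E H \<and>
          (\<forall>z\<in>{a..b} \<times> {c..d}. q (H z) = h z) \<and> (\<forall>t\<in>{c..d}. H (a, t) = l t)))"

lemma strip_liftE:
  assumes "strip_lift E q h a b c d" "continuous_map (top_of_set {c..d}) E l"
    "\<And>t. t \<in> {c..d} \<Longrightarrow> q (l t) = h (a, t)"
  obtains H where "continuous_map (top_of_set ({a..b} \<times> {c..d})) E H"
    "\<And>z. z \<in> {a..b} \<times> {c..d} \<Longrightarrow> q (H z) = h z" "\<And>t. t \<in> {c..d} \<Longrightarrow> H (a, t) = l t"
proof -
  have "\<exists>H. continuous_map (top_of_set ({a..b} \<times> {c..d})) E H \<and>
      (\<forall>z\<in>{a..b} \<times> {c..d}. q (H z) = h z) \<and> (\<forall>t\<in>{c..d}. H (a, t) = l t)"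
    using assms(1)[unfolded strip_lift_def, rule_format, of l] assms(2,3) by simp
  then show thesis by (elim exE conjE) (rule that; (assumption | erule (1) bspec))
qed

lemma continuous_map_glue:
  fixes P Q :: "'k::topological_space set"
  assumes "closed P" "closed Q"
    and "continuous_map (top_of_set P) E f" "continuous_map (top_of_set Q) E g"
    and "\<And>x. x \<in> P \<Longrightarrow> x \<in> Q \<Longrightarrow> f x = g x"
  shows "continuous_map (top_of_set (P \<union> Q)) E (\<lambda>x. if x \<in> P then f x else g x)"
proof -
  let ?h = "\<lambda>x. if x \<in> P then f x else g x"
  have "closedin (top_of_set (P \<union> Q)) {x \<in> P \<union> Q. ?h x \<in> C}" if C: "closedin E C" for C
  proof -
    have "closedin (top_of_set P) {x \<in> P. f x \<in> C}" "closedin (top_of_set Q) {x \<in> Q. g x \<in> C}"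
      using assms(3,4) C unfolding continuous_map_closedin by auto
    then have "closed {x \<in> P. f x \<in> C}" "closed {x \<in> Q. g x \<in> C}"
      using assms(1,2) closedin_closed_trans by blast+
    then have "closed ({x \<in> P. f x \<in> C} \<union> {x \<in> Q. g x \<in> C})" by blast
    moreover have "{x \<in> P \<union> Q. ?h x \<in> C} = {x \<in> P. f x \<in> C} \<union> {x \<in> Q. g x \<in> C}"
      using assms(5) by auto
    ultimately show ?thesis by (auto intro!: closed_subset)
  qed
  moreover have "?h x \<in> topspace E" if "x \<in> P \<union> Q" for x
    using assms(3,4) that by (auto simp: continuous_map_def)
  ultimately show ?thesis unfolding continuous_map_closedin by (simp add: Pi_iff)
qed

text \<open>The two lifts agree on the common edge because they agree at its left end and that edge is connected.\<close>

lemma strip_lift_glue_down: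
  assumes cov: "covering_map E q S"
    and 1: "strip_lift E q h a b c m" and 2: "strip_lift E q h a b m d"
    and le: "c \<le> m" "m \<le> d" "a \<le> b"
  shows "strip_lift E q h a b c d"
  unfolding strip_lift_def
proof (intro allI impI, elim conjE)
  fix l assume l: "continuous_map (top_of_set {c..d}) E l" "\<forall>t\<in>{c..d}. q (l t) = h (a, t)"
  have sub: "{c..m} \<subseteq> {c..d}" "{m..d} \<subseteq> {c..d}" using le by auto
  have l1: "continuous_map (top_of_set {c..m}) E l" "continuous_map (top_of_set {m..d}) E l"
    using l(1) sub by (meson continuous_map_from_subtopology_mono)+
  obtain H where H: "continuous_map (top_of_set ({a..b} \<times> {c..m})) E H"
    "\<And>z. z \<in> {a..b} \<times> {c..m} \<Longrightarrow> q (H z) = h z" "\<And>t. t \<in> {c..m} \<Longrightarrow> H (a, t) = l t"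
    by (rule strip_liftE[OF 1 l1(1)]) (use l(2) sub in auto)
  obtain H' where H': "continuous_map (top_of_set ({a..b} \<times> {m..d})) E H'"
    "\<And>z. z \<in> {a..b} \<times> {m..d} \<Longrightarrow> q (H' z) = h z" "\<And>t. t \<in> {m..d} \<Longrightarrow> H' (a, t) = l t"
    by (rule strip_liftE[OF 2 l1(2)]) (use l(2) sub in auto)
  have "H z = H' z" if "z \<in> {a..b} \<times> {c..m}" "z \<in> {a..b} \<times> {m..d}" for z
  proof (rule covering_lift_unique[OF cov])
    show "connected ({a..b} \<times> {m})" by (intro connected_Times) auto
    show "continuous_map (top_of_set ({a..b} \<times> {m})) E H"
      "continuous_map (top_of_set ({a..b} \<times> {m})) E H'"
      using H(1) H'(1) le by (auto elim!: continuous_map_from_subtopology_mono)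
    show "q (H k) = q (H' k)" if "k \<in> {a..b} \<times> {m}" for k
      using that H(2) H'(2) le by auto
    show "(a, m) \<in> {a..b} \<times> {m}" "H (a, m) = H' (a, m)" using le H(3) H'(3) by auto
    show "z \<in> {a..b} \<times> {m}" using that by auto
  qed
  then have "continuous_map (top_of_set ({a..b} \<times> {c..m} \<union> {a..b} \<times> {m..d})) E
      (\<lambda>z. if z \<in> {a..b} \<times> {c..m} then H z else H' z)"
    by (intro continuous_map_glue H H') (auto intro: closed_Times)
  moreover have "{a..b} \<times> {c..m} \<union> {a..b} \<times> {m..d} = {a..b} \<times> {c..d}" using le by auto
  ultimately show "\<exists>H. continuous_map (top_of_set ({a..b} \<times> {c..d})) E H \<and>
      (\<forall>z\<in>{a..b} \<times> {c..d}. q (H z) = h z) \<and> (\<forall>t\<in>{c..d}. H (a, t) = l t)"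
    using H H' le by (intro exI[of _ "\<lambda>z. if z \<in> {a..b} \<times> {c..m} then H z else H' z"]) auto
qed

lemma strip_lift_glue_right:
  assumes 1: "strip_lift E q h a m c d" and 2: "strip_lift E q h m b c d"
    and le: "a \<le> m" "m \<le> b"
  shows "strip_lift E q h a b c d"
  unfolding strip_lift_def
proof (intro allI impI, elim conjE)
  fix l assume l: "continuous_map (top_of_set {c..d}) E l" "\<forall>t\<in>{c..d}. q (l t) = h (a, t)"
  obtain H where H: "continuous_map (top_of_set ({a..m} \<times> {c..d})) E H"
    "\<And>z. z \<in> {a..m} \<times> {c..d} \<Longrightarrow> q (H z) = h z" "\<And>t. t \<in> {c..d} \<Longrightarrow> H (a, t) = l t"
    by (rule strip_liftE[OF 1 l(1)]) (use l(2) in auto)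
  have "continuous_map (top_of_set {c..d}) (top_of_set ({a..m} \<times> {c..d})) (\<lambda>t. (m, t))"
    using le by (auto simp: continuous_map_in_subtopology intro!: continuous_intros)
  from continuous_map_compose[OF this H(1)]
  have "continuous_map (top_of_set {c..d}) E (\<lambda>t. H (m, t))" by (simp add: o_def)
  note Hm = this
  obtain H' where H': "continuous_map (top_of_set ({m..b} \<times> {c..d})) E H'"
    "\<And>z. z \<in> {m..b} \<times> {c..d} \<Longrightarrow> q (H' z) = h z" "\<And>t. t \<in> {c..d} \<Longrightarrow> H' (m, t) = H (m, t)"
    by (rule strip_liftE[OF 2 Hm]) (use H(2) le in auto)
  have "continuous_map (top_of_set ({a..m} \<times> {c..d} \<union> {m..b} \<times> {c..d})) E
      (\<lambda>z. if z \<in> {a..m} \<times> {c..d} then H z else H' z)"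
    using H'(3) by (intro continuous_map_glue H H') (auto intro: closed_Times)
  moreover have "{a..m} \<times> {c..d} \<union> {m..b} \<times> {c..d} = {a..b} \<times> {c..d}" using le by auto
  ultimately show "\<exists>H. continuous_map (top_of_set ({a..b} \<times> {c..d})) E H \<and>
      (\<forall>z\<in>{a..b} \<times> {c..d}. q (H z) = h z) \<and> (\<forall>t\<in>{c..d}. H (a, t) = l t)"
    using H H' le by (intro exI[of _ "\<lambda>z. if z \<in> {a..m} \<times> {c..d} then H z else H' z"]) auto
qed

text \<open>Over a rectangle inside an evenly covered set, compose with the inverse of the sheet that contains the value
of the given lift at one point of the left edge.\<close>

lemma strip_lift_local:
  assumes cov: "covering_map E q S"
    and U: "openin S U" "\<Union>\<V> = {y \<in> topspace E. q y \<in> U}"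
    "\<forall>V\<in>\<V>. homeomorphic_map (subtopology E V) (subtopology S U) q"
    and h: "continuous_map (top_of_set ({a..b} \<times> {c..d})) S h" "h ` ({a..b} \<times> {c..d}) \<subseteq> U"
    and le: "a \<le> b" "c \<le> d"
  shows "strip_lift E q h a b c d"
  unfolding strip_lift_def
proof (intro allI impI, elim conjE)
  fix l assume l: "continuous_map (top_of_set {c..d}) E l" "\<forall>t\<in>{c..d}. q (l t) = h (a, t)"
  have lc: "l c \<in> topspace E" using l(1) le by (auto simp: continuous_map_def)
  have "h (a, c) \<in> U" using h(2) le by auto
  then have "l c \<in> \<Union>\<V>" unfolding U(2) using lc l(2) le by simp
  then obtain V where V: "V \<in> \<V>" "l c \<in> V" by blast
  have verts_in: "V \<subseteq> topspace E" using U(2) V by auto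
  obtain r where r: "homeomorphic_maps (subtopology E V) (subtopology S U) q r"
    using bspec[OF U(3) V(1)] unfolding homeomorphic_map_maps by blast
  have "continuous_map (top_of_set ({a..b} \<times> {c..d})) (subtopology S U) h"
    using h by (auto simp: continuous_map_in_subtopology)
  moreover have "continuous_map (subtopology S U) (subtopology E V) r"
    using r by (simp add: homeomorphic_maps_def)
  ultimately have c: "continuous_map (top_of_set ({a..b} \<times> {c..d})) (subtopology E V) (r \<circ> h)"
    by (rule continuous_map_compose)
  then have c': "continuous_map (top_of_set ({a..b} \<times> {c..d})) E (r \<circ> h)"
    by (simp add: continuous_map_in_subtopology)
  have US: "U \<subseteq> topspace S" using U(1) openin_subset by blast
  have qr: "q (r (h z)) = h z" if "z \<in> {a..b} \<times> {c..d}" for z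
    using r h(2) that US by (auto simp: homeomorphic_maps_def)
  have rq: "r (q v) = v" if "v \<in> V" for v
    using r that verts_in by (auto simp: homeomorphic_maps_def)
  have "(r \<circ> h) (a, t) = l t" if t: "t \<in> {c..d}" for t
  proof (rule covering_lift_unique[OF cov, of "{c..d}" "\<lambda>t. (r \<circ> h) (a, t)" l c])
    have "continuous_map (top_of_set {c..d}) (top_of_set ({a..b} \<times> {c..d})) (\<lambda>t. (a, t))"
      using le by (auto simp: continuous_map_in_subtopology intro!: continuous_intros)
    from continuous_map_compose[OF this c']
    show "continuous_map (top_of_set {c..d}) E (\<lambda>t. (r \<circ> h) (a, t))" by (simp add: o_def)
    show "q ((r \<circ> h) (a, k)) = q (l k)" if "k \<in> {c..d}" for k using qr l(2) that le by auto
    show "(r \<circ> h) (a, c) = l c" using l(2) rq[OF V(2)] le by auto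
  qed (use t l le in auto)
  then show "\<exists>H. continuous_map (top_of_set ({a..b} \<times> {c..d})) E H \<and>
      (\<forall>z\<in>{a..b} \<times> {c..d}. q (H z) = h z) \<and> (\<forall>t\<in>{c..d}. H (a, t) = l t)"
    using c' qr by (intro exI[of _ "r \<circ> h"]) auto
qed

text \<open>Bolzano's bisection principle is applied twice: first to the height of a strip, which yields for each \<open>x\<close> a
width such that narrow vertical strips around \<open>x\<close> lift, then to the width.\<close>

lemma strip_lift_unit_square:
  assumes cov: "covering_map E q S"
    and h: "continuous_map (top_of_set ({0..1} \<times> {0..1})) S h"
  shows "strip_lift E q h 0 1 0 1"
proof -
  have near: "\<exists>\<epsilon>>0. \<forall>a b c d. 0 \<le> a \<and> a \<le> x \<and> x \<le> b \<and> b \<le> 1 \<and> b - a < \<epsilon> \<and>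
      0 \<le> c \<and> c \<le> y \<and> y \<le> d \<and> d \<le> 1 \<and> d - c < \<epsilon> \<longrightarrow> strip_lift E q h a b c d"
    if xy: "x \<in> {0..1}" "y \<in> {0..1}" for x y
  proof -
    have "h (x, y) \<in> topspace S" using h xy by (auto simp: continuous_map_def)
    from covering_sheets[OF cov this] obtain U \<V> where U: "h (x, y) \<in> U" "openin S U"
      "\<Union>\<V> = {y \<in> topspace E. q y \<in> U}" "\<forall>V\<in>\<V>. openin E V" "pairwise disjnt \<V>"
      "\<forall>V\<in>\<V>. homeomorphic_map (subtopology E V) (subtopology S U) q" .
    have "openin (top_of_set ({0..1} \<times> {0..1})) {z \<in> {0..1} \<times> {0..1}. h z \<in> U}"
      using h U(2) by (auto simp: continuous_map_def)
    then obtain T where T: "open T" "{z \<in> {0..1} \<times> {0..1}. h z \<in> U} = ({0..1} \<times> {0..1}) \<inter> T"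
      unfolding openin_open by blast
    have "(x, y) \<in> ({0..1} \<times> {0..1}) \<inter> T" unfolding T(2)[symmetric] using U(1) xy by simp
    then have "(x, y) \<in> T" by blast
    then obtain e where e: "e > 0" "ball (x, y) e \<subseteq> T" using T(1) open_contains_ball by blast
    have "strip_lift E q h a b c d" if *: "0 \<le> a" "a \<le> x" "x \<le> b" "b \<le> 1" "b - a < e/2"
      "0 \<le> c" "c \<le> y" "y \<le> d" "d \<le> 1" "d - c < e/2" for a b c d
    proof (rule strip_lift_local[OF cov U(2,3,6)])
      have sub: "{a..b} \<times> {c..d} \<subseteq> {0..1} \<times> {0..1}" using * by auto
      then show "continuous_map (top_of_set ({a..b} \<times> {c..d})) S h"
        using h by (rule continuous_map_from_subtopology_mono[rotated])
      show "h ` ({a..b} \<times> {c..d}) \<subseteq> U"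
      proof clarify
        fix s t assume st: "s \<in> {a..b}" "t \<in> {c..d}"
        have "dist (x, y) (s, t) \<le> dist x s + dist y t"
          unfolding dist_prod_def by (rule order_trans[OF sqrt_sum_squares_le_sum_abs]) simp
        also have "\<dots> < e" using st * by (auto simp: dist_real_def abs_if)
        finally have "(s, t) \<in> T" using e by auto
        moreover have "(s, t) \<in> {0..1} \<times> {0..1}" using st * by auto
        ultimately show "h (s, t) \<in> U" using T(2) by blast
      qed
    qed (use * in auto)
    then show ?thesis using e(1) by (intro exI[of _ "e/2"]) auto
  qed
  have col: "\<exists>\<epsilon>>0. \<forall>a b. 0 \<le> a \<and> a \<le> x \<and> x \<le> b \<and> b \<le> 1 \<and> b - a < \<epsilon> \<longrightarrow> strip_lift E q h a b 0 1"
    if x: "x \<in> {0..1}" for x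
  proof -
    define P where "P c d \<longleftrightarrow> 0 \<le> c \<and> d \<le> 1 \<longrightarrow> (\<exists>\<epsilon>>0. \<forall>a b. 0 \<le> a \<and> a \<le> x \<and> x \<le> b \<and> b \<le> 1 \<and> b - a < \<epsilon> \<longrightarrow>
      strip_lift E q h a b c d)" for c d
    have "P 0 (1::real)"
    proof (rule Bolzano[of 0 1 P])
      fix c m d :: real assume 1: "P c m" "P m d" and le: "c \<le> m" "m \<le> d"
      show "P c d"
        unfolding P_def
      proof
        assume cd: "0 \<le> c \<and> d \<le> 1"
        have "0 \<le> c \<and> m \<le> 1" "0 \<le> m \<and> d \<le> 1" using cd le by auto
        from 1(1)[unfolded P_def, rule_format, OF this(1)] 1(2)[unfolded P_def, rule_format, OF this(2)]
        obtain e e' where "e > 0" "e' > 0" and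
          e: "\<forall>a b. 0 \<le> a \<and> a \<le> x \<and> x \<le> b \<and> b \<le> 1 \<and> b - a < e \<longrightarrow> strip_lift E q h a b c m" and
          e': "\<forall>a b. 0 \<le> a \<and> a \<le> x \<and> x \<le> b \<and> b \<le> 1 \<and> b - a < e' \<longrightarrow> strip_lift E q h a b m d"
          by (elim exE conjE)
        show "\<exists>\<epsilon>>0. \<forall>a b. 0 \<le> a \<and> a \<le> x \<and> x \<le> b \<and> b \<le> 1 \<and> b - a < \<epsilon> \<longrightarrow> strip_lift E q h a b c d"
          using \<open>e > 0\<close> \<open>e' > 0\<close> e e' le
          by (intro exI[of _ "min e e'"]) (auto intro!: strip_lift_glue_down[OF cov, of h _ _ c m d])
      qed
    next
      fix y :: real assume "0 \<le> y" "y \<le> 1"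
      then obtain e where "e > 0" and
        e: "\<And>a b c d. 0 \<le> a \<and> a \<le> x \<and> x \<le> b \<and> b \<le> 1 \<and> b - a < e \<and>
          0 \<le> c \<and> c \<le> y \<and> y \<le> d \<and> d \<le> 1 \<and> d - c < e \<Longrightarrow> strip_lift E q h a b c d"
        using near[of x y] x by auto
      then show "\<exists>d>0. \<forall>a b. a \<le> y \<and> y \<le> b \<and> b - a < d \<longrightarrow> P a b"
        unfolding P_def by (intro exI[of _ e]) blast
    qed simp
    then show ?thesis by (simp add: P_def)
  qed
  define P where "P a b \<longleftrightarrow> 0 \<le> a \<and> b \<le> 1 \<longrightarrow> strip_lift E q h a b 0 1" for a b
  have "P 0 1"
  proof (rule Bolzano[of 0 1 P])
    fix a m b :: real assume "P a m" "P m b" "a \<le> m" "m \<le> b"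
    then show "P a b" unfolding P_def by (auto intro: strip_lift_glue_right[of E q h a m 0 1 b])
  next
    fix x :: real assume "0 \<le> x" "x \<le> 1"
    then show "\<exists>d>0. \<forall>a b. a \<le> x \<and> x \<le> b \<and> b - a < d \<longrightarrow> P a b"
      using col[of x] unfolding P_def by (meson atLeastAtMost_iff)
  qed simp
  then show ?thesis by (simp add: P_def)
qed

text \<open>Lift a free homotopy from \<open>q \<circ> g\<close> to a constant loop, starting with \<open>g\<close>. At the end the lift is constant, and
the two paths traced by the endpoints lift the same path of base points; so they agree at the beginning, too.\<close>

lemma nullhomotopic_lift_closed:
  assumes cov: "covering_map E q S" and g: "pathin E g"
    and hom: "homotopic_with (\<lambda>r. r 1 = r 0) (top_of_set {0..1}) S (q \<circ> g) (\<lambda>_. x)"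
  shows "g 1 = g 0"
proof -
  obtain h :: "real \<times> real \<Rightarrow> _" where h: "continuous_map (prod_topology (top_of_set {0..1}) (top_of_set {0..1})) S h"
    "\<And>t. h (0, t) = q (g t)" "\<And>t. h (1, t) = x" "\<forall>s\<in>{0..1}. h (s, 1) = h (s, 0)"
    using hom[unfolded homotopic_with_def] by (elim exE conjE) (rule that, simp_all)
  have hc: "continuous_map (top_of_set ({0..1} \<times> {0..1})) S h"
    using h(1) by (simp add: subtopology_Times[symmetric] euclidean_product_topology)
  have gc: "continuous_map (top_of_set {0..1}) E g" using g by (simp add: pathin_def)
  obtain H where H: "continuous_map (top_of_set ({0..1} \<times> {0..1})) E H"
    "\<And>z. z \<in> {0..1} \<times> {0..1} \<Longrightarrow> q (H z) = h z" "\<And>t. t \<in> {0..1} \<Longrightarrow> H (0, t) = g t"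
    by (rule strip_liftE[OF strip_lift_unit_square[OF cov hc] gc]) (use h(2) in auto)
  have slice: "continuous_map (top_of_set {0..1::real}) E (\<lambda>t. H (f t))"
    if "continuous_on {0..1} f" "f ` {0..1} \<subseteq> {0..1} \<times> {0..1}" for f
    using continuous_map_compose[OF _ H(1), of "top_of_set {0..1}" f] that
    by (auto simp: continuous_map_in_subtopology o_def)
  have "H (1, 1) = H (1, 0)"
  proof (rule covering_lift_unique[OF cov, of "{0..1}" "\<lambda>t. H (1, t)" "\<lambda>t. H (1, 0)" 0 1])
    show "continuous_map (top_of_set {0..1}) E (\<lambda>t. H (1, t))"
      by (rule slice) (auto intro!: continuous_intros)
    show "continuous_map (top_of_set {0..1::real}) E (\<lambda>t. H (1, 0))"
      by (rule slice[of "\<lambda>t. (1, 0)"]) (auto intro!: continuous_intros)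
  qed (use H(2) h(3) in auto)
  then have "H (0, 1) = H (0, 0)"
  proof -
    show ?thesis
    proof (rule covering_lift_unique[OF cov, of "{0..1}" "\<lambda>s. H (s, 1)" "\<lambda>s. H (s, 0)" 1 0])
      show "continuous_map (top_of_set {0..1}) E (\<lambda>s. H (s, 1))"
        "continuous_map (top_of_set {0..1}) E (\<lambda>s. H (s, 0))"
        by (rule slice[of "\<lambda>s. (s, 1)"] slice[of "\<lambda>s. (s, 0)"]; auto intro!: continuous_intros)+
    qed (use \<open>H (1, 1) = H (1, 0)\<close> H(2) h(4) in auto)
  qed
  then show ?thesis using H(3) by auto
qed

section \<open>Faces of cubes\<close>

lemma open_cube_subset: "u \<in> open_cube n \<Longrightarrow> u \<in> cube n"
  unfolding open_cube_def cube_def by (auto intro: less_imp_le)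

lemma origin_cube [simp]: "origin \<in> cube n"
  by (simp add: cube_def)

lemma face_mapE:
  assumes "face_map m n f"
  obtains \<iota> where "inj_on \<iota> {..<m}" "\<And>j. j < m \<Longrightarrow> \<iota> j < n"
    "\<And>j. j < m \<Longrightarrow> (\<forall>t\<in>cube m. f t (\<iota> j) = t j) \<or> (\<forall>t\<in>cube m. f t (\<iota> j) = 1 - t j)"
    "\<And>i. i < n \<Longrightarrow> i \<notin> \<iota> ` {..<m} \<Longrightarrow> (\<forall>t\<in>cube m. f t i = 0) \<or> (\<forall>t\<in>cube m. f t i = 1)"
    "\<And>i t. i \<ge> n \<Longrightarrow> t \<in> cube m \<Longrightarrow> f t i = 0"
  using assms unfolding face_map_def by (auto simp: image_subset_iff)

lemma face_mapI:
  assumes "inj_on \<iota> {..<m}" "\<And>j. j < m \<Longrightarrow> \<iota> j < n"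
    "\<And>j. j < m \<Longrightarrow> (\<forall>t\<in>cube m. f t (\<iota> j) = t j) \<or> (\<forall>t\<in>cube m. f t (\<iota> j) = 1 - t j)"
    "\<And>i. i < n \<Longrightarrow> i \<notin> \<iota> ` {..<m} \<Longrightarrow> (\<forall>t\<in>cube m. f t i = 0) \<or> (\<forall>t\<in>cube m. f t i = 1)"
    "\<And>i t. i \<ge> n \<Longrightarrow> t \<in> cube m \<Longrightarrow> f t i = 0"
  shows "face_map m n f"
  unfolding face_map_def using assms by (intro exI[of _ \<iota>]) auto

lemma face_map_coord:
  assumes "face_map m n f" "i < n"
  obtains (direct) j where "j < m" "\<And>t. t \<in> cube m \<Longrightarrow> f t i = t j"
    | (flipped) j where "j < m" "\<And>t. t \<in> cube m \<Longrightarrow> f t i = 1 - t j"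
    | (zero) "\<And>t. t \<in> cube m \<Longrightarrow> f t i = 0"
    | (one) "\<And>t. t \<in> cube m \<Longrightarrow> f t i = 1"
  using assms(1)
proof (rule face_mapE)
  fix \<iota> assume *: "\<And>j. j < m \<Longrightarrow> (\<forall>t\<in>cube m. f t (\<iota> j) = t j) \<or> (\<forall>t\<in>cube m. f t (\<iota> j) = 1 - t j)"
    "\<And>i. i < n \<Longrightarrow> i \<notin> \<iota> ` {..<m} \<Longrightarrow> (\<forall>t\<in>cube m. f t i = 0) \<or> (\<forall>t\<in>cube m. f t i = 1)"
  show thesis
  proof (cases "i \<in> \<iota> ` {..<m}")
    case True
    then obtain j where "j < m" "i = \<iota> j" by auto
    then show thesis using *(1)[of j] direct flipped by blast
  next
    case False
    then show thesis using *(2)[of i] assms(2) zero one by blast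
  qed
qed

lemma face_map_coord_inv:
  assumes "face_map m n f" "j < m"
  obtains i where "i < n" "(\<forall>t\<in>cube m. f t i = t j) \<or> (\<forall>t\<in>cube m. f t i = 1 - t j)"
  using face_mapE[OF assms(1)] assms(2) by metis

lemma face_map_outside: "face_map m n f \<Longrightarrow> t \<in> cube m \<Longrightarrow> i \<ge> n \<Longrightarrow> f t i = 0"
  by (erule face_mapE) auto

lemma cube_coord: "t \<in> cube m \<Longrightarrow> 0 \<le> t j \<and> t j \<le> 1"
  unfolding cube_def by (cases "j < m") auto

lemma face_map_cube:
  assumes "face_map m n f" "t \<in> cube m"
  shows "f t \<in> cube n"
proof -
  have "0 \<le> f t i \<and> f t i \<le> 1" if "i < n" for i
    using assms(1) that
    by (cases rule: face_map_coord) (use cube_coord[OF assms(2)] assms(2) in auto)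
  then show ?thesis using face_map_outside[OF assms] by (simp add: cube_def)
qed

lemma face_map_compose:
  assumes f: "face_map k m f" and g: "face_map m n g"
  shows "face_map k n (\<lambda>t. g (f t))"
proof -
  from f obtain \<iota> where i: "inj_on \<iota> {..<k}" "\<And>j. j < k \<Longrightarrow> \<iota> j < m"
    "\<And>j. j < k \<Longrightarrow> (\<forall>t\<in>cube k. f t (\<iota> j) = t j) \<or> (\<forall>t\<in>cube k. f t (\<iota> j) = 1 - t j)"
    "\<And>i. i < m \<Longrightarrow> i \<notin> \<iota> ` {..<k} \<Longrightarrow> (\<forall>t\<in>cube k. f t i = 0) \<or> (\<forall>t\<in>cube k. f t i = 1)"
    by (rule face_mapE) blast
  from g obtain \<kappa> where k: "inj_on \<kappa> {..<m}" "\<And>j. j < m \<Longrightarrow> \<kappa> j < n"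
    "\<And>j. j < m \<Longrightarrow> (\<forall>t\<in>cube m. g t (\<kappa> j) = t j) \<or> (\<forall>t\<in>cube m. g t (\<kappa> j) = 1 - t j)"
    "\<And>i. i < n \<Longrightarrow> i \<notin> \<kappa> ` {..<m} \<Longrightarrow> (\<forall>t\<in>cube m. g t i = 0) \<or> (\<forall>t\<in>cube m. g t i = 1)"
    by (rule face_mapE) blast
  have fc: "f t \<in> cube m" if "t \<in> cube k" for t using face_map_cube[OF f that] .
  show ?thesis
  proof (rule face_mapI[of "\<kappa> \<circ> \<iota>"])
    show "inj_on (\<kappa> \<circ> \<iota>) {..<k}"
      using i(1,2) k(1) by (intro comp_inj_on) (auto intro: inj_on_subset)
    show "(\<kappa> \<circ> \<iota>) j < n" if "j < k" for j using that i k by auto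
    show "(\<forall>t\<in>cube k. g (f t) ((\<kappa> \<circ> \<iota>) j) = t j) \<or> (\<forall>t\<in>cube k. g (f t) ((\<kappa> \<circ> \<iota>) j) = 1 - t j)"
      if "j < k" for j
      using i(3)[OF that] k(3)[OF i(2)[OF that]] fc by auto
    show "(\<forall>t\<in>cube k. g (f t) l = 0) \<or> (\<forall>t\<in>cube k. g (f t) l = 1)"
      if "l < n" "l \<notin> (\<kappa> \<circ> \<iota>) ` {..<k}" for l
    proof (cases "l \<in> \<kappa> ` {..<m}")
      case True
      then obtain j where j: "j < m" "l = \<kappa> j" by auto
      then have "j \<notin> \<iota> ` {..<k}" using that by auto
      then show ?thesis using i(4)[OF j(1)] k(3)[OF j(1)] fc j by auto
    next
      case False
      then show ?thesis using k(4)[OF that(1)] fc by auto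
    qed
    show "g (f t) l = 0" if "l \<ge> n" "t \<in> cube k" for l t
      using face_map_outside[OF g fc] that by blast
  qed
qed

text \<open>The coordinates strictly between 0 and 1 parametrise the open face that contains the point.\<close>

lemma carrier_face:
  assumes "t \<in> cube n"
  obtains k f u where "face_map k n f" "u \<in> open_cube k" "f u = t"
proof -
  define I where "I = {i. i < n \<and> 0 < t i \<and> t i < 1}"
  have "finite I" unfolding I_def by simp
  then obtain \<iota> where \<iota>: "bij_betw \<iota> {..<card I} I"
    by (metis atLeast0LessThan ex_bij_betw_nat_finite)
  define \<rho> where "\<rho> = inv_into {..<card I} \<iota>"
  have \<rho>: "\<rho> (\<iota> j) = j" if "j < card I" for j
    unfolding \<rho>_def using \<iota> that by (auto simp: bij_betw_def inv_into_f_f)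
  have \<iota>I: "\<iota> j \<in> I" if "j < card I" for j using \<iota> that by (auto simp: bij_betw_def)
  have \<rho>': "\<iota> (\<rho> i) = i" "\<rho> i < card I" if "i \<in> I" for i
    unfolding \<rho>_def using \<iota> that inv_into_into[of i \<iota> "{..<card I}"] by (auto simp: bij_betw_def f_inv_into_f)
  define f where "f x i = (if i \<in> I then x (\<rho> i) else t i)" for x :: "nat \<Rightarrow> real" and i
  define u where "u j = (if j < card I then t (\<iota> j) else 0)" for j
  have t01: "t i = 0 \<or> t i = 1" if "i < n" "i \<notin> I" for i
    using assms that unfolding I_def cube_def by force
  show thesis
  proof
    show "face_map (card I) n f"
    proof (rule face_mapI[of \<iota>])
      show "inj_on \<iota> {..<card I}" using \<iota> by (simp add: bij_betw_def)
      show "\<iota> j < n" if "j < card I" for j using \<iota>I[OF that] by (simp add: I_def)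
      show "(\<forall>t\<in>cube (card I). f t (\<iota> j) = t j) \<or> (\<forall>t\<in>cube (card I). f t (\<iota> j) = 1 - t j)"
        if "j < card I" for j
        using \<rho>[OF that] \<iota>I[OF that] by (simp add: f_def)
      show "(\<forall>t\<in>cube (card I). f t i = 0) \<or> (\<forall>t\<in>cube (card I). f t i = 1)"
        if "i < n" "i \<notin> \<iota> ` {..<card I}" for i
        using that t01[of i] \<iota> by (auto simp: f_def bij_betw_def)
      show "f x i = 0" if "n \<le> i" "x \<in> cube (card I)" for i x
        using that assms by (auto simp: f_def I_def cube_def)
    qed
    show "u \<in> open_cube (card I)" using \<iota>I by (auto simp: u_def open_cube_def I_def)
    show "f u = t" using \<rho>' by (auto simp: f_def u_def)
  qed
qed

lemma face_map_open:
  assumes "face_map n n h" "t \<in> open_cube n"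
  shows "h t \<in> open_cube n"
proof -
  from assms(1) obtain \<iota> where i: "inj_on \<iota> {..<n}" "\<And>j. j < n \<Longrightarrow> \<iota> j < n"
    "\<And>j. j < n \<Longrightarrow> (\<forall>t\<in>cube n. h t (\<iota> j) = t j) \<or> (\<forall>t\<in>cube n. h t (\<iota> j) = 1 - t j)"
    "\<And>i t. i \<ge> n \<Longrightarrow> t \<in> cube n \<Longrightarrow> h t i = 0"
    by (rule face_mapE) blast
  have im: "\<iota> ` {..<n} = {..<n}" using i(1,2) by (intro endo_inj_surj) auto
  have "0 < h t l \<and> h t l < 1" if l: "l < n" for l
  proof -
    from l im obtain j where "j < n" "l = \<iota> j" by (metis imageE lessThan_iff)
    then show ?thesis using i(3)[of j] open_cube_subset[OF assms(2)] assms(2)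
      by (auto simp: open_cube_def)
  qed
  then show ?thesis using i(4) open_cube_subset[OF assms(2)] by (auto simp: open_cube_def)
qed

text \<open>A point is in the face if it agrees with one interior point of the face in the coordinates that are constant
on it. The last conclusion recognises interior points of the face.\<close>

lemma face_map_range:
  assumes f: "face_map k n f" and u: "u \<in> open_cube k" and t: "t \<in> cube n"
    and const: "\<And>i. i < n \<Longrightarrow> f u i = 0 \<or> f u i = 1 \<Longrightarrow> t i = f u i"
  obtains x where "x \<in> cube k" "f x = t"
    "(\<And>i. i < n \<Longrightarrow> f u i \<noteq> 0 \<Longrightarrow> f u i \<noteq> 1 \<Longrightarrow> 0 < t i \<and> t i < 1) \<Longrightarrow> x \<in> open_cube k"
proof -
  note uc = open_cube_subset[OF u]
  from f obtain \<iota> where i: "inj_on \<iota> {..<k}" "\<And>j. j < k \<Longrightarrow> \<iota> j < n"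
    "\<And>j. j < k \<Longrightarrow> (\<forall>t\<in>cube k. f t (\<iota> j) = t j) \<or> (\<forall>t\<in>cube k. f t (\<iota> j) = 1 - t j)"
    "\<And>i. i < n \<Longrightarrow> i \<notin> \<iota> ` {..<k} \<Longrightarrow> (\<forall>t\<in>cube k. f t i = 0) \<or> (\<forall>t\<in>cube k. f t i = 1)"
    by (rule face_mapE) blast
  define x where "x j = (if j < k then if \<forall>t\<in>cube k. f t (\<iota> j) = t j then t (\<iota> j) else 1 - t (\<iota> j)
    else 0)" for j
  have x: "x \<in> cube k" using cube_coord[OF t] by (auto simp: x_def cube_def)
  have fx: "f x l = t l" for l
  proof -
    consider j where "j < k" "l = \<iota> j" | "l < n" "l \<notin> \<iota> ` {..<k}" | "l \<ge> n"
      by (cases "l < n") auto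
    then show ?thesis
    proof cases
      case 1
      then show ?thesis using i(3)[OF 1(1)] x
        by (cases "\<forall>t\<in>cube k. f t (\<iota> j) = t j") (auto simp: x_def)
    next
      case 2
      then show ?thesis using i(4)[OF 2] const[of l] x uc by auto
    next
      case 3
      then show ?thesis using face_map_outside[OF f x] t by (auto simp: cube_def)
    qed
  qed
  have xo: "x \<in> open_cube k"
    if *: "\<And>i. i < n \<Longrightarrow> f u i \<noteq> 0 \<Longrightarrow> f u i \<noteq> 1 \<Longrightarrow> 0 < t i \<and> t i < 1"
  proof -
    have "0 < t (\<iota> j) \<and> t (\<iota> j) < 1" if "j < k" for j
    proof (rule *)
      show "\<iota> j < n" using i that by auto
      have "0 < u j" "u j < 1" using u that by (auto simp: open_cube_def)
      moreover have "f u (\<iota> j) = u j \<or> f u (\<iota> j) = 1 - u j" using i(3)[OF that] uc by blast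
      ultimately show "f u (\<iota> j) \<noteq> 0" "f u (\<iota> j) \<noteq> 1" by auto
    qed
    then show ?thesis by (auto simp: open_cube_def x_def)
  qed
  show thesis by (rule that[OF x ext[OF fx] xo])
qed

text \<open>Which coordinates are constant on a face can be read off at any interior point.\<close>

lemma face_map_uniform:
  assumes f: "face_map k n f" and u: "u \<in> open_cube k" "v \<in> open_cube k" and "i < n"
  shows "f u i = 0 \<longleftrightarrow> f v i = 0" "f u i = 1 \<longleftrightarrow> f v i = 1"
    "f u i \<noteq> 0 \<Longrightarrow> f u i \<noteq> 1 \<Longrightarrow> 0 < f v i \<and> f v i < 1"
proof -
  have o: "0 < w j" "w j < 1" if "j < k" "w \<in> open_cube k" for j w
    using that by (auto simp: open_cube_def)
  show "f u i = 0 \<longleftrightarrow> f v i = 0" "f u i = 1 \<longleftrightarrow> f v i = 1"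
    "f u i \<noteq> 0 \<Longrightarrow> f u i \<noteq> 1 \<Longrightarrow> 0 < f v i \<and> f v i < 1"
    using f \<open>i < n\<close>
    by (cases rule: face_map_coord;
        use u[THEN open_cube_subset] o[OF _ u(1)] o[OF _ u(2)] in fastforce)+
qed

section \<open>Common faces in a cube complex\<close>

lemma cc_ext: "is_cube_complex Y \<Longrightarrow> s \<in> Y n \<Longrightarrow> s \<in> extensional (cube n)"
  unfolding is_cube_complex_def by (elim conjE) (erule allE[of _ n], erule subsetD)

lemma cc_face:
  assumes "is_cube_complex Y" "s \<in> Y n" "face_map m n f"
  shows "compose (cube m) s f \<in> Y m"
  using assms(1)[unfolded is_cube_complex_def, THEN conjunct2, THEN conjunct1, rule_format, OF assms(2,3)] .

lemma cc_inj:
  assumes "is_cube_complex Y" "s \<in> Y n" shows "inj_on s (open_cube n)"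
  using assms(1)[unfolded is_cube_complex_def, THEN conjunct2, THEN conjunct2, THEN conjunct1,
      rule_format, OF assms(2)] .

lemma cc_open:
  assumes "is_cube_complex Y" "s \<in> Y m" "s' \<in> Y n" "u \<in> open_cube m" "u' \<in> open_cube n" "s u = s' u'"
  obtains f where "m = n" "face_map n n f" "s' = compose (cube n) s f"
  using assms(1)[unfolded is_cube_complex_def, THEN conjunct2, THEN conjunct2, THEN conjunct2,
      rule_format, OF assms(2-6)] that by blast

text \<open>A cube through an interior point of \<open>\<kappa>\<close> has \<open>\<kappa>\<close> as the face carrying that point, up to a symmetry of
\<open>\<kappa>\<close>, which injectivity on open cubes identifies.\<close>

lemma open_point_face:
  assumes Y: "is_cube_complex Y" and k: "\<kappa> \<in> Y k" "u \<in> open_cube k"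
    and s: "s \<in> Y n" "t \<in> cube n" and eq: "\<kappa> u = s t"
  obtains f where "face_map k n f" "f u = t" "\<And>x. x \<in> cube k \<Longrightarrow> s (f x) = \<kappa> x"
proof -
  obtain l g v where g: "face_map l n g" "v \<in> open_cube l" "g v = t" using carrier_face[OF s(2)] .
  have gY: "compose (cube l) s g \<in> Y l" using cc_face[OF Y s(1) g(1)] .
  have "compose (cube l) s g v = \<kappa> u"
    using g open_cube_subset eq by (auto simp: compose_def)
  from cc_open[OF Y gY k(1) g(2) k(2) this]
  obtain h where h: "l = k" "face_map k k h" "\<kappa> = compose (cube k) (compose (cube l) s g) h" .
  have hc: "h x \<in> cube k" if "x \<in> cube k" for x using face_map_cube[OF h(2) that] .
  have ho: "h u \<in> open_cube k" using face_map_open[OF h(2) k(2)] .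
  have "compose (cube l) s g (h u) = compose (cube l) s g v"
    using \<open>compose (cube l) s g v = \<kappa> u\<close> h open_cube_subset[OF k(2)] by (simp add: compose_def)
  then have "h u = v" using cc_inj[OF Y gY] ho g h by (auto dest: inj_onD)
  show thesis
  proof (rule that)
    show "face_map k n (\<lambda>x. g (h x))" using face_map_compose h g by blast
    show "g (h u) = t" using \<open>h u = v\<close> g by simp
    show "s (g (h x)) = \<kappa> x" if "x \<in> cube k" for x
      using h hc[OF that] that by (simp add: compose_def)
  qed
qed

text \<open>Cubes meet in common faces, even though faces of one cube may be glued to each other.\<close>

lemma common_face:
  assumes Y: "is_cube_complex Y" and s: "s \<in> Y n" "t \<in> cube n" and s': "s' \<in> Y n'" "t' \<in> cube n'"
    and eq: "s t = s' t'"
  obtains k f f' u where "face_map k n f" "face_map k n' f'" "u \<in> open_cube k" "f u = t" "f' u = t'"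
    "\<And>x. x \<in> cube k \<Longrightarrow> s (f x) = s' (f' x)"
proof -
  obtain k f u where f: "face_map k n f" "u \<in> open_cube k" "f u = t" using carrier_face[OF s(2)] .
  have fY: "compose (cube k) s f \<in> Y k" using cc_face[OF Y s(1) f(1)] .
  have "compose (cube k) s f u = s' t'" using f open_cube_subset eq by (auto simp: compose_def)
  from open_point_face[OF Y fY f(2) s' this] obtain f' where
    "face_map k n' f'" "f' u = t'" "\<And>x. x \<in> cube k \<Longrightarrow> s' (f' x) = compose (cube k) s f x"
    by blast
  then show thesis using that f by (auto simp: compose_def)
qed

lemma face_param_unique:
  assumes Y: "is_cube_complex Y" and s: "s \<in> Y n"
    and f: "face_map k n f" and g: "face_map k n g" and u: "u \<in> open_cube k" "f u = g u"
    and eq: "\<And>x. x \<in> cube k \<Longrightarrow> s (f x) = s (g x)" and x: "x \<in> open_cube k"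
  shows "f x = g x"
proof -
  note xc = open_cube_subset[OF x]
  obtain y where y: "y \<in> cube k" "f y = g x" and yo:
    "(\<And>i. i < n \<Longrightarrow> f u i \<noteq> 0 \<Longrightarrow> f u i \<noteq> 1 \<Longrightarrow> 0 < g x i \<and> g x i < 1) \<Longrightarrow> y \<in> open_cube k"
  proof (rule face_map_range[OF f u(1) face_map_cube[OF g xc]])
    show "g x i = f u i" if "i < n" "f u i = 0 \<or> f u i = 1" for i
      using face_map_uniform[OF g u(1) x that(1)] that u(2) by auto
  qed blast
  have "y \<in> open_cube k"
    by (rule yo) (use face_map_uniform(3)[OF g u(1) x] u(2) in auto)
  moreover have "compose (cube k) s f y = compose (cube k) s f x"
    using y xc eq by (simp add: compose_def)
  ultimately have "y = x" using cc_inj[OF Y cc_face[OF Y s f]] x by (auto dest: inj_onD)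
  then show ?thesis using y by simp
qed

text \<open>The point with all coordinates \<open>1/4\<close> reveals the type of each coordinate function: its values
\<open>0\<close>, \<open>1\<close>, \<open>1/4\<close> and \<open>3/4\<close> correspond to the values \<open>0\<close>, \<open>1\<close>, \<open>0\<close> and \<open>1\<close> at the origin.\<close>

lemma face_param_unique_origin:
  assumes f: "face_map k n f" and g: "face_map k n g"
    and eq: "\<And>x. x \<in> open_cube k \<Longrightarrow> f x = g x"
  shows "f origin = g origin"
proof
  fix i
  define q :: "nat \<Rightarrow> real" where "q j = (if j < k then 1/4 else 0)" for j
  have q: "q \<in> open_cube k" by (auto simp: q_def open_cube_def)
  have *: "h origin i = (if h q i < 1/2 then 0 else 1)" if "face_map k n h" "i < n" for h
    using that by (cases rule: face_map_coord) (use open_cube_subset[OF q] in \<open>auto simp: q_def\<close>)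
  show "f origin i = g origin i"
    using *[OF f] *[OF g] eq[OF q] face_map_outside[OF f origin_cube] face_map_outside[OF g origin_cube]
    by (cases "i < n") auto
qed

section \<open>Cubical coverings are coverings\<close>

lemma topspace_cc [simp]: "topspace (cc_topology X) = points X"
proof -
  have "openin (cc_topology X) (points X)"
    unfolding openin_cc_topology
  proof (intro conjI allI ballI subset_refl)
    fix n s assume "s \<in> X n"
    then have "{t \<in> cube n. s t \<in> points X} = cube n" by (auto simp: points_def)
    then show "openin (top_of_set (cube n)) {t \<in> cube n. s t \<in> points X}" by simp
  qed
  then show ?thesis by (meson openin_cc_topology openin_subset openin_topspace subset_antisym)
qed

lemma pointsI: "s \<in> X n \<Longrightarrow> t \<in> cube n \<Longrightarrow> s t \<in> points X"
  by (auto simp: points_def)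

lemma pointsE:
  assumes "x \<in> points X" obtains n s t where "s \<in> X n" "t \<in> cube n" "x = s t"
  using assms by (auto simp: points_def)

lemma cube_continuous:
  assumes "s \<in> X n" shows "continuous_map (top_of_set (cube n)) (cc_topology X) s"
proof -
  have "openin (top_of_set (cube n)) {t \<in> cube n. s t \<in> U}" if "openin (cc_topology X) U" for U
    using that assms unfolding openin_cc_topology by simp
  then show ?thesis using pointsI[of s X n, OF assms] by (simp add: continuous_map_def Pi_iff)
qed

lemma continuous_map_from_cc:
  assumes "\<And>n s. s \<in> X n \<Longrightarrow> continuous_map (top_of_set (cube n)) T (\<lambda>t. f (s t))"
  shows "continuous_map (cc_topology X) T f"
proof -
  have top: "f x \<in> topspace T" if x: "x \<in> points X" for x
  proof -
    obtain n s t where s: "s \<in> X n" "t \<in> cube n" "x = s t" using x by (rule pointsE)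
    show ?thesis using assms[OF s(1)] s(2,3) by (auto simp: continuous_map_def)
  qed
  have "openin (cc_topology X) {x \<in> points X. f x \<in> U}" if U: "openin T U" for U
    unfolding openin_cc_topology
  proof (intro conjI allI ballI)
    fix n s assume s: "s \<in> X n"
    have "{t \<in> cube n. s t \<in> {x \<in> points X. f x \<in> U}} = {t \<in> cube n. f (s t) \<in> U}"
      using pointsI[of s X n, OF s] by auto
    then show "openin (top_of_set (cube n)) {t \<in> cube n. s t \<in> {x \<in> points X. f x \<in> U}}"
      using assms[OF s] U by (simp add: continuous_map_def)
  qed auto
  then show ?thesis using top by (simp add: continuous_map_def Pi_iff)
qed

text \<open>The values of \<open>coords\<close> and hence the radius \<open>gap\<close> depend only on the point of the complex and not on the cube
in which it is read, because symmetries and face maps only permute coordinates, reflect them and add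
coordinates 0 and 1. Two preimages of a point in one cube differ in some coordinate by at least \<open>2 * gap\<close>, so
balls of radius \<open>gap\<close> around them are disjoint. This is what makes \<open>star\<close> evenly covered.\<close>

definition coords :: "nat \<Rightarrow> (nat \<Rightarrow> real) \<Rightarrow> real set" where
  "coords n t = {0, 1} \<union> t ` {..<n} \<union> (\<lambda>i. 1 - t i) ` {..<n}"

definition gap :: "nat \<Rightarrow> (nat \<Rightarrow> real) \<Rightarrow> real" where
  "gap n t = Min ((\<lambda>(a, b). \<bar>a - b\<bar>) ` {(a, b). a \<in> coords n t \<and> b \<in> coords n t \<and> a \<noteq> b}) / 2"

definition near :: "nat \<Rightarrow> (nat \<Rightarrow> real) \<Rightarrow> (nat \<Rightarrow> real) \<Rightarrow> bool" where
  "near n t0 t \<longleftrightarrow> (\<forall>i<n. \<bar>t i - t0 i\<bar> < gap n t0)"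

lemma finite_coords_pairs:
  "finite ((\<lambda>(a, b). \<bar>a - b\<bar>) ` {(a, b). a \<in> coords n t \<and> b \<in> coords n t \<and> a \<noteq> b})"
proof (rule finite_imageI, rule finite_subset)
  show "{(a, b). a \<in> coords n t \<and> b \<in> coords n t \<and> a \<noteq> b} \<subseteq> coords n t \<times> coords n t" by auto
  show "finite (coords n t \<times> coords n t)" by (simp add: coords_def)
qed

lemma gap_le:
  assumes "a \<in> coords n t" "b \<in> coords n t" "a \<noteq> b"
  shows "2 * gap n t \<le> \<bar>a - b\<bar>"
proof -
  have "\<bar>a - b\<bar> \<in> (\<lambda>(a, b). \<bar>a - b\<bar>) ` {(a, b). a \<in> coords n t \<and> b \<in> coords n t \<and> a \<noteq> b}"
    using assms by (intro image_eqI[of _ _ "(a, b)"]) auto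
  from Min_le[OF finite_coords_pairs this] show ?thesis by (simp add: gap_def)
qed

lemma gap_pos: "gap n t > 0"
proof -
  have "(0, 1) \<in> {(a, b). a \<in> coords n t \<and> b \<in> coords n t \<and> a \<noteq> b}" by (auto simp: coords_def)
  then have ne: "(\<lambda>(a, b). \<bar>a - b\<bar>) ` {(a, b). a \<in> coords n t \<and> b \<in> coords n t \<and> a \<noteq> b} \<noteq> {}"
    by blast
  show ?thesis
    unfolding gap_def using Min_gr_iff[OF finite_coords_pairs ne, of 0] by auto
qed

lemma coords_gap_cong: "coords n t = coords m t' \<Longrightarrow> gap n t = gap m t'"
  by (simp add: gap_def)

lemma coords_face:
  assumes f: "face_map m n f" and t: "t \<in> cube m"
  shows "coords n (f t) = coords m t"
proof (intro equalityI subsetI)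
  have sub: "f t i \<in> coords m t \<and> 1 - f t i \<in> coords m t" if "i < n" for i
    using f that by (cases rule: face_map_coord) (use t in \<open>auto simp: coords_def\<close>)
  have "0 \<in> coords m t" "1 \<in> coords m t" by (auto simp: coords_def)
  then show "a \<in> coords m t" if "a \<in> coords n (f t)" for a
    using sub that unfolding coords_def[of n "f t"] by auto
next
  have sub: "t j \<in> coords n (f t) \<and> 1 - t j \<in> coords n (f t)" if j: "j < m" for j
  proof -
    obtain i where i: "i < n" "(\<forall>t\<in>cube m. f t i = t j) \<or> (\<forall>t\<in>cube m. f t i = 1 - t j)"
      using face_map_coord_inv[OF f j] .
    then have "t j = f t i \<and> 1 - t j = 1 - f t i \<or> t j = 1 - f t i \<and> 1 - t j = f t i"
      using t by fastforce
    then show ?thesis using i(1) unfolding coords_def by blast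
  qed
  have "0 \<in> coords n (f t)" "1 \<in> coords n (f t)" by (auto simp: coords_def)
  then show "a \<in> coords n (f t)" if "a \<in> coords m t" for a
    using sub that unfolding coords_def[of m t] by auto
qed

lemma near_unique:
  assumes "t0 \<in> cube n" "t1 \<in> cube n" "coords n t0 = coords n t1" "near n t0 t" "near n t1 t"
  shows "t0 = t1"
proof
  fix i
  show "t0 i = t1 i"
  proof (cases "i < n")
    case True
    have "t0 i \<in> coords n t0" "t1 i \<in> coords n t0" unfolding assms(3)
      using True assms(3) by (auto simp: coords_def)
    moreover have "\<bar>t0 i - t1 i\<bar> < 2 * gap n t0"
      using assms(4,5) True coords_gap_cong[OF assms(3)] unfolding near_def by fastforce
    ultimately show ?thesis using gap_le[of "t0 i" n t0 "t1 i"] by force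
  next
    case False
    then show ?thesis using assms(1,2) by (auto simp: cube_def)
  qed
qed

lemma near_face:
  assumes f: "face_map m n f" and t: "t0 \<in> cube m" "t \<in> cube m"
  shows "near n (f t0) (f t) \<longleftrightarrow> near m t0 t"
proof
  have g: "gap n (f t0) = gap m t0" by (rule coords_gap_cong[OF coords_face[OF f t(1)]])
  {
    assume *: "near n (f t0) (f t)"
    show "near m t0 t"
      unfolding near_def
    proof (intro allI impI)
      fix j assume "j < m"
      then obtain i where "i < n" "(\<forall>t\<in>cube m. f t i = t j) \<or> (\<forall>t\<in>cube m. f t i = 1 - t j)"
        using face_map_coord_inv[OF f] by blast
      then have "\<bar>t j - t0 j\<bar> = \<bar>f t i - f t0 i\<bar>" using t by fastforce
      then show "\<bar>t j - t0 j\<bar> < gap m t0" using * \<open>i < n\<close> g by (simp add: near_def)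
    qed
  }
  assume *: "near m t0 t"
  have "\<bar>f t i - f t0 i\<bar> < gap m t0" if "i < n" for i
    using f that by (cases rule: face_map_coord) (use * t gap_pos[of m t0] in \<open>fastforce simp: near_def\<close>)+
  then show "near n (f t0) (f t)" by (simp add: near_def g)
qed

text \<open>A coordinate of \<open>f u\<close> equal to 0 or 1 must already have this value at \<open>t0\<close>, since both numbers are in
\<open>coords n t0\<close> and closer than \<open>gap\<close>.\<close>

lemma near_in_face:
  assumes f: "face_map k n f" and u: "u \<in> open_cube k" and t0: "t0 \<in> cube n" and near: "near n t0 (f u)"
  obtains u0 where "u0 \<in> cube k" "f u0 = t0" "near k u0 u"
proof -
  note uc = open_cube_subset[OF u]
  obtain u0 where u0: "u0 \<in> cube k" "f u0 = t0"
  proof (rule face_map_range[OF f u t0])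
    fix i assume i: "i < n" "f u i = 0 \<or> f u i = 1"
    have "f u i \<in> coords n t0" "t0 i \<in> coords n t0" using i by (auto simp: coords_def)
    moreover have "\<bar>f u i - t0 i\<bar> < gap n t0" using near i by (simp add: near_def)
    ultimately show "t0 i = f u i" using gap_le[of "f u i" n t0 "t0 i"] gap_pos[of n t0] by fastforce
  qed blast
  then show thesis using that near near_face[OF f u0(1) uc] by blast
qed

text \<open>Stated as a property of its own because unique lifting transports it from the base to the total space of a
cubical covering.\<close>

definition common_faces :: "'a cube_complex \<Rightarrow> bool" where
  "common_faces X \<longleftrightarrow> (\<forall>n n'. \<forall>s\<in>X n. \<forall>s'\<in>X n'. \<forall>t\<in>cube n. \<forall>t'\<in>cube n'. s t = s' t' \<longrightarrow>
     (\<exists>k f f' u. face_map k n f \<and> face_map k n' f' \<and> u \<in> open_cube k \<and> f u = t \<and> f' u = t' \<and>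
        (\<forall>x\<in>cube k. s (f x) = s' (f' x))))"

lemma common_facesE:
  assumes "common_faces X" "s \<in> X n" "t \<in> cube n" "s' \<in> X n'" "t' \<in> cube n'" "s t = s' t'"
  obtains k f f' u where "face_map k n f" "face_map k n' f'" "u \<in> open_cube k" "f u = t" "f' u = t'"
    "\<forall>x\<in>cube k. s (f x) = s' (f' x)"
  using assms(1)[unfolded common_faces_def, rule_format, OF assms(2,4,3,5,6)]
  by (elim exE conjE) (rule that)

lemma cc_common_faces:
  assumes "is_cube_complex X" shows "common_faces X"
  unfolding common_faces_def
proof (intro allI ballI impI)
  fix n n' s s' t t'
  assume *: "s \<in> X n" "s' \<in> X n'" "t \<in> cube n" "t' \<in> cube n'" "s t = s' t'"
  show "\<exists>k f f' u. face_map k n f \<and> face_map k n' f' \<and> u \<in> open_cube k \<and> f u = t \<and> f' u = t' \<and>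
        (\<forall>x\<in>cube k. s (f x) = s' (f' x))"
    by (rule common_face[OF assms *(1,3,2,4,5)]) (intro exI conjI ballI; assumption)
qed

lemma common_coords:
  assumes "common_faces X" "s \<in> X n" "t \<in> cube n" "s' \<in> X n'" "t' \<in> cube n'" "s t = s' t'"
  shows "coords n t = coords n' t'"
  using common_facesE[OF assms] coords_face open_cube_subset by metis

definition star :: "'a cube_complex \<Rightarrow> 'a \<Rightarrow> 'a set" where
  "star X x = {s t | n s t. s \<in> X n \<and> t \<in> cube n \<and> (\<exists>t0\<in>cube n. s t0 = x \<and> near n t0 t)}"

lemma starI: "s \<in> X n \<Longrightarrow> t \<in> cube n \<Longrightarrow> t0 \<in> cube n \<Longrightarrow> near n t0 t \<Longrightarrow> s t \<in> star X (s t0)"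
  unfolding star_def by blast

text \<open>Membership in a star can be tested in any cube through the point: pass to the common face.\<close>

lemma star_cube:
  assumes X: "common_faces X" and s: "s \<in> X n" "t \<in> cube n" and st: "s t \<in> star X x"
  obtains t0 where "t0 \<in> cube n" "s t0 = x" "near n t0 t"
proof -
  obtain n' s' t' t0' where s': "s' \<in> X n'" "t' \<in> cube n'" "s t = s' t'"
    "t0' \<in> cube n'" "s' t0' = x" "near n' t0' t'"
    using st unfolding star_def by blast
  obtain k f f' u where f: "face_map k n f" "face_map k n' f'" "u \<in> open_cube k" "f u = t" "f' u = t'"
    "\<forall>x\<in>cube k. s (f x) = s' (f' x)"
    using common_facesE[OF X s s'(1-3)] .
  obtain u0 where u0: "u0 \<in> cube k" "f' u0 = t0'" "near k u0 u"
    using near_in_face[OF f(2,3) s'(4)] s'(6) f(5) by blast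
  show thesis
  proof (rule that)
    show "f u0 \<in> cube n" using face_map_cube[OF f(1) u0(1)] .
    show "s (f u0) = x" using f(6) u0 s'(5) by simp
    show "near n (f u0) t"
      using near_face[OF f(1) u0(1) open_cube_subset[OF f(3)]] u0(3) f(4) by simp
  qed
qed

lemma open_near: "open {t. near n t0 t}"
proof -
  have "open {t::nat \<Rightarrow> real. \<bar>t i - t0 i\<bar> < gap n t0}" for i
    by (intro open_Collect_less continuous_intros continuous_on_product_coordinates)
  then have "open (\<Inter>i\<in>{..<n}. {t::nat \<Rightarrow> real. \<bar>t i - t0 i\<bar> < gap n t0})"
    by (intro open_INT) auto
  moreover have "(\<Inter>i\<in>{..<n}. {t. \<bar>t i - t0 i\<bar> < gap n t0}) = {t. near n t0 t}"
    by (auto simp: near_def)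
  ultimately show ?thesis by simp
qed

lemma openin_star:
  assumes X: "common_faces X" shows "openin (cc_topology X) (star X x)"
  unfolding openin_cc_topology
proof (intro conjI allI ballI)
  show "star X x \<subseteq> points X" by (auto simp: star_def intro: pointsI)
  fix n s assume s: "s \<in> X n"
  have "{t \<in> cube n. s t \<in> star X x} = cube n \<inter> (\<Union>t0\<in>{t0 \<in> cube n. s t0 = x}. {t. near n t0 t})"
  proof (intro equalityI subsetI)
    fix t assume "t \<in> {t \<in> cube n. s t \<in> star X x}"
    then have t: "t \<in> cube n" "s t \<in> star X x" by auto
    obtain t0 where "t0 \<in> cube n" "s t0 = x" "near n t0 t" using star_cube[OF X s t] .
    with t(1) show "t \<in> cube n \<inter> (\<Union>t0\<in>{t0 \<in> cube n. s t0 = x}. {t. near n t0 t})" by blast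
  next
    fix t assume "t \<in> cube n \<inter> (\<Union>t0\<in>{t0 \<in> cube n. s t0 = x}. {t. near n t0 t})"
    then show "t \<in> {t \<in> cube n. s t \<in> star X x}" using starI[of s X n, OF s] by blast
  qed
  moreover have "open (\<Union>t0\<in>{t0 \<in> cube n. s t0 = x}. {t. near n t0 t})"
    using open_near by blast
  ultimately show "openin (top_of_set (cube n)) {t \<in> cube n. s t \<in> star X x}"
    by (simp add: openin_open_Int)
qed

lemma star_self:
  assumes "x \<in> points X" shows "x \<in> star X x"
proof -
  obtain n s t where "s \<in> X n" "t \<in> cube n" "x = s t" using assms by (rule pointsE)
  moreover have "near n t t" using gap_pos by (simp add: near_def)
  ultimately show ?thesis unfolding star_def by blast
qed

text \<open>The conditions that the definition of the universal cover imposes on cubes.\<close>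

definition cubical_covering :: "'b cube_complex \<Rightarrow> ('b \<Rightarrow> 'a) \<Rightarrow> 'a cube_complex \<Rightarrow> bool" where
  "cubical_covering E q Y \<longleftrightarrow> q ` points E = points Y \<and>
     (\<forall>m n f. \<forall>s\<in>E n. face_map m n f \<longrightarrow> compose (cube m) s f \<in> E m) \<and>
     (\<forall>n. \<forall>s\<in>E n. compose (cube n) q s \<in> Y n) \<and>
     (\<forall>n. \<forall>\<sigma>\<in>Y n. \<forall>t\<in>cube n. \<forall>e\<in>points E. q e = \<sigma> t \<longrightarrow>
        (\<exists>!s. s \<in> E n \<and> s t = e \<and> compose (cube n) q s = \<sigma>))"

locale cubical_cover =
  fixes E :: "'b cube_complex" and q :: "'b \<Rightarrow> 'a" and Y :: "'a cube_complex"
  assumes Y: "is_cube_complex Y" and cov: "cubical_covering E q Y"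
begin

lemma face: "s \<in> E n \<Longrightarrow> face_map m n f \<Longrightarrow> compose (cube m) s f \<in> E m"
  using cov[unfolded cubical_covering_def, THEN conjunct2, THEN conjunct1] by simp

lemma proj: "s \<in> E n \<Longrightarrow> compose (cube n) q s \<in> Y n"
  using cov[unfolded cubical_covering_def, THEN conjunct2, THEN conjunct2, THEN conjunct1] by simp

lemma surj: "q ` points E = points Y"
  using cov[unfolded cubical_covering_def, THEN conjunct1] .

lemma ex1:
  assumes "\<sigma> \<in> Y n" "t \<in> cube n" "e \<in> points E" "q e = \<sigma> t"
  shows "\<exists>!s. s \<in> E n \<and> s t = e \<and> compose (cube n) q s = \<sigma>"
  using cov[unfolded cubical_covering_def, THEN conjunct2, THEN conjunct2, THEN conjunct2,
    rule_format, OF assms] .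

lemma lift:
  assumes "\<sigma> \<in> Y n" "t \<in> cube n" "e \<in> points E" "q e = \<sigma> t"
  obtains s where "s \<in> E n" "s t = e" "\<And>x. x \<in> cube n \<Longrightarrow> q (s x) = \<sigma> x"
proof -
  obtain s where "s \<in> E n" "s t = e" "compose (cube n) q s = \<sigma>" using ex1[OF assms] by blast
  then show thesis using that by (auto simp: compose_def)
qed

lemma unique:
  assumes s: "s \<in> E n" "s' \<in> E n" and t: "t \<in> cube n" "s t = s' t"
    and eq: "\<And>x. x \<in> cube n \<Longrightarrow> q (s x) = q (s' x)"
  shows "s = s'"
proof -
  have "compose (cube n) q s' = compose (cube n) q s" using eq by (auto simp: compose_def fun_eq_iff)
  moreover have "q (s t) = compose (cube n) q s t" using t by (simp add: compose_def)
  ultimately show ?thesis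
    using ex1[OF proj[OF s(1)] t(1) pointsI[of s E n, OF s(1) t(1)]] s t(2) by metis
qed

text \<open>A common face of the projected cubes lifts to a common face, by uniqueness of lifts.\<close>

lemma E_common_faces: "common_faces E"
  unfolding common_faces_def
proof (intro allI ballI impI)
  fix n n' s s' t t'
  assume *: "s \<in> E n" "s' \<in> E n'" "t \<in> cube n" "t' \<in> cube n'" "s t = s' t'"
  have "compose (cube n) q s t = compose (cube n') q s' t'" using * by (simp add: compose_def)
  then obtain k f f' u where f: "face_map k n f" "face_map k n' f'" "u \<in> open_cube k" "f u = t" "f' u = t'"
    "\<forall>x\<in>cube k. compose (cube n) q s (f x) = compose (cube n') q s' (f' x)"
    using common_facesE[OF cc_common_faces[OF Y] proj[OF *(1)] *(3) proj[OF *(2)] *(4)] by blast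
  note fc = face_map_cube[OF f(1)] face_map_cube[OF f(2)]
  have "compose (cube k) s f = compose (cube k) s' f'"
    by (rule unique[OF face[OF *(1) f(1)] face[OF *(2) f(2)] open_cube_subset[OF f(3)]])
       (use f fc * open_cube_subset[OF f(3)] in \<open>auto simp: compose_def\<close>)
  then have "\<forall>x\<in>cube k. s (f x) = s' (f' x)" by (auto simp: compose_def fun_eq_iff split: if_splits)
  with f show "\<exists>k f f' u. face_map k n f \<and> face_map k n' f' \<and> u \<in> open_cube k \<and> f u = t \<and> f' u = t' \<and>
        (\<forall>x\<in>cube k. s (f x) = s' (f' x))" by blast
qed

lemma continuous: "continuous_map (cc_topology E) (cc_topology Y) q"
proof (rule continuous_map_from_cc)
  fix n s assume "s \<in> E n"
  from cube_continuous[of _ Y n, OF proj[OF this]]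
  show "continuous_map (top_of_set (cube n)) (cc_topology Y) (\<lambda>t. q (s t))"
    by (rule continuous_map_eq) (simp add: compose_def)
qed

lemma open_image:
  assumes W: "openin (cc_topology E) W" shows "openin (cc_topology Y) (q ` W)"
  unfolding openin_cc_topology
proof (intro conjI allI ballI)
  have WE: "W \<subseteq> points E" using openin_subset[OF W] by simp
  then show "q ` W \<subseteq> points Y" using surj by blast
  fix n \<sigma> assume \<sigma>: "\<sigma> \<in> Y n"
  show "openin (top_of_set (cube n)) {t \<in> cube n. \<sigma> t \<in> q ` W}"
  proof (subst openin_subopen, clarify)
    fix t w assume t: "t \<in> cube n" "\<sigma> t = q w" "w \<in> W"
    obtain s where s: "s \<in> E n" "s t = w" "\<And>x. x \<in> cube n \<Longrightarrow> q (s x) = \<sigma> x"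
      using lift[OF \<sigma> t(1), of w] t WE by auto
    have "openin (top_of_set (cube n)) {x \<in> cube n. s x \<in> W}"
      using W s(1) unfolding openin_cc_topology by simp
    moreover have "{x \<in> cube n. s x \<in> W} \<subseteq> {t \<in> cube n. \<sigma> t \<in> q ` W}" using s(3) by force
    ultimately show "\<exists>T. openin (top_of_set (cube n)) T \<and> t \<in> T \<and> T \<subseteq> {t \<in> cube n. \<sigma> t \<in> q ` W}"
      using t s(2) by (intro exI[of _ "{x \<in> cube n. s x \<in> W}"]) auto
  qed
qed

lemma star_image:
  assumes "e \<in> points E" shows "q ` star E e = star Y (q e)"
proof (intro equalityI subsetI)
  fix y assume "y \<in> q ` star E e"
  then obtain n s t t0 where s: "s \<in> E n" "t \<in> cube n" "t0 \<in> cube n" "s t0 = e" "near n t0 t" "y = q (s t)"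
    unfolding star_def by blast
  then show "y \<in> star Y (q e)"
    unfolding star_def using proj[OF s(1)]
    by (intro CollectI exI[of _ n] exI[of _ "compose (cube n) q s"] exI[of _ t]) (auto simp: compose_def)
next
  fix y assume "y \<in> star Y (q e)"
  then obtain n s t t0 where s: "s \<in> Y n" "t \<in> cube n" "t0 \<in> cube n" "s t0 = q e" "near n t0 t" "y = s t"
    unfolding star_def by blast
  obtain s' where s': "s' \<in> E n" "s' t0 = e" "\<And>x. x \<in> cube n \<Longrightarrow> q (s' x) = s x"
    using lift[OF s(1,3) assms] s(4) by auto
  then have "s' t \<in> star E e" using s unfolding star_def by blast
  then show "y \<in> q ` star E e" using s' s by force
qed

text \<open>Two points of the star with the same image lie in lifts of one common face. The centres of the star read in that
face are both near the point, hence equal, so the lifts agree there and coincide.\<close>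

lemma star_inj:
  assumes "e \<in> points E" shows "inj_on q (star E e)"
proof (rule inj_onI)
  fix z z' assume "z \<in> star E e" "z' \<in> star E e" and eq: "q z = q z'"
  then obtain n s t t0 n' s' t' t0' where
    s: "s \<in> E n" "t \<in> cube n" "t0 \<in> cube n" "s t0 = e" "near n t0 t" "z = s t" and
    s': "s' \<in> E n'" "t' \<in> cube n'" "t0' \<in> cube n'" "s' t0' = e" "near n' t0' t'" "z' = s' t'"
    unfolding star_def by blast
  have "compose (cube n) q s t = compose (cube n') q s' t'" using s s' eq by (simp add: compose_def)
  then obtain k f f' u where f: "face_map k n f" "face_map k n' f'" "u \<in> open_cube k" "f u = t" "f' u = t'"
    "\<forall>x\<in>cube k. compose (cube n) q s (f x) = compose (cube n') q s' (f' x)"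
    using common_facesE[OF cc_common_faces[OF Y] proj[OF s(1)] s(2) proj[OF s'(1)] s'(2)] by blast
  obtain u0 where u0: "u0 \<in> cube k" "f u0 = t0" "near k u0 u"
    using near_in_face[OF f(1,3) s(3)] s(5) f(4) by blast
  obtain u0' where u0': "u0' \<in> cube k" "f' u0' = t0'" "near k u0' u"
    using near_in_face[OF f(2,3) s'(3)] s'(5) f(5) by blast
  have "coords n t0 = coords n' t0'"
    using common_coords[OF E_common_faces s(1,3) s'(1,3)] s(4) s'(4) by simp
  then have "coords k u0 = coords k u0'"
    using coords_face[OF f(1) u0(1)] coords_face[OF f(2) u0'(1)] u0 u0' by simp
  then have uu: "u0 = u0'" using near_unique[OF u0(1) u0'(1)] u0 u0' by blast
  note fc = face_map_cube[OF f(1)] face_map_cube[OF f(2)]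
  have "compose (cube k) s f = compose (cube k) s' f'"
    by (rule unique[OF face[OF s(1) f(1)] face[OF s'(1) f(2)] u0(1)])
       (use f fc u0 u0' uu s s' in \<open>auto simp: compose_def\<close>)
  then have "compose (cube k) s f u = compose (cube k) s' f' u" by simp
  then show "z = z'" using open_cube_subset[OF f(3)] f s s' by (simp add: compose_def)
qed

text \<open>The star of \<open>x\<close> is evenly covered by the stars of its preimages.\<close>

theorem covering: "covering_map (cc_topology E) q (cc_topology Y)"
  unfolding covering_map_def
proof (intro conjI ballI)
  show "continuous_map (cc_topology E) (cc_topology Y) q" by (rule continuous)
  show "q ` topspace (cc_topology E) = topspace (cc_topology Y)" using surj by simp
  fix x assume "x \<in> topspace (cc_topology Y)"
  then have x: "x \<in> points Y" by simp
  note EY = E_common_faces cc_common_faces[OF Y]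
  define \<V> where "\<V> = star E ` {e \<in> points E. q e = x}"
  have "\<Union>\<V> = {y \<in> topspace (cc_topology E). q y \<in> star Y x}"
  proof (intro equalityI subsetI)
    fix z assume "z \<in> \<Union>\<V>"
    then obtain e where e: "e \<in> points E" "q e = x" "z \<in> star E e" by (auto simp: \<V>_def)
    then have "q z \<in> star Y x" using star_image by blast
    then show "z \<in> {y \<in> topspace (cc_topology E). q y \<in> star Y x}"
      using e openin_subset[OF openin_star[OF EY(1)]] by auto
  next
    fix z assume "z \<in> {y \<in> topspace (cc_topology E). q y \<in> star Y x}"
    then have z: "z \<in> points E" "q z \<in> star Y x" by auto
    obtain n s t where s: "s \<in> E n" "t \<in> cube n" "z = s t" using z(1) by (rule pointsE)
    have "compose (cube n) q s t \<in> star Y x" using z s by (simp add: compose_def)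
    then obtain t0 where t0: "t0 \<in> cube n" "compose (cube n) q s t0 = x" "near n t0 t"
      using star_cube[OF EY(2) proj[OF s(1)] s(2)] by blast
    have "z \<in> star E (s t0)" unfolding star_def using s t0 by blast
    moreover have "s t0 \<in> points E" "q (s t0) = x" using s t0 by (auto simp: compose_def intro: pointsI)
    ultimately show "z \<in> \<Union>\<V>" unfolding \<V>_def by blast
  qed
  moreover have "\<forall>V\<in>\<V>. openin (cc_topology E) V"
    using openin_star[OF EY(1)] by (auto simp: \<V>_def)
  moreover have "pairwise disjnt \<V>"
  proof -
    have "e = e'" if e: "e \<in> points E" "q e = x" "e' \<in> points E" "q e' = x"
      and z: "z \<in> star E e" "z \<in> star E e'" for e e' z
    proof -
      obtain n s t t0 where
        s: "s \<in> E n" "t \<in> cube n" "t0 \<in> cube n" "s t0 = e" "near n t0 t" "z = s t"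
        using z(1) unfolding star_def by blast
      obtain t1 where t1: "t1 \<in> cube n" "s t1 = e'" "near n t1 t"
        using star_cube[OF EY(1) s(1,2)] z(2) s(6) by blast
      have "coords n t0 = coords n t1"
        by (rule common_coords[OF EY(2) proj[OF s(1)] s(3) proj[OF s(1)] t1(1)])
           (use s t1 e in \<open>simp add: compose_def\<close>)
      then have "t0 = t1" using near_unique[OF s(3) t1(1)] s(5) t1(3) by blast
      then show ?thesis using s t1 by simp
    qed
    then show ?thesis unfolding \<V>_def pairwise_def disjnt_def by blast
  qed
  moreover have "\<forall>V\<in>\<V>. homeomorphic_map (subtopology (cc_topology E) V) (subtopology (cc_topology Y) (star Y x)) q"
  proof
    fix V assume "V \<in> \<V>"
    then obtain e where e: "e \<in> points E" "q e = x" and V: "V = star E e" by (auto simp: \<V>_def)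
    have sub: "star E e \<subseteq> points E" "star Y x \<subseteq> points Y"
      using openin_subset[OF openin_star[OF EY(1)]] openin_subset[OF openin_star[OF EY(2)]] by auto
    show "homeomorphic_map (subtopology (cc_topology E) V) (subtopology (cc_topology Y) (star Y x)) q"
      unfolding V
    proof (rule bijective_open_imp_homeomorphic_map)
      show "continuous_map (subtopology (cc_topology E) (star E e)) (subtopology (cc_topology Y) (star Y x)) q"
        using continuous star_image[OF e(1)] e(2)
        by (auto simp: continuous_map_in_subtopology continuous_map_from_subtopology)
      show "open_map (subtopology (cc_topology E) (star E e)) (subtopology (cc_topology Y) (star Y x)) q"
        unfolding open_map_def
      proof (intro allI impI)
        fix W assume "openin (subtopology (cc_topology E) (star E e)) W"
        then have W: "openin (cc_topology E) W" "W \<subseteq> star E e"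
          using openin_open_subtopology[OF openin_star[OF EY(1)]] by auto
        then show "openin (subtopology (cc_topology Y) (star Y x)) (q ` W)"
          using openin_open_subtopology[OF openin_star[OF EY(2)]] open_image star_image[OF e(1)] e(2)
          by blast
      qed
      show "q ` topspace (subtopology (cc_topology E) (star E e)) = topspace (subtopology (cc_topology Y) (star Y x))"
        using sub star_image[OF e(1)] e(2) by (simp add: Int_absorb1)
      show "inj_on q (topspace (subtopology (cc_topology E) (star E e)))"
        using sub star_inj[OF e(1)] by (simp add: Int_absorb1)
    qed
  qed
  ultimately show "\<exists>U. x \<in> U \<and> openin (cc_topology Y) U \<and>
        (\<exists>\<V>. \<Union>\<V> = {y \<in> topspace (cc_topology E). q y \<in> U} \<and> (\<forall>V\<in>\<V>. openin (cc_topology E) V) \<and>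
             pairwise disjnt \<V> \<and>
             (\<forall>V\<in>\<V>. homeomorphic_map (subtopology (cc_topology E) V) (subtopology (cc_topology Y) U) q))"
    using star_self[OF x] openin_star[OF EY(2), of x] by (intro exI[of _ "star Y x"] conjI exI[of _ \<V>]) assumption+
qed

end

section \<open>Corners, edges and connectivity of subcomplexes\<close>

definition corners :: "nat \<Rightarrow> (nat \<Rightarrow> real) set" where
  "corners n = {w. (\<forall>i<n. w i = 0 \<or> w i = 1) \<and> (\<forall>i\<ge>n. w i = 0)}"

abbreviation flip :: "(nat \<Rightarrow> real) \<Rightarrow> nat \<Rightarrow> (nat \<Rightarrow> real)" where
  "flip w i \<equiv> w(i := 1 - w i)"

abbreviation unit_end :: "nat \<Rightarrow> real" where
  "unit_end \<equiv> origin(0 := 1)"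

lemma corners_cube: "w \<in> corners n \<Longrightarrow> w \<in> cube n"
  by (fastforce simp: corners_def cube_def)

lemma origin_corner [simp]: "origin \<in> corners n"
  by (simp add: corners_def)

lemma flip_corner: "w \<in> corners n \<Longrightarrow> i < n \<Longrightarrow> flip w i \<in> corners n"
  by (auto simp: corners_def)

lemma corner_01: "w \<in> corners n \<Longrightarrow> w i = 0 \<or> w i = 1"
  by (cases "i < n") (auto simp: corners_def)

lemma corner_induct [consumes 2, case_names base flip]:
  assumes "w0 \<in> corners n" "w \<in> corners n"
    and "P w0" and flip: "\<And>w i. w \<in> corners n \<Longrightarrow> i < n \<Longrightarrow> P w \<Longrightarrow> P (flip w i)"
  shows "P w"
  using assms(2)
proof (induction "card {i. w i \<noteq> w0 i}" arbitrary: w)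
  have fin: "finite {i. w i \<noteq> w0 i}" if "w \<in> corners n" for w
  proof (rule finite_subset)
    show "{i. w i \<noteq> w0 i} \<subseteq> {..<n}"
      using that assms(1) by (auto simp: corners_def) (metis linorder_not_less)
  qed simp
  {
    case 0
    then have "w = w0" using fin[of w] by auto
    then show ?case using assms(3) by simp
  next
    case (Suc m)
    then obtain i where i: "w i \<noteq> w0 i" by (metis (mono_tags, lifting) card.empty empty_Collect_eq nat.simps(3))
    then have "i < n" using Suc.prems assms(1) by (metis (mono_tags, lifting) corners_def linorder_not_less mem_Collect_eq)
    have "{j. flip w i j \<noteq> w0 j} = {j. w j \<noteq> w0 j} - {i}"
      using i corner_01[OF Suc.prems, of i] corner_01[OF assms(1), of i] by auto
    then have "card {j. flip w i j \<noteq> w0 j} = m"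
      using Suc.hyps(2) i fin[OF Suc.prems] by simp
    then have "P (flip w i)" using Suc.hyps(1) flip_corner[OF Suc.prems \<open>i < n\<close>] by blast
    from flip[OF flip_corner[OF Suc.prems \<open>i < n\<close>] \<open>i < n\<close> this] show ?case by simp
  }
qed

lemma cube_update: "t \<in> cube n \<Longrightarrow> i < n \<Longrightarrow> 0 \<le> x \<Longrightarrow> x \<le> 1 \<Longrightarrow> t(i := x) \<in> cube n"
  by (auto simp: cube_def)

text \<open>The edge in direction \<open>i\<close> at the corner \<open>w\<close>, parametrised as starting at \<open>w\<close>.\<close>

definition edge_param :: "(nat \<Rightarrow> real) \<Rightarrow> nat \<Rightarrow> (nat \<Rightarrow> real) \<Rightarrow> (nat \<Rightarrow> real)" where
  "edge_param w i t = w(i := if w i = 0 then t 0 else 1 - t 0)"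

definition cedge :: "((nat \<Rightarrow> real) \<Rightarrow> 'a) \<Rightarrow> (nat \<Rightarrow> real) \<Rightarrow> nat \<Rightarrow> ((nat \<Rightarrow> real) \<Rightarrow> 'a)" where
  "cedge s w i = compose (cube 1) s (edge_param w i)"

lemma corner_edge_cedge: "corner_edge s i = cedge s origin i"
  unfolding corner_edge_def cedge_def edge_param_def by simp

lemma face_map_edge_param:
  assumes "w \<in> corners n" "i < n"
  shows "face_map 1 n (edge_param w i)"
  by (rule face_mapI[of "\<lambda>_. i"]) (use assms in \<open>auto simp: edge_param_def corners_def inj_on_def\<close>)

lemma cedge_in: "is_cube_complex X \<Longrightarrow> s \<in> X n \<Longrightarrow> w \<in> corners n \<Longrightarrow> i < n \<Longrightarrow> cedge s w i \<in> X 1"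
  unfolding cedge_def by (rule cc_face[OF _ _ face_map_edge_param])

lemma unit_end_cube [simp]: "unit_end \<in> cube (Suc 0)"
  by (auto simp: cube_def)

lemma unit_end_corner [simp]: "unit_end \<in> corners (Suc 0)"
  by (auto simp: corners_def)

lemma cedge_origin [simp]: "w \<in> corners n \<Longrightarrow> cedge s w i origin = s w"
  using corner_01[of w n i] by (auto simp: cedge_def compose_def edge_param_def fun_upd_idem)

lemma cedge_end [simp]: "w \<in> corners n \<Longrightarrow> cedge s w i unit_end = s (flip w i)"
  using corner_01[of w n i] by (auto simp: cedge_def compose_def edge_param_def)

lemma cedge_image:
  assumes "w \<in> corners n"
  shows "cedge s w i ` cube 1 = s ` {w(i := x) | x. 0 \<le> x \<and> x \<le> 1}"
proof -
  have "edge_param w i ` cube 1 = {w(i := x) | x. 0 \<le> x \<and> x \<le> 1}"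
  proof (intro equalityI subsetI)
    fix a assume "a \<in> edge_param w i ` cube 1"
    then obtain t where "t \<in> cube 1" "a = edge_param w i t" by blast
    then show "a \<in> {w(i := x) | x. 0 \<le> x \<and> x \<le> 1}"
      using cube_coord[of t 1 0] by (auto simp: edge_param_def)
  next
    fix a assume "a \<in> {w(i := x) | x. 0 \<le> x \<and> x \<le> 1}"
    then obtain x where x: "a = w(i := x)" "0 \<le> x" "x \<le> 1" by blast
    show "a \<in> edge_param w i ` cube 1"
      by (rule image_eqI[of _ _ "origin(0 := if w i = 0 then x else 1 - x)"])
         (use x in \<open>auto simp: edge_param_def cube_def\<close>)
  qed
  moreover have "cedge s w i ` cube 1 = s ` edge_param w i ` cube 1"
    by (auto simp: cedge_def compose_def image_iff)
  ultimately show ?thesis by simp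
qed

lemma unit_line:
  assumes "w \<in> corners 1" shows "{w(0 := x) | x. 0 \<le> x \<and> x \<le> 1} = cube 1"
proof (intro equalityI subsetI)
  fix t assume t: "t \<in> cube 1"
  then have "t = w(0 := t 0)" using assms by (auto simp: cube_def corners_def fun_eq_iff)
  then show "t \<in> {w(0 := x) | x. 0 \<le> x \<and> x \<le> 1}" using cube_coord[OF t, of 0] by blast
qed (use assms in \<open>auto simp: cube_def corners_def\<close>)

lemma cedge_compose:
  assumes "w \<in> corners n" "i < n"
  shows "cedge (compose (cube n) q s) w i = compose (cube 1) q (cedge s w i)"
  using face_map_cube[OF face_map_edge_param[OF assms]]
  by (auto simp: cedge_def compose_def fun_eq_iff)

lemma face_map_update:
  assumes g: "face_map m n g" and j: "j < m"
  obtains (direct) i where "i < n" "\<And>t. t \<in> cube m \<Longrightarrow> g t i = t j"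
      "\<And>t x. t \<in> cube m \<Longrightarrow> 0 \<le> x \<Longrightarrow> x \<le> 1 \<Longrightarrow> g (t(j := x)) = (g t)(i := x)"
    | (flipped) i where "i < n" "\<And>t. t \<in> cube m \<Longrightarrow> g t i = 1 - t j"
      "\<And>t x. t \<in> cube m \<Longrightarrow> 0 \<le> x \<Longrightarrow> x \<le> 1 \<Longrightarrow> g (t(j := x)) = (g t)(i := 1 - x)"
proof -
  obtain \<iota> where i: "inj_on \<iota> {..<m}" "\<And>j. j < m \<Longrightarrow> \<iota> j < n"
    "\<And>j. j < m \<Longrightarrow> (\<forall>t\<in>cube m. g t (\<iota> j) = t j) \<or> (\<forall>t\<in>cube m. g t (\<iota> j) = 1 - t j)"
    "\<And>i. i < n \<Longrightarrow> i \<notin> \<iota> ` {..<m} \<Longrightarrow> (\<forall>t\<in>cube m. g t i = 0) \<or> (\<forall>t\<in>cube m. g t i = 1)"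
    using g by (rule face_mapE) blast
  have other: "g (t(j := x)) l = g t l" if t: "t \<in> cube m" "0 \<le> x" "x \<le> 1" and l: "l \<noteq> \<iota> j" for t x l
  proof -
    have tx: "t(j := x) \<in> cube m" using cube_update t j by blast
    consider j' where "j' < m" "l = \<iota> j'" "j' \<noteq> j" | "l < n" "l \<notin> \<iota> ` {..<m}" | "l \<ge> n"
      using l by (cases "l < n") auto
    then show ?thesis
    proof cases
      case 1
      then show ?thesis using i(3)[OF 1(1)] t tx by auto
    next
      case 2
      then show ?thesis using i(4)[OF 2] t tx by auto
    next
      case 3
      then show ?thesis using face_map_outside[OF g] t tx by auto
    qed
  qed
  from i(3)[OF j] show thesis
  proof
    assume *: "\<forall>t\<in>cube m. g t (\<iota> j) = t j"
    have "g (t(j := x)) = (g t)(\<iota> j := x)" if "t \<in> cube m" "0 \<le> x" "x \<le> 1" for t x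
      using other[OF that] * cube_update[OF that(1) j that(2,3)] by (auto simp: fun_eq_iff)
    then show thesis using direct[of "\<iota> j"] i(2)[OF j] * by blast
  next
    assume *: "\<forall>t\<in>cube m. g t (\<iota> j) = 1 - t j"
    have "g (t(j := x)) = (g t)(\<iota> j := 1 - x)" if "t \<in> cube m" "0 \<le> x" "x \<le> 1" for t x
      using other[OF that] * cube_update[OF that(1) j that(2,3)] by (auto simp: fun_eq_iff)
    then show thesis using flipped[of "\<iota> j"] i(2)[OF j] * by blast
  qed
qed

lemma face_map_corner:
  assumes g: "face_map m n g" and w: "w \<in> corners m"
  shows "g w \<in> corners n"
proof -
  have "g w i = 0 \<or> g w i = 1" if "i < n" for i
    using g that by (cases rule: face_map_coord) (use corners_cube[OF w] corner_01[OF w] in auto)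
  then show ?thesis using face_map_outside[OF g corners_cube[OF w]] by (simp add: corners_def)
qed

text \<open>A face map takes the edges in direction \<open>j\<close> to those in one direction \<open>i\<close>; since \<open>edge_param\<close> starts at the
given corner, reflections of coordinates leave no trace.\<close>

lemma cedge_face:
  assumes g: "face_map m n g" and j: "j < m"
  obtains i where "i < n" "\<And>w. w \<in> corners m \<Longrightarrow> g (flip w j) = flip (g w) i"
    "\<And>s w. w \<in> corners m \<Longrightarrow> cedge (compose (cube m) s g) w j = cedge s (g w) i"
  using g j
proof (cases rule: face_map_update)
  case (direct i)
  have "cedge (compose (cube m) s g) w j = cedge s (g w) i" if w: "w \<in> corners m" for s w
  proof -
    have "compose (cube m) s g (edge_param w j t) = s (edge_param (g w) i t)" if t: "t \<in> cube 1" for t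
      using direct(2)[OF corners_cube[OF w]] direct(3)[OF corners_cube[OF w]] cube_coord[OF t, of 0]
        face_map_cube[OF face_map_edge_param[OF w j] t] by (auto simp: compose_def edge_param_def)
    then show ?thesis unfolding cedge_def by (auto simp: compose_def fun_eq_iff)
  qed
  moreover have "g (flip w j) = flip (g w) i" if w: "w \<in> corners m" for w
    using direct(2)[OF corners_cube[OF w]] direct(3)[OF corners_cube[OF w]] cube_coord[OF corners_cube[OF w], of j]
    by auto
  ultimately show thesis using that[OF direct(1)] by blast
next
  case (flipped i)
  have "cedge (compose (cube m) s g) w j = cedge s (g w) i" if w: "w \<in> corners m" for s w
  proof -
    have "compose (cube m) s g (edge_param w j t) = s (edge_param (g w) i t)" if t: "t \<in> cube 1" for t
      using flipped(2)[OF corners_cube[OF w]] flipped(3)[OF corners_cube[OF w]] cube_coord[OF t, of 0]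
        corner_01[OF w, of j]
        face_map_cube[OF face_map_edge_param[OF w j] t] by (auto simp: compose_def edge_param_def)
    then show ?thesis unfolding cedge_def by (auto simp: compose_def fun_eq_iff)
  qed
  moreover have "g (flip w j) = flip (g w) i" if w: "w \<in> corners m" for w
    using flipped(2)[OF corners_cube[OF w]] flipped(3)[OF corners_cube[OF w]] cube_coord[OF corners_cube[OF w], of j]
    by auto
  ultimately show thesis using that[OF flipped(1)] by blast
qed

lemma face_map_point: "w \<in> corners n \<Longrightarrow> face_map 0 n (\<lambda>_. w)"
  by (rule face_mapI[of "\<lambda>_. 0"]) (auto simp: corners_def)

lemma cube_0: "t \<in> cube 0 \<Longrightarrow> t = origin"
  by (auto simp: cube_def)

lemma vertexI:
  assumes "is_cube_complex X" "s \<in> X n" "w \<in> corners n" shows "s w \<in> vertices X"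
proof -
  have "compose (cube 0) s (\<lambda>_. w) \<in> X 0" using cc_face[OF assms(1,2) face_map_point[OF assms(3)]] .
  then show ?thesis unfolding vertices_def by (rule rev_image_eqI) (simp add: compose_def)
qed

lemma face_map_0: "face_map k 0 f \<Longrightarrow> k = 0"
  by (erule face_mapE) (metis bot_nat_0.not_eq_extremum not_less0)

text \<open>The common face with a 0-cube is 0-dimensional.\<close>

lemma vertex_corner:
  assumes X: "is_cube_complex X" and s: "s \<in> X n" "t \<in> cube n" and v: "s t \<in> vertices X"
  shows "t \<in> corners n"
proof -
  obtain \<rho> where \<rho>: "\<rho> \<in> X 0" "\<rho> origin = s t" using v unfolding vertices_def by auto
  obtain k f f' u where f: "face_map k n f" "face_map k 0 f'" "u \<in> open_cube k" "f u = t"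
    by (rule common_face[OF X s \<rho>(1) origin_cube \<rho>(2)[symmetric]]) blast
  have k: "k = 0" using face_map_0[OF f(2)] .
  then have "u = origin" using cube_0 open_cube_subset[OF f(3)] by blast
  then show ?thesis using face_map_corner[OF f(1)] f(4) by auto
qed

lemma cube_path_component:
  assumes t: "t \<in> cube n" "t' \<in> cube n"
  shows "path_component_of (top_of_set (cube n)) t t'"
proof -
  define \<gamma> where "\<gamma> r i = (1 - r) * t i + r * t' i" for r :: real and i
  have "continuous_on {0..1} \<gamma>"
    unfolding \<gamma>_def by (intro continuous_on_coordinatewise_then_product continuous_intros)
  moreover have "\<gamma> r \<in> cube n" if "r \<in> {0..1}" for r
  proof -
    have "0 \<le> \<gamma> r i \<and> \<gamma> r i \<le> 1" for i
      using that cube_coord[OF t(1), of i] cube_coord[OF t(2), of i] convex_bound_le[of "t i" 1 "t' i" "1 - r" r]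
      by (auto simp: \<gamma>_def)
    then show ?thesis using t by (auto simp: cube_def \<gamma>_def)
  qed
  ultimately have "pathin (top_of_set (cube n)) \<gamma>"
    by (auto simp: pathin_def continuous_map_in_subtopology)
  moreover have "\<gamma> 0 = t" "\<gamma> 1 = t'" by (auto simp: \<gamma>_def)
  ultimately show ?thesis unfolding path_component_of_def by blast
qed

lemma cube_path:
  assumes s: "s \<in> X n" and t: "t \<in> cube n" "t' \<in> cube n"
  shows "path_component_of (cc_topology X) (s t) (s t')"
  using path_component_of_continuous_image[OF cube_continuous[of s X n, OF s] cube_path_component[OF t]] .

text \<open>The preimage of the subcomplex in a cube contains with each point its whole closed carrier face, so it is a
union of faces, and a cube has only finitely many.\<close>

lemma subcomplex_closed:
  assumes Y: "is_cube_complex Y" and D: "subcomplex Y D"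
  shows "closedin (cc_topology Y) D"
proof -
  have DP: "D \<subseteq> points Y" using D by (simp add: subcomplex_def)
  have "openin (cc_topology Y) (points Y - D)"
    unfolding openin_cc_topology
  proof (intro conjI allI ballI)
    fix n s assume s: "s \<in> Y n"
    define T where "T = {t \<in> cube n. s t \<in> D}"
    (* zs and os collect the coordinates that are 0 and 1, so cell_face (zs t) (os t) is the carrier of t. *)
    define cell_face where "cell_face A B = {x \<in> cube n. (\<forall>i\<in>A. x i = 0) \<and> (\<forall>i\<in>B. x i = 1)}" for A B :: "nat set"
    have closed_cell_face: "closed (cell_face A B)" for A B
    proof -
      have c: "closed {x::nat \<Rightarrow> real. x i = a}" "closed {x::nat \<Rightarrow> real. a \<le> x i}"
        "closed {x::nat \<Rightarrow> real. x i \<le> a}" for i a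
        by (intro closed_Collect_eq closed_Collect_le continuous_intros continuous_on_product_coordinates)+
      have "cell_face A B = (\<Inter>i\<in>{..<n}. {x. 0 \<le> x i} \<inter> {x. x i \<le> 1}) \<inter> (\<Inter>i\<in>{n..}. {x. x i = 0}) \<inter>
        (\<Inter>i\<in>A. {x. x i = 0}) \<inter> (\<Inter>i\<in>B. {x. x i = 1})"
        by (auto simp: cell_face_def cube_def)
      moreover have "closed \<dots>" by (intro closed_Int closed_INT ballI c)
      ultimately show ?thesis by simp
    qed
    define zs os where "zs t = {i. i < n \<and> t i = 0}" and "os t = {i. i < n \<and> t i = 1}" for t :: "nat \<Rightarrow> real"
    have sub: "cell_face (zs t) (os t) \<subseteq> T" if t: "t \<in> T" for t
    proof
      fix x assume x: "x \<in> cell_face (zs t) (os t)"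
      have "t \<in> cube n" "s t \<in> D" using t by (auto simp: T_def)
      then obtain n' s' t' where s': "s' \<in> Y n'" "t' \<in> cube n'" "s t = s' t'" "s' ` cube n' \<subseteq> D"
        using D unfolding subcomplex_def by (metis imageE)
      obtain k f f' u where f: "face_map k n f" "face_map k n' f'" "u \<in> open_cube k" "f u = t"
        "\<And>x. x \<in> cube k \<Longrightarrow> s (f x) = s' (f' x)"
        by (rule common_face[OF Y s \<open>t \<in> cube n\<close> s'(1-3)]) blast
      obtain y where y: "y \<in> cube k" "f y = x"
      proof (rule face_map_range[OF f(1,3)])
        show "x \<in> cube n" using x by (simp add: cell_face_def)
        show "x i = f u i" if "i < n" "f u i = 0 \<or> f u i = 1" for i
          using x that f(4) by (auto simp: cell_face_def zs_def os_def)
      qed blast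
      have "s x = s' (f' y)" using f(5) y by blast
      also have "\<dots> \<in> D" using s'(4) face_map_cube[OF f(2) y(1)] by blast
      finally show "x \<in> T" using x by (simp add: T_def cell_face_def)
    qed
    have "T = (\<Union>t\<in>T. cell_face (zs t) (os t))"
      using sub by (auto simp: cell_face_def zs_def os_def T_def)
    then have "T = (\<Union>S\<in>(\<lambda>t. cell_face (zs t) (os t)) ` T. S)" by simp
    moreover have "(\<lambda>t. cell_face (zs t) (os t)) ` T \<subseteq> (\<lambda>(A, B). cell_face A B) ` (Pow {..<n} \<times> Pow {..<n})"
      by (auto simp: zs_def os_def intro!: image_eqI)
    then have "finite ((\<lambda>t. cell_face (zs t) (os t)) ` T)"
      by (rule finite_subset) simp
    then have "closed (\<Union>S\<in>(\<lambda>t. cell_face (zs t) (os t)) ` T. S)"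
      using closed_cell_face by (intro closed_UN) auto
    ultimately have "closed T" by simp
    then have "openin (top_of_set (cube n)) (cube n \<inter> - T)" by (simp add: openin_open_Int open_Compl)
    moreover have "{t \<in> cube n. s t \<in> points Y - D} = cube n \<inter> - T"
      using pointsI[of s Y n, OF s] by (auto simp: T_def)
    ultimately show "openin (top_of_set (cube n)) {t \<in> cube n. s t \<in> points Y - D}" by simp
  qed auto
  then show ?thesis using DP by (simp add: closedin_def)
qed

definition edges_within :: "'a cube_complex \<Rightarrow> 'a set \<Rightarrow> ('a \<times> 'a) set" where
  "edges_within Y P = {(d origin, d unit_end) | d. d \<in> Y 1 \<and> d ` cube 1 \<subseteq> P}"

lemma corners_joined:
  assumes Y: "is_cube_complex Y" and s: "s \<in> Y n" "s ` cube n \<subseteq> P" and w: "w0 \<in> corners n" "w \<in> corners n"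
  shows "(s w0, s w) \<in> (edges_within Y P)\<^sup>*"
  using w
proof (induction rule: corner_induct)
  case (flip w i)
  have "cedge s w i ` cube 1 \<subseteq> P"
    using s(2) face_map_cube[OF face_map_edge_param[OF flip(1,2)]] by (auto simp: cedge_def compose_def)
  then have "(cedge s w i origin, cedge s w i unit_end) \<in> edges_within Y P"
    unfolding edges_within_def using cedge_in[OF Y s(1) flip(1,2)] by blast
  then have "(s w, s (flip w i)) \<in> edges_within Y P"
    by (simp only: cedge_origin[OF flip(1)] cedge_end[OF flip(1)])
  with flip(3) show ?case by (rule rtrancl.rtrancl_into_rtrancl)
qed simp

text \<open>The cubes of \<open>P\<close> whose corners can be reached from \<open>u\<close> by edges form a subcomplex, and so do the others:
cubes that touch share a face and hence a corner. Both unions are closed and disjoint, and \<open>C\<close> is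
connected.\<close>

theorem edge_connected:
  assumes Y: "is_cube_complex Y" and P: "subcomplex Y P"
    and C: "connectedin (cc_topology Y) C" "C \<subseteq> P"
    and uv: "u \<in> vertices Y" "u \<in> C" "v \<in> vertices Y" "v \<in> C"
  shows "(u, v) \<in> (edges_within Y P)\<^sup>*"
proof -
  define good where "good n s \<longleftrightarrow> s \<in> Y n \<and> s ` cube n \<subseteq> P \<and> (u, s origin) \<in> (edges_within Y P)\<^sup>*" for n s
  have touch: "good n s"
    if s: "s \<in> Y n" "s ` cube n \<subseteq> P" "t \<in> cube n" and s': "good n' s'" "t' \<in> cube n'" "s t = s' t'"
    for n s t n' s' t'
  proof -
    have s'Y: "s' \<in> Y n'" using s' by (simp add: good_def)
    obtain k f f' y where f: "face_map k n f" "face_map k n' f'"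
      "\<And>x. x \<in> cube k \<Longrightarrow> s (f x) = s' (f' x)"
      by (rule common_face[OF Y s(1,3) s'Y s'(2,3)]) blast
    note fo = face_map_corner[OF f(1) origin_corner] face_map_corner[OF f(2) origin_corner]
    have "(s' origin, s' (f' origin)) \<in> (edges_within Y P)\<^sup>*"
      using corners_joined[OF Y s'Y _ origin_corner fo(2)] s'(1) by (simp add: good_def)
    moreover have "(s (f origin), s origin) \<in> (edges_within Y P)\<^sup>*"
      using corners_joined[OF Y s(1,2) fo(1) origin_corner] .
    ultimately show ?thesis using f(3)[OF origin_cube] s' s unfolding good_def by (metis rtrancl_trans)
  qed
  have in_cube: "\<exists>n s t. s \<in> Y n \<and> s ` cube n \<subseteq> P \<and> t \<in> cube n \<and> z = s t" if "z \<in> P" for z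
    using P that unfolding subcomplex_def by blast
  define D where "D = {s t | n s t. good n s \<and> t \<in> cube n}"
  have PY: "P \<subseteq> points Y" using P by (simp add: subcomplex_def)
  have DP: "D \<subseteq> P" by (auto simp: D_def good_def)
  have 1: "subcomplex Y D"
    unfolding subcomplex_def
  proof (intro conjI ballI)
    show "D \<subseteq> points Y" using DP PY by blast
    fix x assume "x \<in> D"
    then obtain n s t where "good n s" "t \<in> cube n" "x = s t" by (auto simp: D_def)
    moreover from this have "s ` cube n \<subseteq> D" by (auto simp: D_def)
    ultimately show "\<exists>n. \<exists>\<sigma>\<in>Y n. x \<in> \<sigma> ` cube n \<and> \<sigma> ` cube n \<subseteq> D" by (auto simp: good_def)
  qed
  have 2: "subcomplex Y (P - D)"
    unfolding subcomplex_def
  proof (intro conjI ballI)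
    show "P - D \<subseteq> points Y" using PY by blast
    fix x assume x: "x \<in> P - D"
    then obtain n s t where s: "s \<in> Y n" "s ` cube n \<subseteq> P" "t \<in> cube n" "x = s t" using in_cube by blast
    have "\<not> good n s" using x s by (auto simp: D_def)
    then have "s t' \<notin> D" if "t' \<in> cube n" for t'
      using touch[OF s(1,2) that] by (auto simp: D_def)
    then have "s ` cube n \<subseteq> P - D" using s(2) by blast
    then show "\<exists>n. \<exists>\<sigma>\<in>Y n. x \<in> \<sigma> ` cube n \<and> \<sigma> ` cube n \<subseteq> P - D" using s by blast
  qed
  have start: "w \<in> corners n \<Longrightarrow> s \<in> Y n \<Longrightarrow> s ` cube n \<subseteq> P \<Longrightarrow> u = s w \<Longrightarrow> good n s" for s n w
    using corners_joined[OF Y _ _ _ origin_corner] by (simp add: good_def)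
  obtain n s t where s: "s \<in> Y n" "s ` cube n \<subseteq> P" "t \<in> cube n" "u = s t" using in_cube uv C by blast
  then have "good n s" using start vertex_corner[OF Y s(1,3)] uv by simp
  then have "u \<in> D" using s by (auto simp: D_def)
  moreover have "C \<subseteq> D \<union> (P - D)" using C by blast
  moreover have "closedin (cc_topology Y) D" "closedin (cc_topology Y) (P - D)"
    using subcomplex_closed[OF Y] 1 2 by auto
  ultimately have "C \<inter> (P - D) = {}"
    using C(1) uv(2) unfolding connectedin_closedin by blast
  then have "v \<in> D" using uv C by blast
  then obtain n s t where g: "good n s" "t \<in> cube n" "v = s t" by (auto simp: D_def)
  then have "t \<in> corners n" using vertex_corner[OF Y] uv by (auto simp: good_def)
  then have "(s origin, s t) \<in> (edges_within Y P)\<^sup>*"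
    using corners_joined[OF Y, of s n P origin t] g by (simp add: good_def)
  then show ?thesis using g unfolding good_def by (metis rtrancl_trans)
qed

section \<open>Colouring the edges of the universal cover by hyperplanes\<close>

lemma image_compose_cube: "compose S f g ` S = f ` g ` S"
  by (auto simp: compose_def image_iff)

lemma parallel_class:
  assumes "(e, f) \<in> parallel X" shows "parallel X `` {e} = parallel X `` {f}"
proof -
  have s: "sym (parallel X)" and t: "trans (parallel X)"
    unfolding parallel_def by (auto intro: sym_rtrancl sym_Un_converse trans_rtrancl)
  show ?thesis using assms s t by (auto elim: transE dest: symD)
qed

lemma link_singleton: "d \<in> X 1 \<Longrightarrow> d \<in> extensional (cube 1) \<Longrightarrow> {d} \<in> link X (d origin)"
proof -
  assume d: "d \<in> X 1" "d \<in> extensional (cube 1)"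
  have "corner_edge d 0 t = d t" for t
  proof (cases "t \<in> cube 1")
    case True
    then have "origin(0 := t 0) = t" by (auto simp: cube_def fun_eq_iff)
    then show ?thesis using True by (simp add: corner_edge_def compose_def)
  next
    case False
    then show ?thesis using d(2) by (simp add: corner_edge_def compose_def extensional_def)
  qed
  then have "corner_edge d ` {..<1} = {d}" by auto
  then show ?thesis unfolding link_def using d(1) by blast
qed

lemma lessThan_2: "{..<2} = {0, 1 :: nat}"
  by auto

definition square_param :: "(nat \<Rightarrow> real) \<Rightarrow> nat \<Rightarrow> nat \<Rightarrow> (nat \<Rightarrow> real) \<Rightarrow> (nat \<Rightarrow> real)" where
  "square_param w i j t =
     w(i := (if w i = 0 then t 0 else 1 - t 0), j := (if w j = 0 then t 1 else 1 - t 1))"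

lemma face_map_square_param:
  assumes w: "w \<in> corners n" and ij: "i < n" "j < n" "i \<noteq> j"
  shows "face_map 2 n (square_param w i j)"
proof (rule face_mapI[of "\<lambda>k. if k = 0 then i else j"])
  show "inj_on (\<lambda>k. if k = 0 then i else j) {..<2::nat}" using ij by (auto simp: lessThan_2)
  show "(\<forall>t\<in>cube 2. square_param w i j t (if k = 0 then i else j) = t k) \<or>
      (\<forall>t\<in>cube 2. square_param w i j t (if k = 0 then i else j) = 1 - t k)"
    if "k < 2" for k
    using that ij by (auto simp: square_param_def less_2_cases_iff)
  show "(\<forall>t\<in>cube 2. square_param w i j t l = 0) \<or> (\<forall>t\<in>cube 2. square_param w i j t l = 1)"
    if "l < n" "l \<notin> (\<lambda>k. if k = 0 then i else j) ` {..<2::nat}" for l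
    using that corner_01[OF w, of l] by (auto simp: square_param_def lessThan_2)
  show "square_param w i j t l = 0" if "n \<le> l" for l t
    using that ij w by (auto simp: square_param_def corners_def)
qed (use ij in auto)

locale special_cover =
  fixes X :: "'a cube_complex" and Y :: "'b cube_complex" and p :: "'b \<Rightarrow> 'a"
  assumes special: "weakly_special X" and univ: "universal_cover Y p X"
begin

lemma X_cc: "is_cube_complex X"
  using special by (simp add: weakly_special_def)

lemma npc: "nonpositively_curved X"
  using special by (simp add: weakly_special_def)

lemma Y_cc: "is_cube_complex Y"
  using univ by (simp add: universal_cover_def)

lemma Y_simply: "simply_connected_space (cc_topology Y)"
  using univ by (simp add: universal_cover_def)

lemma p_cov: "covering_map (cc_topology Y) p (cc_topology X)"
  using univ by (simp add: universal_cover_def)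

sublocale cubical_cover Y p X
proof
  show "is_cube_complex X" by (rule X_cc)
  have "p ` points Y = points X" using p_cov unfolding covering_map_def by simp
  then show "cubical_covering Y p X"
    unfolding cubical_covering_def using univ[unfolded universal_cover_def] cc_face[OF Y_cc]
    by blast
qed

text \<open>The colour of an edge is the hyperplane of the base dual to its image.\<close>

definition col :: "((nat \<Rightarrow> real) \<Rightarrow> 'b) \<Rightarrow> 'a set set" where
  "col d = parallel X `` {p ` d ` cube 1}"

definition ccol :: "((nat \<Rightarrow> real) \<Rightarrow> 'b) \<Rightarrow> nat \<Rightarrow> 'a set set" where
  "ccol s i = col (cedge s origin i)"

lemma col_parallel_edges:
  assumes s: "s \<in> Y n" and w: "w \<in> corners n" and ij: "i < n" "j < n" "i \<noteq> j"
  shows "col (cedge s (w(j := 0)) i) = col (cedge s (w(j := 1)) i)"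
proof -
  define g where "g = square_param (w(i := 0, j := 0)) i j"
  have g: "face_map 2 n g"
    unfolding g_def using w ij by (intro face_map_square_param) (auto simp: corners_def)
  have g_def: "g t = w(j := t 1, i := t 0)" for t
    using ij by (auto simp: g_def square_param_def)
  define \<sigma> where "\<sigma> = compose (cube 2) p (compose (cube 2) s g)"
  have \<sigma>: "\<sigma> \<in> X 2" unfolding \<sigma>_def by (rule proj[OF cc_face[OF Y_cc s g]])
  have im: "\<sigma> ` {t \<in> cube 2. t 1 = a} = p ` cedge s (w(j := a)) i ` cube 1" if a: "a = 0 \<or> a = 1" for a
  proof -
    have "g ` {t \<in> cube 2. t 1 = a} = {w(j := a, i := x) | x. 0 \<le> x \<and> x \<le> 1}"
    proof (intro equalityI subsetI)
      fix z assume "z \<in> g ` {t \<in> cube 2. t 1 = a}"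
      then obtain t where "t \<in> cube 2" "t 1 = a" "z = g t" by blast
      then show "z \<in> {w(j := a, i := x) | x. 0 \<le> x \<and> x \<le> 1}"
        using cube_coord[of t 2 0] by (auto simp: g_def)
    next
      fix z assume "z \<in> {w(j := a, i := x) | x. 0 \<le> x \<and> x \<le> 1}"
      then obtain x where x: "z = w(j := a, i := x)" "0 \<le> x" "x \<le> 1" by blast
      show "z \<in> g ` {t \<in> cube 2. t 1 = a}"
        by (rule image_eqI[of _ _ "origin(0 := x, 1 := a)"])
           (use x a in \<open>auto simp: g_def cube_def\<close>)
    qed
    moreover have "\<sigma> ` {t \<in> cube 2. t 1 = a} = p ` s ` g ` {t \<in> cube 2. t 1 = a}"
      by (auto simp: \<sigma>_def compose_def image_iff)
    moreover have "w(j := a) \<in> corners n" using w a ij by (auto simp: corners_def)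
    ultimately show ?thesis by (simp only: cedge_image)
  qed
  have "(p ` cedge s (w(j := 0)) i ` cube 1, p ` cedge s (w(j := 1)) i ` cube 1) \<in> elementary_parallel X"
    unfolding elementary_parallel_def im[OF disjI1[OF refl], symmetric] im[OF disjI2[OF refl], symmetric]
    by (intro CollectI exI[of _ \<sigma>] conjI refl \<sigma>)
  then have "(p ` cedge s (w(j := 0)) i ` cube 1, p ` cedge s (w(j := 1)) i ` cube 1) \<in> parallel X"
    unfolding parallel_def by blast
  then show ?thesis unfolding col_def by (rule parallel_class)
qed

lemma col_cedge_flip:
  assumes "w \<in> corners n" "i < n" shows "col (cedge s (flip w i) i) = col (cedge s w i)"
proof -
  have "cedge s (flip w i) i ` cube 1 = cedge s w i ` cube 1"
    by (simp only: cedge_image[OF flip_corner[OF assms]] cedge_image[OF assms(1)] fun_upd_upd)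
  then show ?thesis by (simp only: col_def)
qed

text \<open>Edges in the same direction of a cube are parallel, as any two corners are joined by flipping coordinates.\<close>

lemma col_cedge:
  assumes s: "s \<in> Y n" and w: "w \<in> corners n" and i: "i < n"
  shows "col (cedge s w i) = ccol s i"
  using origin_corner w
proof (induction rule: corner_induct)
  case base
  show ?case by (simp add: ccol_def)
next
  case (flip w j)
  show ?case
  proof (cases "i = j")
    case True
    show ?thesis using flip(3) unfolding True by (rule trans[OF col_cedge_flip[OF flip(1,2)]])
  next
    case False
    have "col (cedge s (flip w j) i) = col (cedge s w i)"
      using col_parallel_edges[OF s flip(1) i flip(2) False] corner_01[OF flip(1), of j]
      by (auto simp: fun_upd_idem)
    then show ?thesis using flip(3) by (rule trans)
  qed
qed

text \<open>This is where weak specialness enters. Two edges at one vertex whose images are different and dual to the same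
hyperplane would make it self-intersect or self-osculate. If the images coincide as sets, the edges
coincide, since they start at the same vertex and the image is not a loop.\<close>

lemma edge_det:
  assumes d: "d \<in> Y 1" "d' \<in> Y 1" and o: "d origin = d' origin" and c: "col d = col d'"
  shows "d = d'"
proof -
  define e e' where "e = compose (cube 1) p d" and "e' = compose (cube 1) p d'"
  have eX: "e \<in> X 1" "e' \<in> X 1" using proj d by (auto simp: e_def e'_def)
  have im: "e ` cube 1 = p ` d ` cube 1" "e' ` cube 1 = p ` d' ` cube 1"
    by (simp_all add: e_def e'_def image_compose_cube)
  have eo: "e origin = e' origin" using o by (simp add: e_def e'_def compose_def)
  define H where "H = parallel X `` {e ` cube 1}"
  have H: "H \<in> hyperplanes X" unfolding hyperplanes_def H_def
    using eX by (auto simp: edges_def intro: quotientI)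
  have refl: "(a, a) \<in> parallel X" for a by (simp add: parallel_def)
  have "parallel X `` {e' ` cube 1} = H" using c im by (simp add: col_def H_def)
  then have eH: "e ` cube 1 \<in> H" "e' ` cube 1 \<in> H" using refl by (auto simp: H_def)
  have ns: "\<not> self_intersects X H" "\<not> self_osculates X H"
    using special H by (auto simp: weakly_special_def)
  have x: "e origin \<in> vertices X" using vertexI[OF X_cc eX(1) origin_corner] .
  have ox: "e origin \<in> e ` cube 1" "e origin \<in> e' ` cube 1"
    using eo by (auto intro: image_eqI[of _ _ origin])
  have same: "e ` cube 1 = e' ` cube 1"
  proof (rule ccontr)
    assume ne: "e ` cube 1 \<noteq> e' ` cube 1"
    show False
    proof (cases "square_corner X (e origin) (e ` cube 1) (e' ` cube 1)")
      case True
      then have "self_intersects X H" unfolding self_intersects_def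
        by (intro bexI[OF _ eH(1)] bexI[OF _ eH(2)] bexI[OF _ x] conjI ne ox)
      then show False using ns by blast
    next
      case False
      then have "self_osculates X H" unfolding self_osculates_def
        by (intro disjI1 bexI[OF _ eH(1)] bexI[OF _ eH(2)] bexI[OF _ x] conjI ne ox)
      then show False using ns by blast
    qed
  qed
  \<comment> \<open>The two parametrisations share an interior point, so they agree or are reverses of each other.\<close>
  define u :: "nat \<Rightarrow> real" where "u = origin(0 := 1/2)"
  have u: "u \<in> open_cube 1" by (auto simp: u_def open_cube_def)
  have "e u \<in> e' ` cube 1" using same open_cube_subset[OF u] by blast
  then obtain t where t: "t \<in> cube 1" "e u = e' t" by blast
  obtain f where f: "face_map 1 1 f" "\<And>x. x \<in> cube 1 \<Longrightarrow> e' (f x) = e x"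
    by (rule open_point_face[OF X_cc eX(1) u eX(2) t]) blast
  have out: "f x i = 0" if "x \<in> cube 1" "i \<noteq> 0" for x i using face_map_outside[OF f(1) that(1), of i] that by simp
  obtain j where j: "j < (1::nat)" "(\<forall>x\<in>cube 1. f x j = x 0) \<or> (\<forall>x\<in>cube 1. f x j = 1 - x 0)"
    using face_map_coord_inv[OF f(1), of 0] by auto
  from j(2) show ?thesis
  proof
    assume *: "\<forall>x\<in>cube 1. f x j = x 0"
    have "f x = x" if x: "x \<in> cube 1" for x
    proof
      fix i show "f x i = x i" using * j(1) out[OF x, of i] x by (cases "i = 0") (auto simp: cube_def)
    qed
    then have "e' x = e x" if "x \<in> cube 1" for x using f(2)[OF that] that by simp
    then show ?thesis
      by (intro unique[OF d origin_cube o]) (auto simp: e_def e'_def compose_def split: if_splits)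
  next
    assume *: "\<forall>x\<in>cube 1. f x j = 1 - x 0"
    have "f origin = unit_end"
    proof
      fix i show "f origin i = unit_end i" using * j(1) out[OF origin_cube, of i] by (cases "i = 0") auto
    qed
    then have "e' origin = e' unit_end" using f(2)[OF origin_cube] eo by simp
    then have "self_osculates X H" unfolding self_osculates_def
      by (intro disjI2 bexI[OF _ eX(2)] conjI eH(2))
    then show ?thesis using ns by blast
  qed
qed

definition ed :: "'b \<Rightarrow> 'a set set \<Rightarrow> bool" where
  "ed v c \<longleftrightarrow> (\<exists>d\<in>Y 1. d origin = v \<and> col d = c)"

definition edge :: "'b \<Rightarrow> 'a set set \<Rightarrow> ((nat \<Rightarrow> real) \<Rightarrow> 'b)" where
  "edge v c = (THE d. d \<in> Y 1 \<and> d origin = v \<and> col d = c)"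

definition mv :: "'b \<Rightarrow> 'a set set \<Rightarrow> 'b" where
  "mv v c = edge v c unit_end"

definition sq :: "'b \<Rightarrow> 'a set set \<Rightarrow> 'a set set \<Rightarrow> bool" where
  "sq v c d \<longleftrightarrow> (\<exists>s\<in>Y 2. s origin = v \<and> ccol s 0 = c \<and> ccol s 1 = d)"

lemma edge_eq: "d \<in> Y 1 \<Longrightarrow> edge (d origin) (col d) = d"
  unfolding edge_def by (rule the_equality) (auto intro: edge_det)

lemma mv_eq: "d \<in> Y 1 \<Longrightarrow> mv (d origin) (col d) = d unit_end"
  by (simp add: mv_def edge_eq)

lemma ccol_edge: "ccol d 0 = col d"
  unfolding ccol_def col_def by (simp only: cedge_image[OF origin_corner[of 1]] unit_line[OF origin_corner])

lemma edge_props: "ed v c \<Longrightarrow> edge v c \<in> Y 1 \<and> edge v c origin = v \<and> col (edge v c) = c"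
  unfolding ed_def using edge_eq by auto

lemma cube_ed:
  assumes s: "s \<in> Y n" "w \<in> corners n" "i < n"
  shows "ed (s w) (ccol s i)" "edge (s w) (ccol s i) = cedge s w i" "mv (s w) (ccol s i) = s (flip w i)"
proof -
  note c = cedge_in[OF Y_cc s] col_cedge[OF s]
  show "ed (s w) (ccol s i)" unfolding ed_def using c s(2) by (intro bexI[of _ "cedge s w i"]) auto
  show "edge (s w) (ccol s i) = cedge s w i" "mv (s w) (ccol s i) = s (flip w i)"
    using edge_eq[OF c(1)] mv_eq[OF c(1)] c(2) s(2) by simp_all
qed

lemma cube_sq:
  assumes s: "s \<in> Y n" and w: "w \<in> corners n" and ij: "i < n" "j < n" "i \<noteq> j"
  shows "sq (s w) (ccol s i) (ccol s j)"
proof -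
  define g where "g = square_param w i j"
  have g: "face_map 2 n g" unfolding g_def by (rule face_map_square_param[OF w ij])
  define s2 where "s2 = compose (cube 2) s g"
  have s2: "s2 \<in> Y 2" unfolding s2_def by (rule cc_face[OF Y_cc s g])
  have g0: "g origin = w" using corner_01[OF w, of i] corner_01[OF w, of j] by (auto simp: g_def square_param_def)
  have ge: "g (origin(0 := t 0)) = edge_param w i t" "g (origin(1 := t 0)) = edge_param w j t" for t
    using corner_01[OF w, of i] corner_01[OF w, of j] ij by (auto simp: g_def square_param_def edge_param_def)
  have oc: "origin(0 := t 0) \<in> cube 2" "origin(1 := t 0) \<in> cube 2" if "t \<in> cube 1" for t
    using cube_coord[OF that, of 0] by (auto simp: cube_def)
  have "cedge s2 origin 0 = cedge s w i" "cedge s2 origin 1 = cedge s w j"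
    using ge oc by (auto simp: cedge_def s2_def compose_def edge_param_def[of origin] intro!: ext)
  then have "ccol s2 0 = ccol s i" "ccol s2 1 = ccol s j"
    using col_cedge[OF s w] ij by (auto simp: ccol_def)
  moreover have "s2 origin = s w" using g0 by (simp add: s2_def compose_def)
  ultimately show ?thesis unfolding sq_def using s2 by blast
qed

lemma sq_corner:
  assumes "sq v c d"
  obtains s where "s \<in> Y 2" "v = s origin" "c = ccol s 0" "d = ccol s 1"
  using assms unfolding sq_def by blast

definition proj_edge :: "((nat \<Rightarrow> real) \<Rightarrow> 'b) \<Rightarrow> ((nat \<Rightarrow> real) \<Rightarrow> 'a)" where
  "proj_edge d = compose (cube 1) p d"

lemma proj_edge_corner: "i < n \<Longrightarrow> corner_edge (compose (cube n) p s) i = proj_edge (cedge s origin i)"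
  by (simp add: corner_edge_cedge cedge_compose proj_edge_def)

lemma sq_link:
  assumes "sq v c d" shows "{proj_edge (edge v c), proj_edge (edge v d)} \<in> link X (p v)"
proof -
  obtain s where s: "s \<in> Y 2" "v = s origin" "c = ccol s 0" "d = ccol s 1" using sq_corner[OF assms] .
  have "edge v c = cedge s origin 0" "edge v d = cedge s origin 1"
    using cube_ed(2)[OF s(1) origin_corner] s by auto
  then have "{proj_edge (edge v c), proj_edge (edge v d)} = corner_edge (compose (cube 2) p s) ` {..<2}"
    by (simp add: lessThan_2 proj_edge_corner)
  moreover have "compose (cube 2) p s origin = p v" using s by (simp add: compose_def)
  ultimately show ?thesis unfolding link_def using proj[OF s(1)] by blast
qed

lemma ed_link: assumes "ed v c" shows "{proj_edge (edge v c)} \<in> link X (p v)"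
proof -
  have e: "edge v c \<in> Y 1" "edge v c origin = v" using edge_props[OF assms] by auto
  have "proj_edge (edge v c) \<in> X 1" using proj[OF e(1)] by (simp add: proj_edge_def)
  moreover have "proj_edge (edge v c) \<in> extensional (cube 1)" by (simp add: proj_edge_def)
  moreover have "proj_edge (edge v c) origin = p v" using e by (simp add: proj_edge_def compose_def)
  ultimately show ?thesis using link_singleton by metis
qed

lemma npc_inj: "\<sigma> \<in> X n \<Longrightarrow> inj_on (corner_edge \<sigma>) {..<n}"
  using npc unfolding nonpositively_curved_def by simp

lemma npc_unique:
  assumes "\<sigma> \<in> X n" "\<tau> \<in> X n" "\<sigma> origin = \<tau> origin" "\<And>i. i < n \<Longrightarrow> corner_edge \<sigma> i = corner_edge \<tau> i"
  shows "\<sigma> = \<tau>"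
  using npc[unfolded nonpositively_curved_def, THEN conjunct2, THEN conjunct1, rule_format, OF assms(1,2)]
    assms(3,4) by simp

lemma npc_flag: "v \<in> vertices X \<Longrightarrow> flag (link X v)"
  using npc unfolding nonpositively_curved_def by simp

lemma p_vertex: "v \<in> vertices Y \<Longrightarrow> p v \<in> vertices X"
proof -
  assume "v \<in> vertices Y"
  then obtain \<rho> where \<rho>: "\<rho> \<in> Y 0" "v = \<rho> origin" unfolding vertices_def by auto
  show ?thesis using vertexI[OF X_cc proj[OF \<rho>(1)] origin_corner] \<rho>(2) by (simp add: compose_def)
qed

lemma ed_vertex: "ed v c \<Longrightarrow> v \<in> vertices Y"
  unfolding ed_def using vertexI[OF Y_cc _ origin_corner] by blast

lemma lift_edge_unique:
  assumes d: "d \<in> Y 1" "d' \<in> Y 1" "d origin = d' origin" "proj_edge d = proj_edge d'"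
  shows "d = d'"
proof (rule unique[OF d(1,2) origin_cube d(3)])
  show "p (d x) = p (d' x)" if "x \<in> cube 1" for x
    using fun_cong[OF d(4), of x] that by (simp add: proj_edge_def compose_def)
qed

text \<open>Simplices of links in the base are realised by corners of cubes in the cover.\<close>

lemma link_lift:
  assumes v: "v \<in> points Y" and S: "S \<in> link X (p v)"
  obtains n s where "s \<in> Y n" "s origin = v" "(\<lambda>i. proj_edge (cedge s origin i)) ` {..<n} = S"
proof -
  obtain n \<sigma> where \<sigma>: "\<sigma> \<in> X n" "corner_edge \<sigma> ` {..<n} = S" "\<sigma> origin = p v"
    using S unfolding link_def by blast
  obtain s where s: "s \<in> Y n" "s origin = v" "\<And>x. x \<in> cube n \<Longrightarrow> p (s x) = \<sigma> x"
    by (rule lift[OF \<sigma>(1) origin_cube v \<sigma>(3)[symmetric]]) blast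
  have "compose (cube n) p s = \<sigma>"
    using s(3) cc_ext[OF X_cc \<sigma>(1)] by (auto simp: compose_def extensional_def fun_eq_iff)
  then have "(\<lambda>i. proj_edge (cedge s origin i)) ` {..<n} = S"
    using \<sigma>(2) proj_edge_corner[of _ n s] by (metis (mono_tags, lifting) image_cong lessThan_iff)
  then show thesis using that s by blast
qed

lemma sq_edges: "sq v c d \<Longrightarrow> ed v c \<and> ed v d"
  using cube_ed(1)[of _ 2 origin 0] cube_ed(1)[of _ 2 origin 1] by (auto elim!: sq_corner)

text \<open>Flagness of the link in the base provides a 3-cube, which is lifted to \<open>v\<close>. Its edges at \<open>v\<close> are the given
ones, as edges lift uniquely.\<close>

lemma sq_cube:
  assumes ab: "sq v a b" and bc: "sq v b c" and ac: "sq v a c"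
    and ne: "a \<noteq> b" "b \<noteq> c" "a \<noteq> c"
  shows "sq (mv v a) b c"
proof -
  have e: "ed v a" "ed v b" "ed v c" using ab bc sq_edges by auto
  define S where "S = {proj_edge (edge v a), proj_edge (edge v b), proj_edge (edge v c)}"
  have v: "v \<in> vertices Y" using ed_vertex[OF e(1)] .
  have vp: "v \<in> points Y" using v by (auto simp: vertices_def intro: pointsI)
  have "\<forall>x\<in>S. \<forall>y\<in>S. {x, y} \<in> link X (p v)"
    using sq_link[OF ab] sq_link[OF bc] sq_link[OF ac] e[THEN ed_link]
    by (auto simp: S_def insert_commute)
  moreover have "finite S" by (simp add: S_def)
  ultimately have "S \<in> link X (p v)"
    by (intro npc_flag[OF p_vertex[OF v], unfolded flag_def, THEN spec, THEN mp] conjI)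
  then obtain n s where s: "s \<in> Y n" "s origin = v" "(\<lambda>i. proj_edge (cedge s origin i)) ` {..<n} = S"
    using link_lift[OF vp] by blast
  have ex: "\<exists>i<n. ccol s i = x" if x: "ed v x" "proj_edge (edge v x) \<in> S" for x
  proof -
    obtain i where i: "i < n" "proj_edge (cedge s origin i) = proj_edge (edge v x)"
      using s(3) x(2) by (metis (no_types, lifting) imageE lessThan_iff)
    have "cedge s origin i = edge v x"
      by (rule lift_edge_unique) (use i cedge_in[OF Y_cc s(1) origin_corner i(1)] edge_props[OF x(1)] s(2) in auto)
    then have "ccol s i = x" using edge_props[OF x(1)] by (simp add: ccol_def)
    then show ?thesis using i by blast
  qed
  obtain i j k where ijk: "i < n" "ccol s i = a" "j < n" "ccol s j = b" "k < n" "ccol s k = c"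
    using ex[OF e(1)] ex[OF e(2)] ex[OF e(3)] by (auto simp: S_def)
  have "mv v a = s (flip origin i)" using cube_ed(3)[OF s(1) origin_corner ijk(1)] ijk s(2) by simp
  then show ?thesis
    using cube_sq[OF s(1) flip_corner[OF origin_corner ijk(1)] ijk(3,5)] ijk ne by auto
qed

lemma sq_neq: "sq v c d \<Longrightarrow> c \<noteq> d"
proof
  assume "sq v c d" "c = d"
  then obtain s where s: "s \<in> Y 2" "ccol s 0 = ccol s 1" by (metis sq_corner)
  have "cedge s origin 0 = cedge s origin 1"
    by (rule edge_det) (use s cedge_in[OF Y_cc s(1) origin_corner] in \<open>auto simp: ccol_def\<close>)
  then have "corner_edge (compose (cube 2) p s) 0 = corner_edge (compose (cube 2) p s) 1"
    by (simp add: proj_edge_corner)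
  then show False using npc_inj[OF proj[OF s(1)]] by (auto simp: lessThan_2)
qed

sublocale C: coloured_squares ed mv sq
proof
  fix v c d
  {
    assume "ed v c"
    note e = edge_props[OF this]
    have e1: "edge v c \<in> Y 1" using e by simp
    have cc: "ccol (edge v c) 0 = c" using e by (simp add: ccol_edge)
    have m: "mv v c = edge v c unit_end" by (simp add: mv_def)
    have fl: "flip unit_end 0 = origin" by auto
    have uc: "unit_end \<in> corners 1" by simp
    show "ed (mv v c) c" using cube_ed(1)[OF e1 uc, of 0] cc m by simp
    show "mv (mv v c) c = v" using cube_ed(3)[OF e1 uc, of 0] cc m fl e by simp
  }
  {
    assume "sq v c d"
    then obtain s where s: "s \<in> Y 2" "v = s origin" "c = ccol s 0" "d = ccol s 1" by (rule sq_corner)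
    note o = origin_corner[of 2]
    show "ed v c" using cube_ed(1)[OF s(1) o] s by simp
    show "c \<noteq> d" by (rule sq_neq[OF \<open>sq v c d\<close>])
    show "sq v d c" using cube_sq[OF s(1) o, of 1 0] s by simp
    have m: "mv v c = s (flip origin 0)" "mv v d = s (flip origin 1)"
      using cube_ed(3)[OF s(1) o] s by auto
    have f: "flip origin 0 \<in> corners 2" "flip origin 1 \<in> corners 2" using flip_corner[OF o] by auto
    show "sq (mv v c) c d" using cube_sq[OF s(1) f(1), of 0 1] s m by simp
    have "flip (flip origin 0) 1 = flip (flip origin 1) 0" by auto
    then show "mv (mv v c) d = mv (mv v d) c"
      using cube_ed(3)[OF s(1) f(1), of 1] cube_ed(3)[OF s(1) f(2), of 0] s m by simp
  }
  show "sq (mv v a) b c" if "sq v a b" "sq v b c" "sq v a c" for a b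
    using sq_cube that sq_neq by blast
qed

end

section \<open>The combinatorial universal cover\<close>

text \<open>A free homotopy between two constant loops moves the base point along a path.\<close>

lemma simply_connected_path_components:
  assumes T: "simply_connected_space T" and x: "x \<in> topspace T" and y: "y \<in> topspace T"
  shows "path_component_of T x y"
proof -
  have "pathin T (\<lambda>_. x)" "pathin T (\<lambda>_. y)" using x y by (auto simp: pathin_const)
  then have "homotopic_with (\<lambda>r. r 1 = r 0) (top_of_set {0..1::real}) T (\<lambda>_. x) (\<lambda>_. y)"
    using T[unfolded simply_connected_space_def, rule_format, of "\<lambda>_. x" "\<lambda>_. y"] by simp
  then obtain h :: "real \<times> real \<Rightarrow> _" where
    h: "continuous_map (prod_topology (top_of_set {0..1}) (top_of_set {0..1})) T h"
    "\<And>t. h (0, t) = x" "\<And>t. h (1, t) = y"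
    unfolding homotopic_with_def by (elim exE conjE) (rule that, assumption, simp_all)
  have "continuous_map (top_of_set {0..1}) (prod_topology (top_of_set {0..1}) (top_of_set {0..1}))
      (\<lambda>s::real. (s, 0::real))"
    by (intro continuous_map_pairedI) auto
  from continuous_map_compose[OF this h(1)] have "pathin T (\<lambda>s. h (s, 0))"
    by (simp add: pathin_def o_def)
  then show ?thesis unfolding path_component_of_def using h by (intro exI[of _ "\<lambda>s. h (s, 0)"]) auto
qed

lemma simply_connected_connected: "simply_connected_space T \<Longrightarrow> connected_space T"
  by (rule path_connected_imp_connected_space)
     (simp add: path_connected_space_iff_path_component simply_connected_path_components)

lemma covering_simply_connected_inj:
  assumes cov: "covering_map E q S" and S: "simply_connected_space S"
    and e: "path_component_of E e e'" "q e = q e'"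
  shows "e = e'"
proof -
  obtain g where g: "pathin E g" "g 0 = e" "g 1 = e'" using e(1) by (auto simp: path_component_of_def)
  have "continuous_map E S q" using cov by (simp add: covering_map_def)
  then have qg: "pathin S (q \<circ> g)" using g(1) pathin_compose by blast
  have "e \<in> topspace E" using g by (auto simp: pathin_def continuous_map_def)
  then have "q e \<in> topspace S" using cov by (auto simp: covering_map_def)
  then have "pathin S (\<lambda>_. q e)" by (simp add: pathin_const)
  with qg have "homotopic_with (\<lambda>r. r 1 = r 0) (top_of_set {0..1}) S (q \<circ> g) (\<lambda>_. q e)"
    using S[unfolded simply_connected_space_def, rule_format, of "q \<circ> g" "\<lambda>_. q e"] g e(2) by simp
  from nullhomotopic_lift_closed[OF cov g(1) this] show ?thesis using g by simp
qed

text \<open>A choice of the open cube that contains a point, with a parametrisation. The vertex \<open>anchor Y y\<close>, where this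
parametrisation has its origin, serves as base point of the fibre over \<open>y\<close>; for a cube \<open>s\<close> with \<open>s t = y\<close>,
\<open>anchor_corner\<close> is the corner of \<open>s\<close> that corresponds to this origin in the carrier face of \<open>t\<close>.\<close>

definition carrier_of :: "'a cube_complex \<Rightarrow> 'a \<Rightarrow> nat \<times> ((nat \<Rightarrow> real) \<Rightarrow> 'a) \<times> (nat \<Rightarrow> real)" where
  "carrier_of Y y = (SOME z. fst (snd z) \<in> Y (fst z) \<and> snd (snd z) \<in> open_cube (fst z) \<and> fst (snd z) (snd (snd z)) = y)"

definition anchor :: "'a cube_complex \<Rightarrow> 'a \<Rightarrow> 'a" where
  "anchor Y y = fst (snd (carrier_of Y y)) origin"

definition anchor_face :: "'a cube_complex \<Rightarrow> nat \<Rightarrow> ((nat \<Rightarrow> real) \<Rightarrow> 'a) \<Rightarrow> (nat \<Rightarrow> real) \<Rightarrow>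
    ((nat \<Rightarrow> real) \<Rightarrow> (nat \<Rightarrow> real)) \<Rightarrow> bool" where
  "anchor_face Y n s t f \<longleftrightarrow> (case carrier_of Y (s t) of (k, \<kappa>, u) \<Rightarrow>
     face_map k n f \<and> f u = t \<and> (\<forall>x\<in>cube k. s (f x) = \<kappa> x))"

definition anchor_corner :: "'a cube_complex \<Rightarrow> nat \<Rightarrow> ((nat \<Rightarrow> real) \<Rightarrow> 'a) \<Rightarrow> (nat \<Rightarrow> real) \<Rightarrow> (nat \<Rightarrow> real)" where
  "anchor_corner Y n s t = (SOME f. anchor_face Y n s t f) origin"

lemma carrier_of:
  assumes Y: "is_cube_complex Y" and y: "y \<in> points Y"
  obtains k \<kappa> u where "carrier_of Y y = (k, \<kappa>, u)" "\<kappa> \<in> Y k" "u \<in> open_cube k" "\<kappa> u = y"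
proof -
  obtain n s t where s: "s \<in> Y n" "t \<in> cube n" "y = s t" using y by (rule pointsE)
  obtain k f u where f: "face_map k n f" "u \<in> open_cube k" "f u = t" using carrier_face[OF s(2)] .
  have "compose (cube k) s f \<in> Y k" using cc_face[OF Y s(1) f(1)] .
  moreover have "compose (cube k) s f u = y" using f s open_cube_subset[OF f(2)] by (simp add: compose_def)
  ultimately have "\<exists>z. fst (snd z) \<in> Y (fst z) \<and> snd (snd z) \<in> open_cube (fst z) \<and> fst (snd z) (snd (snd z)) = y"
    using f(2) by (intro exI[of _ "(k, compose (cube k) s f, u)"]) simp
  from someI_ex[OF this] show thesis
    unfolding carrier_of_def[symmetric]
    by (intro that[of "fst (carrier_of Y y)" "fst (snd (carrier_of Y y))" "snd (snd (carrier_of Y y))"]) auto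
qed

lemma anchor_face_ex:
  assumes Y: "is_cube_complex Y" and s: "s \<in> Y n" "t \<in> cube n"
  obtains f where "anchor_face Y n s t f"
proof -
  obtain k \<kappa> u where c: "carrier_of Y (s t) = (k, \<kappa>, u)" "\<kappa> \<in> Y k" "u \<in> open_cube k" "\<kappa> u = s t"
    using carrier_of[OF Y pointsI[of s Y n, OF s]] .
  obtain f where "face_map k n f" "f u = t" "\<And>x. x \<in> cube k \<Longrightarrow> s (f x) = \<kappa> x"
    by (rule open_point_face[OF Y c(2,3) s c(4)]) blast
  then show thesis by (intro that[of f]) (simp add: anchor_face_def c)
qed

lemma anchor_corner_eq:
  assumes Y: "is_cube_complex Y" and s: "s \<in> Y n" "t \<in> cube n" and f: "anchor_face Y n s t f"
  shows "anchor_corner Y n s t = f origin"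
proof -
  obtain k \<kappa> u where c: "carrier_of Y (s t) = (k, \<kappa>, u)" "\<kappa> \<in> Y k" "u \<in> open_cube k" "\<kappa> u = s t"
    using carrier_of[OF Y pointsI[of s Y n, OF s]] .
  define g where "g = (SOME f. anchor_face Y n s t f)"
  have "anchor_face Y n s t g" unfolding g_def by (rule someI[of "anchor_face Y n s t", OF f])
  then have g: "face_map k n g" "g u = t" "\<forall>x\<in>cube k. s (g x) = \<kappa> x" by (simp_all add: anchor_face_def c)
  have f: "face_map k n f" "f u = t" "\<forall>x\<in>cube k. s (f x) = \<kappa> x" using f by (simp_all add: anchor_face_def c)
  have "g x = f x" if "x \<in> open_cube k" for x
    by (rule face_param_unique[OF Y s(1) g(1) f(1) c(3)]) (use f g that in auto)
  then have "g origin = f origin" by (rule face_param_unique_origin[OF g(1) f(1)])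
  then show ?thesis by (simp add: anchor_corner_def g_def)
qed

lemma anchor_corner_props:
  assumes Y: "is_cube_complex Y" and s: "s \<in> Y n" "t \<in> cube n"
  shows "anchor_corner Y n s t \<in> corners n" "s (anchor_corner Y n s t) = anchor Y (s t)"
proof -
  obtain k \<kappa> u where c: "carrier_of Y (s t) = (k, \<kappa>, u)" using prod_cases3 by blast
  obtain f where f: "anchor_face Y n s t f" using anchor_face_ex[OF Y s] .
  then have g: "face_map k n f" "\<forall>x\<in>cube k. s (f x) = \<kappa> x" by (simp_all add: anchor_face_def c)
  show "anchor_corner Y n s t \<in> corners n" "s (anchor_corner Y n s t) = anchor Y (s t)"
    using anchor_corner_eq[OF Y s f] face_map_corner[OF g(1) origin_corner] g(2) by (simp_all add: anchor_def c)
qed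

lemma anchor_corner_face:
  assumes Y: "is_cube_complex Y" and s: "s \<in> Y n" and g: "face_map m n g" and t: "t \<in> cube m"
  shows "anchor_corner Y n s (g t) = g (anchor_corner Y m (compose (cube m) s g) t)"
proof -
  have sg: "compose (cube m) s g \<in> Y m" using cc_face[OF Y s g] .
  obtain f where f: "anchor_face Y m (compose (cube m) s g) t f" using anchor_face_ex[OF Y sg t] .
  obtain k \<kappa> u where c: "carrier_of Y (s (g t)) = (k, \<kappa>, u)" using prod_cases3 by blast
  have c': "carrier_of Y (compose (cube m) s g t) = (k, \<kappa>, u)" using c t by (simp add: compose_def)
  have f': "face_map k m f" "f u = t" "\<forall>x\<in>cube k. compose (cube m) s g (f x) = \<kappa> x"
    using f by (simp_all add: anchor_face_def c')
  have "anchor_face Y n s (g t) (\<lambda>x. g (f x))"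
    using f' face_map_compose[OF f'(1) g] face_map_cube[OF f'(1)]
    by (simp add: anchor_face_def c compose_def)
  then show ?thesis using anchor_corner_eq[OF Y s face_map_cube[OF g t]] anchor_corner_eq[OF Y sg t f] by simp
qed

lemma anchor_corner_corner:
  assumes Y: "is_cube_complex Y" and s: "s \<in> Y n" and t: "t \<in> corners n"
  shows "anchor_corner Y n s t = t"
proof -
  note tc = corners_cube[OF t]
  obtain k \<kappa> u where c: "carrier_of Y (s t) = (k, \<kappa>, u)" "\<kappa> \<in> Y k" "u \<in> open_cube k" "\<kappa> u = s t"
    using carrier_of[OF Y pointsI[of s Y n, OF s tc]] .
  have "u \<in> corners k"
    by (rule vertex_corner[OF Y c(2) open_cube_subset[OF c(3)]]) (simp add: c vertexI[OF Y s t])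
  then have "k = 0" using c(3) corner_01[of u k 0] by (cases k) (auto simp: open_cube_def)
  then have u: "u = origin" using cube_0 open_cube_subset[OF c(3)] by blast
  obtain f where f: "anchor_face Y n s t f" using anchor_face_ex[OF Y s tc] .
  then have "f origin = t" using u by (simp add: anchor_face_def c)
  then show ?thesis using anchor_corner_eq[OF Y s tc f] by simp
qed

context special_cover
begin

lemma Y_connected: "connectedin (cc_topology Y) (points Y)"
  using simply_connected_connected[OF Y_simply] connectedin_topspace[of "cc_topology Y"] by simp

lemma points_subcomplex: "subcomplex Y (points Y)"
  unfolding subcomplex_def using pointsI[of _ Y] by (auto elim!: pointsE) blast

lemma vertices_points: "v \<in> vertices Y \<Longrightarrow> v \<in> points Y"
  by (auto simp: vertices_def intro: pointsI)

lemma words_exist: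
  assumes "u \<in> vertices Y" "v \<in> vertices Y"
  obtains w where "C.is_path u w" "C.end_of u w = v"
proof -
  have "(u, v) \<in> (edges_within Y (points Y))\<^sup>*"
    by (rule edge_connected[OF Y_cc points_subcomplex Y_connected]) (use assms vertices_points in auto)
  then have "\<exists>w. C.is_path u w \<and> C.end_of u w = v"
  proof (induction rule: rtrancl_induct)
    case base
    show ?case by (intro exI[of _ "[]"]) simp
  next
    case (step x y)
    then obtain w d where w: "C.is_path u w" "C.end_of u w = x" and d: "d \<in> Y 1" "x = d origin" "y = d unit_end"
      unfolding edges_within_def by blast
    have "ed x (col d)" "mv x (col d) = y" using d mv_eq[OF d(1)] by (auto simp: ed_def)
    then show ?case using w by (intro exI[of _ "w @ [col d]"]) (simp add: C.is_path_append C.end_of_append)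
  qed
  then show thesis using that by blast
qed

end

text \<open>The points of the covering \<open>E\<close> are pairs of a point of \<open>Y\<close> and a homotopy class of words from \<open>v0\<close> to its
anchor. Cubes of \<open>E\<close> are cubes of \<open>Y\<close> with a compatible choice of classes at all corners.\<close>

locale special_cover_based = special_cover +
  fixes v0 :: 'b
  assumes v0: "v0 \<in> vertices Y"
begin

definition word_class :: "'a set set list \<Rightarrow> 'a set set list set" where
  "word_class w = {w'. C.hom v0 w w'}"

definition extend_class :: "'a set set list set \<Rightarrow> 'a set set \<Rightarrow> 'a set set list set" where
  "extend_class A c = {w'. \<exists>z\<in>A. C.hom v0 (z @ [c]) w'}"

definition fibre :: "'b \<Rightarrow> 'a set set list set set" where
  "fibre v = {word_class z | z. C.is_path v0 z \<and> C.end_of v0 z = v}"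

lemma word_class_eq: "word_class w = word_class w' \<longleftrightarrow> C.hom v0 w w'"
  unfolding word_class_def using C.hom_refl C.hom_sym C.hom_trans by blast

lemma extend_class_word_class: "extend_class (word_class z) c = word_class (z @ [c])"
proof -
  have "C.hom v0 (z' @ [c]) w' \<Longrightarrow> C.hom v0 z z' \<Longrightarrow> C.hom v0 (z @ [c]) w'" for z' w'
    using C.hom_append C.hom_trans by blast
  then show ?thesis unfolding extend_class_def word_class_def using C.hom_refl by blast
qed

definition flat :: "nat \<Rightarrow> ((nat \<Rightarrow> real) \<Rightarrow> 'b) \<Rightarrow> ((nat \<Rightarrow> real) \<Rightarrow> 'a set set list set) \<Rightarrow> bool" where
  "flat n s \<phi> \<longleftrightarrow> (\<forall>w\<in>corners n. \<phi> w \<in> fibre (s w) \<and> (\<forall>i<n. \<phi> (flip w i) = extend_class (\<phi> w) (ccol s i)))"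

lemma flat_unique:
  assumes "flat n s \<phi>" "flat n s \<psi>" "w0 \<in> corners n" "\<phi> w0 = \<psi> w0" "w \<in> corners n"
  shows "\<phi> w = \<psi> w"
  using assms(3,5)
proof (induction rule: corner_induct)
  case (flip w i)
  then show ?case using assms(1,2) unfolding flat_def by metis
qed (rule assms(4))

lemma cube_path_word:
  assumes s: "s \<in> Y n"
  shows "w \<in> corners n \<Longrightarrow> distinct L \<Longrightarrow> set L \<subseteq> {..<n} \<Longrightarrow>
    C.is_path (s w) (map (ccol s) L) \<and>
    C.end_of (s w) (map (ccol s) L) = s (\<lambda>i. if i \<in> set L then 1 - w i else w i)"
proof (induction L arbitrary: w)
  case (Cons i L)
  have i: "i < n" "i \<notin> set L" using Cons.prems by auto
  note f = flip_corner[OF Cons.prems(1) i(1)]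
  have eq: "(\<lambda>l. if l \<in> set L then 1 - flip w i l else flip w i l) = (\<lambda>l. if l \<in> set (i # L) then 1 - w l else w l)"
    using i(2) by auto
  have "distinct L" "set L \<subseteq> {..<n}" using Cons.prems by auto
  note Cons.IH[OF f this, unfolded eq]
  then show ?case
    by (simp only: list.map C.is_path.simps C.end_of.simps cube_ed[OF s Cons.prems(1) i(1)] simp_thms)
qed simp

text \<open>The squares of a cube allow a letter to be moved past any letters of other directions.\<close>

lemma cube_shift_word:
  assumes s: "s \<in> Y n"
  shows "w \<in> corners n \<Longrightarrow> i < n \<Longrightarrow> i \<notin> set L \<Longrightarrow> set L \<subseteq> {..<n} \<Longrightarrow>
    C.hom (s w) (map (ccol s) L @ [ccol s i]) (ccol s i # map (ccol s) L)"
proof (induction L arbitrary: w)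
  case (Cons l L)
  have l: "l < n" "l \<noteq> i" using Cons.prems by auto
  note f = flip_corner[OF Cons.prems(1) l(1)]
  have "C.hom (s w) (ccol s l # map (ccol s) L @ [ccol s i]) (ccol s l # ccol s i # map (ccol s) L)"
  proof (rule C.hom_cons[OF cube_ed(1)[OF s Cons.prems(1) l(1)]])
    have "i \<notin> set L" "set L \<subseteq> {..<n}" using Cons.prems by auto
    from Cons.IH[OF f Cons.prems(2) this]
    show "C.hom (mv (s w) (ccol s l)) (map (ccol s) L @ [ccol s i]) (ccol s i # map (ccol s) L)"
      by (simp only: cube_ed(3)[OF s Cons.prems(1) l(1)])
  qed
  moreover have "C.hom (s w) (ccol s l # ccol s i # map (ccol s) L) (ccol s i # ccol s l # map (ccol s) L)"
    using cube_sq[OF s Cons.prems(1) l(1) Cons.prems(2) l(2)] by (rule C.hom_swap)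
  ultimately show ?case using C.hom_trans by simp
qed (simp add: C.hom_refl)

text \<open>From \<open>w0\<close> the corner \<open>w\<close> is reached by flipping the coordinates in which they differ, in increasing order.
Flipping one more coordinate \<open>i\<close> inserts or deletes the letter of \<open>i\<close> in the middle of this word; shuffling
inside the cube moves it there from the end.\<close>

lemma flat_exists:
  assumes s: "s \<in> Y n" and w0: "w0 \<in> corners n" and x: "x \<in> fibre (s w0)"
  obtains \<phi> where "flat n s \<phi>" "\<phi> w0 = x"
proof -
  obtain z where z: "x = word_class z" "C.is_path v0 z" "C.end_of v0 z = s w0" using x by (auto simp: fibre_def)
  define D where "D w = filter (\<lambda>i. w i \<noteq> w0 i) [0..<n]" for w :: "nat \<Rightarrow> real"
  define \<phi> where "\<phi> w = word_class (z @ map (ccol s) (D w))" for w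
  have D: "distinct (D w)" "set (D w) \<subseteq> {..<n}" for w by (auto simp: D_def)
  have "flat n s \<phi>"
    unfolding flat_def
  proof (intro ballI conjI allI impI)
    fix w assume w: "w \<in> corners n"
    have "(\<lambda>i. if i \<in> set (D w) then 1 - w0 i else w0 i) = w"
    proof
      fix i show "(if i \<in> set (D w) then 1 - w0 i else w0 i) = w i"
      proof (cases "i < n")
        case True
        then show ?thesis using corner_01[OF w, of i] corner_01[OF w0, of i] by (auto simp: D_def)
      next
        case False
        then show ?thesis using w w0 by (auto simp: D_def corners_def)
      qed
    qed
    then show "\<phi> w \<in> fibre (s w)"
      using cube_path_word[OF s w0 D] z unfolding \<phi>_def fibre_def
      by (intro CollectI exI[of _ "z @ map (ccol s) (D w)"]) (simp add: C.is_path_append C.end_of_append)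
    fix i assume i: "i < n"
    \<comment> \<open>Split the word at the place of \<open>i\<close>; the corner \<open>u\<close> is reached by the first part.\<close>
    define L1 L2 where "L1 = filter (\<lambda>i. w i \<noteq> w0 i) [0..<i]" and "L2 = filter (\<lambda>i. w i \<noteq> w0 i) [Suc i..<n]"
    have split: "[0..<n] = [0..<i] @ i # [Suc i..<n]"
      using i by (metis append.assoc append_Cons append_Nil le_add1 less_imp_add_positive upt_add_eq_append upt_conv_Cons zero_le)
    have L1': "filter (\<lambda>l. flip w i l \<noteq> w0 l) [0..<i] = L1"
      unfolding L1_def by (rule filter_cong) auto
    have L2': "filter (\<lambda>l. flip w i l \<noteq> w0 l) [Suc i..<n] = L2"
      unfolding L2_def by (rule filter_cong) auto
    have L: "set L1 \<subseteq> {..<n}" "set L2 \<subseteq> {..<n}" "i \<notin> set L1" "i \<notin> set L2" "distinct L1" "distinct L2"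
      using i by (auto simp: L1_def L2_def)
    define c u where "c = ccol s i" and "u = (\<lambda>l. if l \<in> set L1 then 1 - w0 l else w0 l)"
    have u: "u \<in> corners n" using w0 L by (auto simp: u_def corners_def)
    have p1: "C.is_path v0 (z @ map (ccol s) L1)" "C.end_of v0 (z @ map (ccol s) L1) = s u"
      using cube_path_word[OF s w0 L(5,1)] z by (simp_all add: C.is_path_append C.end_of_append u_def)
    have sh: "C.hom (s u) (map (ccol s) L2 @ [c]) (c # map (ccol s) L2)"
      using cube_shift_word[OF s u i L(4,2)] by (simp add: c_def)
    have h: "C.hom v0 ((z @ map (ccol s) L1) @ (map (ccol s) L2 @ [c])) ((z @ map (ccol s) L1) @ (c # map (ccol s) L2))"
      by (rule C.hom_prepend[OF p1(1)]) (use p1(2) sh in simp)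
    show "\<phi> (flip w i) = extend_class (\<phi> w) (ccol s i)"
    proof (cases "w i = w0 i")
      case True
      then have "flip w i i \<noteq> w0 i" using corner_01[OF w0, of i] by auto
      then have "D w = L1 @ L2" "D (flip w i) = L1 @ i # L2"
        unfolding D_def split using True L1' L2' by (auto simp: L1_def L2_def simp del: fun_upd_apply)
      then show ?thesis using C.hom_sym[OF h] by (simp add: \<phi>_def extend_class_word_class word_class_eq c_def)
    next
      case False
      then have "flip w i i = w0 i" using corner_01[OF w0, of i] corner_01[OF w, of i] by auto
      then have DD: "D w = L1 @ i # L2" "D (flip w i) = L1 @ L2"
        unfolding D_def split using False L1' L2' by (auto simp: L1_def L2_def simp del: fun_upd_apply)
      have e: "ed (s u) c" "mv (s u) c = s (flip u i)" using cube_ed[OF s u i] by (auto simp: c_def)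
      have "C.hom (s (flip u i)) (map (ccol s) L2 @ [c]) (c # map (ccol s) L2)"
        using cube_shift_word[OF s flip_corner[OF u i] i L(4,2)] by (simp add: c_def)
      then have "C.hom (s u) (c # map (ccol s) L2 @ [c]) (c # c # map (ccol s) L2)"
        using e by (intro C.hom_cons) simp_all
      then have "C.hom (s u) (c # map (ccol s) L2 @ [c]) (map (ccol s) L2)"
        using C.hom_cancel[OF e(1)] C.hom_trans by blast
      then have "C.hom v0 ((z @ map (ccol s) L1) @ (c # map (ccol s) L2 @ [c])) ((z @ map (ccol s) L1) @ map (ccol s) L2)"
        by (intro C.hom_prepend[OF p1(1)]) (simp only: p1(2))
      then show ?thesis using C.hom_sym by (simp add: \<phi>_def extend_class_word_class word_class_eq c_def DD)
    qed
  qed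
  moreover have "\<phi> w0 = x" by (simp add: \<phi>_def D_def z)
  ultimately show thesis using that by blast
qed

definition lifted :: "nat \<Rightarrow> ((nat \<Rightarrow> real) \<Rightarrow> 'b) \<Rightarrow> ((nat \<Rightarrow> real) \<Rightarrow> 'a set set list set) \<Rightarrow>
    ((nat \<Rightarrow> real) \<Rightarrow> 'b \<times> 'a set set list set)" where
  "lifted n s \<phi> = restrict (\<lambda>t. (s t, \<phi> (anchor_corner Y n s t))) (cube n)"

definition E :: "('b \<times> 'a set set list set) cube_complex" where
  "E n = {lifted n s \<phi> | s \<phi>. s \<in> Y n \<and> flat n s \<phi>}"

lemma lifted_in_E: "s \<in> Y n \<Longrightarrow> flat n s \<phi> \<Longrightarrow> lifted n s \<phi> \<in> E n"
  unfolding E_def by blast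

lemma fst_lifted:
  assumes "s \<in> Y n" shows "compose (cube n) fst (lifted n s \<phi>) = s"
  using cc_ext[OF Y_cc assms] by (auto simp: compose_def lifted_def extensional_def fun_eq_iff)

text \<open>Restricting a cube to a face identifies directions, hence colours.\<close>

lemma flat_face:
  assumes s: "s \<in> Y n" and \<phi>: "flat n s \<phi>" and g: "face_map m n g"
  shows "flat m (compose (cube m) s g) (\<lambda>w. \<phi> (g w))"
  unfolding flat_def
proof (intro ballI conjI allI impI)
  fix w assume w: "w \<in> corners m"
  have gw: "g w \<in> corners n" using face_map_corner[OF g w] .
  show "\<phi> (g w) \<in> fibre (compose (cube m) s g w)"
    using \<phi> gw corners_cube[OF w] by (simp add: flat_def compose_def)
  fix j assume j: "j < m"
  obtain i where i: "i < n" "\<And>w. w \<in> corners m \<Longrightarrow> g (flip w j) = flip (g w) i"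
    "\<And>w. w \<in> corners m \<Longrightarrow> cedge (compose (cube m) s g) w j = cedge s (g w) i"
    using cedge_face[OF g j] by metis
  have "ccol (compose (cube m) s g) j = ccol s i"
    using col_cedge[OF s gw i(1)] col_cedge[OF cc_face[OF Y_cc s g] w j] i(3)[OF w] by simp
  then show "\<phi> (g (flip w j)) = extend_class (\<phi> (g w)) (ccol (compose (cube m) s g) j)"
    using \<phi> gw i(1) i(2)[OF w] by (simp add: flat_def)
qed

lemma points_E: "(y, x) \<in> points E \<longleftrightarrow> y \<in> points Y \<and> x \<in> fibre (anchor Y y)"
proof
  assume "(y, x) \<in> points E"
  then obtain n e t where e: "e \<in> E n" "t \<in> cube n" "(y, x) = e t" by (rule pointsE)
  then obtain s \<phi> where s: "s \<in> Y n" "flat n s \<phi>" "e = lifted n s \<phi>" unfolding E_def by blast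
  have "y = s t" "x = \<phi> (anchor_corner Y n s t)" using e s by (auto simp: lifted_def)
  then show "y \<in> points Y \<and> x \<in> fibre (anchor Y y)"
    using pointsI[of s Y n, OF s(1) e(2)] s(2) anchor_corner_props[OF Y_cc s(1) e(2)] by (auto simp: flat_def)
next
  assume yx: "y \<in> points Y \<and> x \<in> fibre (anchor Y y)"
  then obtain n s t where s: "s \<in> Y n" "t \<in> cube n" "y = s t" by (meson pointsE)
  note c = anchor_corner_props[OF Y_cc s(1,2)]
  obtain \<phi> where \<phi>: "flat n s \<phi>" "\<phi> (anchor_corner Y n s t) = x"
    using flat_exists[OF s(1) c(1), of x] yx c(2) s(3) by auto
  have "lifted n s \<phi> t = (y, x)" using s \<phi> by (simp add: lifted_def)
  then show "(y, x) \<in> points E" using pointsI[of _ E n, OF lifted_in_E[OF s(1) \<phi>(1)] s(2)] by simp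
qed

lemma E_covering: "cubical_covering E fst Y"
  unfolding cubical_covering_def
proof (intro conjI allI ballI impI)
  show "fst ` points E = points Y"
  proof (intro equalityI subsetI)
    fix y assume "y \<in> fst ` points E" then show "y \<in> points Y" using points_E by auto
  next
    fix y assume y: "y \<in> points Y"
    obtain k \<kappa> u where c: "carrier_of Y y = (k, \<kappa>, u)" "\<kappa> \<in> Y k" using carrier_of[OF Y_cc y] .
    have "anchor Y y \<in> vertices Y" using vertexI[OF Y_cc c(2) origin_corner] by (simp add: anchor_def c)
    then obtain z where z: "C.is_path v0 z" "C.end_of v0 z = anchor Y y" using words_exist[OF v0] by blast
    then have "(y, word_class z) \<in> points E" using y points_E by (auto simp: fibre_def)
    then show "y \<in> fst ` points E" by force
  qed
next
  fix m n f e assume e: "e \<in> E n" and f: "face_map m n f"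
  obtain s \<phi> where s: "s \<in> Y n" "flat n s \<phi>" "e = lifted n s \<phi>" using e unfolding E_def by blast
  have "compose (cube m) e f = lifted m (compose (cube m) s f) (\<lambda>w. \<phi> (f w))"
  proof
    fix t
    show "compose (cube m) e f t = lifted m (compose (cube m) s f) (\<lambda>w. \<phi> (f w)) t"
    proof (cases "t \<in> cube m")
      case True
      then show ?thesis
        using anchor_corner_face[OF Y_cc s(1) f True] face_map_cube[OF f True] by (simp add: s(3) lifted_def compose_eq)
    next
      case False
      then show ?thesis by (simp add: lifted_def compose_def)
    qed
  qed
  then show "compose (cube m) e f \<in> E m"
    using lifted_in_E[OF cc_face[OF Y_cc s(1) f] flat_face[OF s(1,2) f]] by simp
next
  fix n e assume "e \<in> E n"
  then show "compose (cube n) fst e \<in> Y n" unfolding E_def using fst_lifted by auto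
next
  fix n \<sigma> t e assume \<sigma>: "\<sigma> \<in> Y n" and t: "t \<in> cube n" and e: "e \<in> points E" "fst e = \<sigma> t"
  obtain x where ex: "e = (\<sigma> t, x)" using e by (cases e) auto
  note c = anchor_corner_props[OF Y_cc \<sigma> t]
  have "x \<in> fibre (anchor Y (\<sigma> t))" using e points_E ex by auto
  then obtain \<phi> where \<phi>: "flat n \<sigma> \<phi>" "\<phi> (anchor_corner Y n \<sigma> t) = x"
    using flat_exists[OF \<sigma> c(1), of x] c(2) by auto
  show "\<exists>!s. s \<in> E n \<and> s t = e \<and> compose (cube n) fst s = \<sigma>"
  proof (rule ex1I)
    show "lifted n \<sigma> \<phi> \<in> E n \<and> lifted n \<sigma> \<phi> t = e \<and> compose (cube n) fst (lifted n \<sigma> \<phi>) = \<sigma>"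
      using lifted_in_E[OF \<sigma> \<phi>(1)] fst_lifted[OF \<sigma>] \<phi>(2) t by (simp add: lifted_def ex)
    fix s' assume s': "s' \<in> E n \<and> s' t = e \<and> compose (cube n) fst s' = \<sigma>"
    then obtain s \<psi> where s: "s \<in> Y n" "flat n s \<psi>" "s' = lifted n s \<psi>" unfolding E_def by blast
    have ss: "s = \<sigma>" using fst_lifted[OF s(1)] s' s(3) by metis
    have "\<psi> (anchor_corner Y n \<sigma> t) = \<phi> (anchor_corner Y n \<sigma> t)" using s' t \<phi>(2) by (simp add: s(3) ss lifted_def ex)
    then have "\<psi> w = \<phi> w" if "w \<in> corners n" for w
      using flat_unique[OF s(2)[unfolded ss] \<phi>(1) c(1) _ that] by blast
    then show "s' = lifted n \<sigma> \<phi>"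
      using anchor_corner_props(1)[OF Y_cc \<sigma>] by (auto simp: s(3) ss lifted_def fun_eq_iff)
  qed
qed

text \<open>The path with word \<open>z\<close> lifts to a path in \<open>E\<close> that records \<open>z\<close> itself.\<close>

lemma E_word_path:
  "C.is_path v0 z \<Longrightarrow> path_component_of (cc_topology E) (v0, word_class []) (C.end_of v0 z, word_class z)"
proof (induction z rule: rev_induct)
  case Nil
  have "anchor Y v0 = v0"
  proof -
    obtain \<rho> where \<rho>: "\<rho> \<in> Y 0" "v0 = \<rho> origin" using v0 unfolding vertices_def by auto
    show ?thesis
      using anchor_corner_props(2)[OF Y_cc \<rho>(1) origin_cube] anchor_corner_corner[OF Y_cc \<rho>(1) origin_corner] \<rho>(2) by simp
  qed
  moreover have "word_class [] \<in> fibre v0" unfolding fibre_def by (intro CollectI exI[of _ "[]"]) simp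
  ultimately have "(v0, word_class []) \<in> points E" using points_E vertices_points[OF v0] by simp
  then show ?case by (simp add: path_component_of_refl)
next
  case (snoc c z)
  define v where "v = C.end_of v0 z"
  have z: "C.is_path v0 z" "ed v c" using snoc.prems by (auto simp: C.is_path_append v_def)
  define d where "d = edge v c"
  have d: "d \<in> Y 1" "d origin = v" "col d = c" using edge_props[OF z(2)] by (auto simp: d_def)
  have "ccol d 0 = c" using d by (simp add: ccol_edge)
  have "word_class z \<in> fibre (d origin)" unfolding fibre_def
    by (intro CollectI exI[of _ z]) (simp add: z d(2) v_def)
  then obtain \<phi> where \<phi>: "flat 1 d \<phi>" "\<phi> origin = word_class z"
    using flat_exists[OF d(1) origin_corner] by blast
  have fl: "flip origin 0 = unit_end" by simp
  have "\<phi> (flip origin 0) = extend_class (\<phi> origin) (ccol d 0)"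
    using \<phi>(1)[unfolded flat_def, THEN bspec, OF origin_corner, THEN conjunct2, rule_format, of 0]
    by simp
  then have \<phi>1: "\<phi> unit_end = word_class (z @ [c])" unfolding fl \<phi>(2) \<open>ccol d 0 = c\<close> extend_class_word_class .
  have uc: "unit_end \<in> corners 1" by simp
  have "lifted 1 d \<phi> origin = (v, word_class z)" "lifted 1 d \<phi> unit_end = (mv v c, word_class (z @ [c]))"
    using anchor_corner_corner[OF Y_cc d(1) origin_corner] anchor_corner_corner[OF Y_cc d(1) uc] \<phi>(2) \<phi>1 d(2) corners_cube[OF uc]
    by (simp_all add: lifted_def mv_def d_def)
  then have "path_component_of (cc_topology E) (v, word_class z) (mv v c, word_class (z @ [c]))"
    using cube_path[of _ E 1, OF lifted_in_E[OF d(1) \<phi>(1)] origin_cube corners_cube[OF uc]] by simp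
  then show ?case
    using snoc.IH[OF z(1)] path_component_of_trans by (fastforce simp: v_def C.end_of_append)
qed

text \<open>The lift of a closed word joins two points over \<open>v0\<close>, which coincide because \<open>E\<close> is a covering of a simply
connected space.\<close>

lemma closed_word_hom:
  assumes "C.is_path v0 z" "C.end_of v0 z = v0"
  shows "C.hom v0 z []"
proof -
  interpret EE: cubical_cover E fst Y
    using Y_cc E_covering by unfold_locales
  have "(v0, word_class []) = (v0, word_class z)"
    by (rule covering_simply_connected_inj[OF EE.covering Y_simply]) (use E_word_path[OF assms(1)] assms(2) in auto)
  then show ?thesis using word_class_eq C.hom_sym by simp
qed

end

context special_cover
begin

sublocale C: simply_connected_squares ed mv sq
proof
  fix v w assume w: "C.is_path v w" "C.end_of v w = v"
  show "C.hom v w []"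
  proof (cases w)
    case Nil
    then show ?thesis by (simp add: C.hom_refl)
  next
    case (Cons c w')
    then have "v \<in> vertices Y" using w ed_vertex by auto
    then interpret special_cover_based X Y p v by unfold_locales
    show ?thesis using closed_word_hom w by blast
  qed
qed

end

section \<open>Deck transformations\<close>

lemma connected_cube: "connected (cube n)"
proof -
  have "path_connected_space (top_of_set (cube n))"
    unfolding path_connected_space_iff_path_component using cube_path_component by auto
  then have "connected_space (top_of_set (cube n))" by (rule path_connected_imp_connected_space)
  then show ?thesis by (simp add: connected_space_subtopology connectedin_def flip: connectedin_iff_connected)
qed

context special_cover
begin

abbreviation G :: "('b \<Rightarrow> 'b) set" where
  "G \<equiv> deck_group Y p"

lemma deck_points: "g \<in> G \<Longrightarrow> x \<in> points Y \<Longrightarrow> g x \<in> points Y"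
  unfolding deck_group_def by (auto dest!: homeomorphic_imp_continuous_map simp: continuous_map_def)

lemma deck_p: "g \<in> G \<Longrightarrow> x \<in> points Y \<Longrightarrow> p (g x) = p x"
  by (simp add: deck_group_def)

lemma deck_continuous: "g \<in> G \<Longrightarrow> continuous_map (cc_topology Y) (cc_topology Y) g"
  by (simp add: deck_group_def homeomorphic_imp_continuous_map)

lemma deckI:
  assumes "g \<in> extensional (points Y)" "homeomorphic_maps (cc_topology Y) (cc_topology Y) g h"
    "\<And>x. x \<in> points Y \<Longrightarrow> p (g x) = p x"
  shows "g \<in> G"
  using assms homeomorphic_map_maps by (fastforce simp: deck_group_def)

lemma deck_inverse:
  assumes g: "g \<in> G"
  obtains h where "h \<in> G" "\<forall>x\<in>points Y. h (g x) = x" "\<forall>x\<in>points Y. g (h x) = x"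
proof -
  obtain h0 where h0: "homeomorphic_maps (cc_topology Y) (cc_topology Y) g h0"
    using g unfolding deck_group_def homeomorphic_map_maps by blast
  define h where "h = restrict h0 (points Y)"
  have hm: "homeomorphic_maps (cc_topology Y) (cc_topology Y) g h"
    using h0 by (rule homeomorphic_maps_eq) (auto simp: h_def)
  have inv: "h (g x) = x" "g (h x) = x" if "x \<in> points Y" for x
    using hm that by (auto simp: homeomorphic_maps_def)
  have hp: "h x \<in> points Y" if "x \<in> points Y" for x
    using hm that by (auto simp: homeomorphic_maps_def continuous_map_def)
  have "h \<in> G"
  proof (rule deckI)
    show "homeomorphic_maps (cc_topology Y) (cc_topology Y) h g" using hm homeomorphic_maps_sym by blast
    show "p (h x) = p x" if "x \<in> points Y" for x using deck_p[OF g hp[OF that]] inv(2)[OF that] by simp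
  qed (simp add: h_def)
  then show thesis using that inv by blast
qed

lemma deck_compose:
  assumes "g \<in> G" "h \<in> G" shows "compose (points Y) h g \<in> G"
proof -
  have "homeomorphic_map (cc_topology Y) (cc_topology Y) (h \<circ> g)"
    using assms homeomorphic_map_compose by (fastforce simp: deck_group_def)
  then have "homeomorphic_map (cc_topology Y) (cc_topology Y) (compose (points Y) h g)"
    by (rule homeomorphic_map_eq) (simp add: compose_def)
  moreover have "p (compose (points Y) h g x) = p x" if "x \<in> points Y" for x
    using deck_p[OF assms(2) deck_points[OF assms(1) that]] deck_p[OF assms(1) that] that
    by (simp add: compose_eq)
  ultimately show ?thesis unfolding deck_group_def by (simp add: compose_extensional)
qed

lemma deck_id: "restrict id (points Y) \<in> G"
proof (rule deckI)
  show "homeomorphic_maps (cc_topology Y) (cc_topology Y) (restrict id (points Y)) id"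
    by (rule homeomorphic_maps_eq[of _ _ id id]) (auto simp: homeomorphic_maps_def)
qed auto

text \<open>Both \<open>g \<circ> s\<close> and the cube that lifts \<open>p \<circ> s\<close> at \<open>g (s origin)\<close> are continuous lifts of one map on a connected
cube.\<close>

lemma deck_cube:
  assumes g: "g \<in> G" and s: "s \<in> Y n"
  shows "compose (cube n) g s \<in> Y n"
proof -
  note sp = pointsI[of s Y n, OF s]
  have "p (g (s origin)) = compose (cube n) p s origin"
    using deck_p[OF g sp[OF origin_cube]] by (simp add: compose_def)
  then obtain s' where s': "s' \<in> Y n" "s' origin = g (s origin)"
    "\<And>x. x \<in> cube n \<Longrightarrow> p (s' x) = compose (cube n) p s x"
    using lift[OF proj[OF s] origin_cube deck_points[OF g sp[OF origin_cube]]] by blast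
  have "s' t = g (s t)" if t: "t \<in> cube n" for t
  proof (rule covering_lift_unique[OF p_cov connected_cube[of n]])
    show "continuous_map (top_of_set (cube n)) (cc_topology Y) s'"
      by (rule cube_continuous[of s' Y n, OF s'(1)])
    show "continuous_map (top_of_set (cube n)) (cc_topology Y) (\<lambda>t. g (s t))"
      using continuous_map_compose[OF cube_continuous[of s Y n, OF s] deck_continuous[OF g]] by (simp add: o_def)
    show "p (s' k) = p (g (s k))" if "k \<in> cube n" for k
      using s'(3)[OF that] deck_p[OF g sp[OF that]] that by (simp add: compose_def)
  qed (use s' t in auto)
  then have "compose (cube n) g s = s'"
    using cc_ext[OF Y_cc s'(1)] by (auto simp: compose_def extensional_def fun_eq_iff)
  then show ?thesis using s'(1) by simp
qed

lemma deck_edge: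
  assumes g: "g \<in> G" and e: "ed v c"
  shows "ed (g v) c" "mv (g v) c = g (mv v c)" "edge (g v) c = compose (cube 1) g (edge v c)"
proof -
  define d where "d = edge v c"
  have d: "d \<in> Y 1" "d origin = v" "col d = c" using edge_props[OF e] by (auto simp: d_def)
  define d' where "d' = compose (cube 1) g d"
  have d': "d' \<in> Y 1" unfolding d'_def by (rule deck_cube[OF g d(1)])
  have "p ` d' ` cube 1 = p ` d ` cube 1"
    unfolding d'_def image_compose_cube image_image
    using deck_p[OF g] pointsI[of d Y 1, OF d(1)] by (intro image_cong) auto
  then have c: "col d' = c" using d(3) by (simp add: col_def)
  have o: "d' origin = g v" "d' unit_end = g (d unit_end)"
    using d(2) corners_cube[of unit_end 1] by (simp_all add: d'_def compose_def)
  show "ed (g v) c" unfolding ed_def by (intro bexI[OF _ d'] conjI c o(1))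
  show "edge (g v) c = compose (cube 1) g (edge v c)"
    using edge_eq[OF d'] c o by (simp add: d'_def d_def)
  show "mv (g v) c = g (mv v c)" using mv_eq[OF d'] c o by (simp add: mv_def d_def)
qed

lemma deck_word:
  assumes g: "g \<in> G"
  shows "C.is_path v w \<Longrightarrow> C.is_path (g v) w \<and> C.end_of (g v) w = g (C.end_of v w)"
  by (induction w arbitrary: v) (simp_all add: deck_edge[OF g])

lemma deck_vertex: "g \<in> G \<Longrightarrow> v \<in> vertices Y \<Longrightarrow> g v \<in> vertices Y"
proof -
  assume g: "g \<in> G" and "v \<in> vertices Y"
  then obtain \<rho> where \<rho>: "\<rho> \<in> Y 0" "v = \<rho> origin" unfolding vertices_def by auto
  show ?thesis using vertexI[OF Y_cc deck_cube[OF g \<rho>(1)] origin_corner] \<rho>(2) by (simp add: compose_def)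
qed

text \<open>The graph of the deck transformation that takes \<open>x0\<close> to \<open>y0\<close>, generated cube by cube. It is the component of
\<open>(x0, y0)\<close> in the fibre product of the covering with itself.\<close>

inductive matched :: "'b \<Rightarrow> 'b \<Rightarrow> 'b \<Rightarrow> 'b \<Rightarrow> bool" for x0 y0 where
  matched_base: "matched x0 y0 x0 y0"
| matched_cube: "matched x0 y0 (s u) (s' u) \<Longrightarrow> s \<in> Y n \<Longrightarrow> s' \<in> Y n \<Longrightarrow>
    (\<And>t. t \<in> cube n \<Longrightarrow> p (s t) = p (s' t)) \<Longrightarrow> u \<in> cube n \<Longrightarrow> t \<in> cube n \<Longrightarrow> matched x0 y0 (s t) (s' t)"

lemma matched_sym: "matched x0 y0 x y \<Longrightarrow> matched y0 x0 y x"
proof (induction rule: matched.induct)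
  case (matched_cube s u s' n t)
  show ?case by (rule matched.matched_cube[of y0 x0 s' u s n t, OF matched_cube.IH]) (use matched_cube.hyps in auto)
qed (rule matched_base)

context
  fixes x0 y0
  assumes x0: "x0 \<in> points Y" and y0: "y0 \<in> points Y" and p0: "p x0 = p y0"
begin

lemma matched_points: "matched x0 y0 x y \<Longrightarrow> x \<in> points Y \<and> y \<in> points Y \<and> p x = p y"
proof (induction rule: matched.induct)
  case (matched_cube s u s' n t)
  then show ?case using pointsI[of s Y n t] pointsI[of s' Y n t] by simp
qed (simp add: x0 y0 p0)

lemma matched_lift:
  assumes m: "matched x0 y0 (s u) y" and s: "s \<in> Y n" "u \<in> cube n"
  obtains s' where "s' \<in> Y n" "\<And>t. t \<in> cube n \<Longrightarrow> matched x0 y0 (s t) (s' t)"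
proof -
  have "y \<in> points Y" "p y = compose (cube n) p s u" using matched_points[OF m] s by (auto simp: compose_def)
  then obtain s' where s': "s' \<in> Y n" "s' u = y" "\<And>x. x \<in> cube n \<Longrightarrow> p (s' x) = compose (cube n) p s x"
    using lift[OF proj[OF s(1)] s(2)] by blast
  have "matched x0 y0 (s t) (s' t)" if "t \<in> cube n" for t
    by (rule matched_cube[of _ _ s u s' n t]) (use m s s' that in \<open>auto simp: compose_def\<close>)
  then show thesis using that s' by blast
qed

text \<open>The points that are matched form a union of closed cubes, and so do the others.\<close>

lemma matched_total:
  assumes x: "x \<in> points Y" obtains y where "matched x0 y0 x y"
proof -
  define D where "D = {x. \<exists>y. matched x0 y0 x y}"
  have all: "s t' \<in> D" if "s t \<in> D" "s \<in> Y n" "t \<in> cube n" "t' \<in> cube n" for s t t' n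
  proof -
    obtain y where "matched x0 y0 (s t) y" using \<open>s t \<in> D\<close> by (auto simp: D_def)
    then obtain s' where "matched x0 y0 (s t') (s' t')"
      using matched_lift \<open>s \<in> Y n\<close> \<open>t \<in> cube n\<close> \<open>t' \<in> cube n\<close> by blast
    then show ?thesis by (auto simp: D_def)
  qed
  have D: "D \<subseteq> points Y" using matched_points by (auto simp: D_def)
  have sub: "subcomplex Y D'" if "D' \<subseteq> points Y"
    "\<And>s t t' n. s t \<in> D' \<Longrightarrow> s \<in> Y n \<Longrightarrow> t \<in> cube n \<Longrightarrow> t' \<in> cube n \<Longrightarrow> s t' \<in> D'" for D'
    unfolding subcomplex_def
  proof (intro conjI ballI that(1))
    fix x assume x: "x \<in> D'"
    have "x \<in> points Y" using that(1) x by blast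
    then obtain n s t where s: "s \<in> Y n" "t \<in> cube n" "x = s t" by (rule pointsE)
    have "s ` cube n \<subseteq> D'" using that(2)[of s t n] x s by auto
    then show "\<exists>n. \<exists>\<sigma>\<in>Y n. x \<in> \<sigma> ` cube n \<and> \<sigma> ` cube n \<subseteq> D'" using s by blast
  qed
  have "subcomplex Y D" by (rule sub[OF D]) (rule all)
  moreover have "subcomplex Y (points Y - D)"
    by (rule sub) (use all pointsI[of _ Y] in auto)
  ultimately have "closedin (cc_topology Y) D" "closedin (cc_topology Y) (points Y - D)"
    using subcomplex_closed[OF Y_cc] by auto
  moreover have "x0 \<in> D" unfolding D_def using matched_base by blast
  ultimately have "points Y - D = {}"
    using Y_connected x0 unfolding connectedin_closedin by blast
  then show thesis using that x unfolding D_def by blast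
qed

text \<open>Two partners of \<open>x\<close> are joined by a path in the fibre product. Its first component is a loop, which is
null-homotopic in \<open>Y\<close>; its second component lifts the image of this loop, hence is closed.\<close>

lemma matched_functional:
  assumes "matched x0 y0 x y" "matched x0 y0 x y'"
  shows "y = y'"
proof -
  let ?P = "subtopology (prod_topology (cc_topology Y) (cc_topology Y)) {z. p (fst z) = p (snd z)}"
  have path: "path_component_of ?P (x0, y0) (x, y)" if "matched x0 y0 x y" for x y
    using that
  proof (induction rule: matched.induct)
    case matched_base
    show ?case using x0 y0 p0 by (simp add: path_component_of_refl)
  next
    case (matched_cube s u s' n t)
    have "continuous_map (top_of_set (cube n)) ?P (\<lambda>t. (s t, s' t))"
      using cube_continuous[of s Y n] cube_continuous[of s' Y n] matched_cube.hyps
      by (auto simp: continuous_map_in_subtopology intro: continuous_map_pairedI)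
    from path_component_of_continuous_image[OF this cube_path_component[of u n t]]
    show ?case using matched_cube path_component_of_trans by fast
  qed
  have "path_component_of ?P (x, y) (x, y')"
    by (rule path_component_of_trans[OF path_component_of_sym[OF path[OF assms(1)]] path[OF assms(2)]])
  then obtain h where h: "pathin ?P h" "h 0 = (x, y)" "h 1 = (x, y')" by (auto simp: path_component_of_def)
  have hc: "continuous_map (top_of_set {0..1}) (prod_topology (cc_topology Y) (cc_topology Y)) h"
    "\<And>r. r \<in> {0..1} \<Longrightarrow> p (fst (h r)) = p (snd (h r))"
    using h(1) by (auto simp: pathin_def continuous_map_in_subtopology)
  have h1: "pathin (cc_topology Y) (fst \<circ> h)" and h2: "pathin (cc_topology Y) (snd \<circ> h)"
    using continuous_map_compose[OF hc(1) continuous_map_fst] continuous_map_compose[OF hc(1) continuous_map_snd]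
    by (simp_all add: pathin_def)
  have "x \<in> points Y" using matched_points assms by blast
  then have "homotopic_with (\<lambda>r. r 1 = r 0) (top_of_set {0..1::real}) (cc_topology Y) (fst \<circ> h) (\<lambda>_. x)"
    using Y_simply[unfolded simply_connected_space_def, rule_format, of "fst \<circ> h" "\<lambda>_. x"] h h1 by simp
  moreover have p_continuous: "continuous_map (cc_topology Y) (cc_topology X) p"
    using p_cov by (simp add: covering_map_def)
  ultimately have "homotopic_with (\<lambda>r. r 1 = r 0) (top_of_set {0..1::real}) (cc_topology X) (p \<circ> (fst \<circ> h)) (p \<circ> (\<lambda>_. x))"
    by (rule homotopic_with_compose_continuous_map_left) auto
  then have 1: "homotopic_with (\<lambda>r. r 1 = r 0) (top_of_set {0..1::real}) (cc_topology X) (p \<circ> (fst \<circ> h)) (\<lambda>_. p x)"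
    by (simp add: o_def)
  have "homotopic_with (\<lambda>r. r 1 = r 0) (top_of_set {0..1::real}) (cc_topology X) (p \<circ> (snd \<circ> h)) (p \<circ> (fst \<circ> h))"
  proof (rule homotopic_with_equal)
    show "continuous_map (top_of_set {0..1}) (cc_topology X) (p \<circ> (snd \<circ> h))"
      using h2 p_continuous by (auto simp: pathin_def intro: continuous_map_compose)
    show "(p \<circ> (snd \<circ> h)) 1 = (p \<circ> (snd \<circ> h)) 0" using h hc(2)[of 0] hc(2)[of 1] by simp
  qed (use h hc(2) in auto)
  from homotopic_with_trans[OF this 1]
  have "homotopic_with (\<lambda>r. r 1 = r 0) (top_of_set {0..1::real}) (cc_topology X) (p \<circ> (snd \<circ> h)) (\<lambda>_. p x)" .
  from nullhomotopic_lift_closed[OF p_cov h2 this] show ?thesis using h by simp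
qed

end

lemma deck_transitive:
  assumes x0: "x0 \<in> points Y" and y0: "y0 \<in> points Y" and p0: "p x0 = p y0"
  obtains g where "g \<in> G" "g x0 = y0"
proof -
  define f where "f a b = restrict (\<lambda>x. THE y. matched a b x y) (points Y)" for a b
  have f_eq: "f a b x = y" if "a \<in> points Y" "b \<in> points Y" "p a = p b" "matched a b x y" for a b x y
  proof -
    have "(THE y. matched a b x y) = y"
      by (rule the_equality) (use matched_functional[OF that(1-3)] that(4) in auto)
    then show ?thesis using matched_points[OF that] by (simp add: f_def)
  qed
  have cont: "continuous_map (cc_topology Y) (cc_topology Y) (f a b)"
    if ab: "a \<in> points Y" "b \<in> points Y" "p a = p b" for a b
  proof (rule continuous_map_from_cc)
    fix n s assume s: "s \<in> Y n"
    obtain y where y: "matched a b (s origin) y"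
      using matched_total[OF ab pointsI[of s Y n, OF s origin_cube]] .
    obtain s' where s': "s' \<in> Y n" "\<And>t. t \<in> cube n \<Longrightarrow> matched a b (s t) (s' t)"
      using matched_lift[OF ab y s origin_cube] by blast
    show "continuous_map (top_of_set (cube n)) (cc_topology Y) (\<lambda>t. f a b (s t))"
      by (rule continuous_map_eq[OF cube_continuous[of s' Y n, OF s'(1)]]) (use f_eq[OF ab s'(2)] in auto)
  qed
  have inv: "f b a (f a b x) = x" if ab: "a \<in> points Y" "b \<in> points Y" "p a = p b" and x: "x \<in> points Y" for a b x
  proof -
    obtain y where y: "matched a b x y" using matched_total[OF ab x] .
    show ?thesis using f_eq[OF ab y] f_eq[OF ab(2,1) ab(3)[symmetric] matched_sym[OF y]] by simp
  qed
  have "f x0 y0 \<in> G"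
  proof (rule deckI)
    show "homeomorphic_maps (cc_topology Y) (cc_topology Y) (f x0 y0) (f y0 x0)"
      unfolding homeomorphic_maps_def
      using cont[OF x0 y0 p0] cont[OF y0 x0 p0[symmetric]] inv[OF x0 y0 p0] inv[OF y0 x0 p0[symmetric]] by simp
    show "p (f x0 y0 x) = p x" if x: "x \<in> points Y" for x
    proof -
      obtain y where y: "matched x0 y0 x y" using matched_total[OF x0 y0 p0 x] .
      show ?thesis using f_eq[OF x0 y0 p0 y] matched_points[OF x0 y0 p0 y] by simp
    qed
  qed (simp add: f_def)
  moreover have "f x0 y0 x0 = y0" by (rule f_eq[OF x0 y0 p0 matched_base])
  ultimately show thesis using that by blast
qed

end

section \<open>Elevations are locally convex\<close>

lemma sub_cc_iff: "s \<in> sub_cc X A n \<longleftrightarrow> s \<in> X n \<and> s ` cube n \<subseteq> A"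
  by (simp add: sub_cc_def)

context special_cover
begin

definition verts_in :: "'b set \<Rightarrow> 'b set" where
  "verts_in D = vertices Y \<inter> D"

definition edge_in :: "'b set \<Rightarrow> 'b \<Rightarrow> 'a set set \<Rightarrow> bool" where
  "edge_in D v c \<longleftrightarrow> ed v c \<and> edge v c ` cube 1 \<subseteq> D"

lemma edge_image_rev:
  assumes "ed v c" shows "edge (mv v c) c ` cube 1 = edge v c ` cube 1"
proof -
  define d where "d = edge v c"
  have d: "d \<in> Y 1" "d origin = v" "col d = c" using edge_props[OF assms] by (auto simp: d_def)
  have uc: "unit_end \<in> corners 1" by simp
  have "edge (mv v c) c = cedge d unit_end 0"
    using cube_ed(2)[OF d(1) uc, of 0] d by (simp add: ccol_edge mv_def d_def)
  then show ?thesis by (simp only: cedge_image[OF uc] unit_line[OF uc] d_def)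
qed

lemma cube_vertex: "s \<in> Y n \<Longrightarrow> w \<in> corners n \<Longrightarrow> s w \<in> vertices Y"
  by (rule vertexI[OF Y_cc])

text \<open>Corners are compared in the link as sets of edges, so a square may have to be re-parametrised.\<close>

lemma square_swap:
  assumes "\<sigma> \<in> X 2"
  obtains \<tau> where "\<tau> \<in> X 2" "\<tau> ` cube 2 = \<sigma> ` cube 2" "\<tau> origin = \<sigma> origin"
    "corner_edge \<tau> 0 = corner_edge \<sigma> 1" "corner_edge \<tau> 1 = corner_edge \<sigma> 0"
proof -
  define sw where "sw t = t(0 := t 1, 1 := t (0::nat))" for t :: "nat \<Rightarrow> real"
  have sw: "face_map 2 2 sw"
    by (rule face_mapI[of "\<lambda>k. 1 - k"]) (auto simp: sw_def less_2_cases_iff lessThan_2 cube_def inj_on_def)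
  have sw2: "sw (sw t) = t" for t by (auto simp: sw_def)
  have im: "sw ` cube 2 = cube 2"
    using face_map_cube[OF sw] sw2 by (metis image_eqI image_subsetI subsetI subset_antisym)
  define \<tau> where "\<tau> = compose (cube 2) \<sigma> sw"
  have "corner_edge \<tau> 0 = corner_edge \<sigma> 1" "corner_edge \<tau> 1 = corner_edge \<sigma> 0"
  proof -
    have "origin(0 := t 0) \<in> cube 2" "origin(1 := t 0) \<in> cube 2" if "t \<in> cube 1" for t
      using cube_coord[OF that, of 0] by (auto simp: cube_def)
    moreover have "sw (origin(0 := x)) = origin(1 := x)" "sw (origin(1 := x)) = origin(0 := x)" for x
      by (auto simp: sw_def)
    ultimately show "corner_edge \<tau> 0 = corner_edge \<sigma> 1" "corner_edge \<tau> 1 = corner_edge \<sigma> 0"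
      by (auto simp: corner_edge_def \<tau>_def compose_def intro!: ext)
  qed
  moreover have "\<tau> ` cube 2 = \<sigma> ` cube 2" by (simp only: \<tau>_def image_compose_cube im)
  moreover have "\<tau> origin = \<sigma> origin" by (simp add: \<tau>_def compose_def sw_def fun_upd_idem)
  ultimately show thesis using that[of \<tau>] cc_face[OF X_cc assms sw] by (simp add: \<tau>_def)
qed

end

locale elevation = special_cover +
  fixes A :: "'a set" and At :: "'b set"
  assumes A_convex: "locally_convex X A" and At: "At \<in> elevations Y p A"
begin

definition over_A :: "'b set" where "over_A = {y \<in> points Y. p y \<in> A}"

lemma A_sub: "subcomplex X A"
  using A_convex by (simp add: locally_convex_def)

lemma At_component: "At \<in> connected_components_of (subtopology (cc_topology Y) over_A)"
  using At by (simp add: elevations_def over_A_def)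

lemma At_over_A: "At \<subseteq> over_A"
  using connected_components_of_subset[OF At_component] by auto

lemma At_connected: "connectedin (cc_topology Y) At"
  using connectedin_connected_components_of[OF At_component] by (simp add: connectedin_subtopology)

lemma At_nonempty: "At \<noteq> {}"
  using nonempty_connected_components_of[OF At_component] .

lemma At_points: "At \<subseteq> points Y"
  using At_over_A by (auto simp: over_A_def)

lemma At_maximal:
  assumes "connectedin (cc_topology Y) C" "C \<subseteq> over_A" "x \<in> C" "x \<in> At"
  shows "C \<subseteq> At"
proof (rule connected_components_of_maximal[OF At_component])
  show "connectedin (subtopology (cc_topology Y) over_A) C" using assms by (simp add: connectedin_subtopology)
  show "\<not> disjnt At C" using assms by (auto simp: disjnt_def)
qed

text \<open>The image of a cube is connected, so it stays in the component.\<close>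

lemma At_cube:
  assumes s: "s \<in> Y n" "t \<in> cube n" "s t \<in> At" and A: "p ` s ` cube n \<subseteq> A"
  shows "s ` cube n \<subseteq> At"
proof (rule At_maximal[OF _ _ _ s(3)])
  have "connectedin (top_of_set (cube n)) (cube n)"
    using connected_cube[of n] by (simp add: connectedin_subtopology)
  then show "connectedin (cc_topology Y) (s ` cube n)"
    using connectedin_continuous_map_image[OF cube_continuous[of s Y n, OF s(1)]] by blast
  show "s ` cube n \<subseteq> over_A" using A pointsI[of s Y n, OF s(1)] by (auto simp: over_A_def)
qed (use s in auto)

lemma At_carrier:
  assumes "x \<in> At"
  obtains n s t where "s \<in> Y n" "t \<in> cube n" "x = s t" "s ` cube n \<subseteq> At"
proof -
  have x: "x \<in> points Y" "p x \<in> A" using At_over_A assms by (auto simp: over_A_def)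
  obtain n \<sigma> t where \<sigma>: "\<sigma> \<in> X n" "t \<in> cube n" "p x = \<sigma> t" "\<sigma> ` cube n \<subseteq> A"
    using A_sub x(2) unfolding subcomplex_def by (metis imageE)
  obtain s where s: "s \<in> Y n" "s t = x" "\<And>x. x \<in> cube n \<Longrightarrow> p (s x) = \<sigma> x"
    using lift[OF \<sigma>(1,2) x(1) \<sigma>(3)] by blast
  have "p ` s ` cube n \<subseteq> A" using s(3) \<sigma>(4) by auto
  then have "s ` cube n \<subseteq> At" using At_cube[OF s(1) \<sigma>(2)] s(2) assms by blast
  then show thesis using that s \<sigma>(2) by blast
qed

lemma At_subcomplex: "subcomplex Y At"
  unfolding subcomplex_def using At_points by (auto elim!: At_carrier)

lemma deck_At_sub:
  assumes g: "g \<in> G" and x: "x \<in> At" "g x \<in> At"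
  shows "g ` At \<subseteq> At"
proof (rule At_maximal[OF _ _ _ x(2)])
  show "connectedin (cc_topology Y) (g ` At)"
    by (rule connectedin_continuous_map_image[OF deck_continuous[OF g] At_connected])
  show "g ` At \<subseteq> over_A" using At_over_A deck_p[OF g] deck_points[OF g] by (auto simp: over_A_def)
qed (use x in auto)

text \<open>Deck transformations permute the components of the preimage of \<open>A\<close>.\<close>

lemma deck_At:
  assumes g: "g \<in> G" and x: "x \<in> At" "g x \<in> At"
  shows "g ` At = At"
proof -
  obtain h where h: "h \<in> G" "\<forall>x\<in>points Y. h (g x) = x" "\<forall>x\<in>points Y. g (h x) = x"
    using deck_inverse[OF g] .
  have "h ` At \<subseteq> At"
    by (rule deck_At_sub[OF h(1) x(2)]) (use h(2) x At_points in auto)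
  have "At \<subseteq> g ` At"
  proof
    fix y assume y: "y \<in> At"
    have "y = g (h y)" using h(3) y At_points by auto
    moreover have "h y \<in> At" using \<open>h ` At \<subseteq> At\<close> y by blast
    ultimately show "y \<in> g ` At" by (rule image_eqI)
  qed
  then show ?thesis using deck_At_sub[OF g x] by blast
qed

lemma edge_in_V: "edge_in At v c \<Longrightarrow> v \<in> verts_in At"
proof -
  assume K: "edge_in At v c"
  moreover have "edge v c origin \<in> edge v c ` cube 1" by (rule imageI[OF origin_cube])
  ultimately have "edge v c origin \<in> At" unfolding edge_in_def by blast
  then show ?thesis using K edge_props ed_vertex by (auto simp: edge_in_def verts_in_def)
qed

lemma edge_in_link:
  assumes K: "edge_in At v c"
  shows "{proj_edge (edge v c)} \<in> link (sub_cc X A) (p v)"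
proof -
  have e: "edge v c \<in> Y 1" "edge v c origin = v" using K edge_props by (auto simp: edge_in_def)
  have "proj_edge (edge v c) ` cube 1 \<subseteq> A"
    using K At_over_A unfolding edge_in_def proj_edge_def image_compose_cube by (auto simp: over_A_def)
  then have "proj_edge (edge v c) \<in> sub_cc X A 1"
    using proj[OF e(1)] by (simp add: sub_cc_iff proj_edge_def)
  moreover have "proj_edge (edge v c) \<in> extensional (cube 1)" by (simp add: proj_edge_def)
  moreover have "proj_edge (edge v c) origin = p v" using e by (simp add: proj_edge_def compose_def)
  ultimately show ?thesis using link_singleton by metis
qed

text \<open>In the base, the corner of the square is a simplex of the link all of whose vertices belong to \<open>A\<close>. Fullness
yields a square of \<open>A\<close> with the same corner, and non-positive curvature identifies it with the given one.\<close>

lemma edge_in_square: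
  assumes s: "s \<in> Y 2" "s origin = v" "ccol s 0 = c" "ccol s 1 = d" and K: "edge_in At v c" "edge_in At v d"
  shows "s ` cube 2 \<subseteq> At"
proof -
  define \<rho> where "\<rho> = compose (cube 2) p s"
  have \<rho>: "\<rho> \<in> X 2" "\<rho> origin = p v" using proj[OF s(1)] s(2) by (simp_all add: \<rho>_def compose_def)
  have ce: "corner_edge \<rho> 0 = proj_edge (edge v c)" "corner_edge \<rho> 1 = proj_edge (edge v d)"
    using cube_ed(2)[OF s(1) origin_corner] s by (auto simp: \<rho>_def proj_edge_corner)
  define S where "S = corner_edge \<rho> ` {..<2}"
  have v: "v \<in> At" "v \<in> vertices Y" using edge_in_V[OF K(1)] by (auto simp: verts_in_def)
  have pv: "p v \<in> vertices X \<inter> A" using p_vertex[OF v(2)] v(1) At_over_A by (auto simp: over_A_def)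
  have "S \<in> link X (p v)" unfolding link_def S_def using \<rho> by blast
  moreover have "\<forall>a\<in>S. {a} \<in> link (sub_cc X A) (p v)"
    using edge_in_link[OF K(1)] edge_in_link[OF K(2)]
    unfolding S_def lessThan_2 image_insert image_empty ce by blast
  moreover have "full_simplicial_subcomplex (link (sub_cc X A) (p v)) (link X (p v))"
    using A_convex pv by (simp add: locally_convex_def)
  ultimately have "S \<in> link (sub_cc X A) (p v)" unfolding full_simplicial_subcomplex_def by simp
  then obtain n \<sigma> where \<sigma>: "\<sigma> \<in> sub_cc X A n" "corner_edge \<sigma> ` {..<n} = S" "\<sigma> origin = p v"
    unfolding link_def by blast
  have \<sigma>X: "\<sigma> \<in> X n" "\<sigma> ` cube n \<subseteq> A" using \<sigma>(1) by (simp_all add: sub_cc_iff)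
  have "card S = 2" using card_image[OF npc_inj[OF \<rho>(1)]] by (simp add: S_def)
  moreover have "card S = n" using card_image[OF npc_inj[OF \<sigma>X(1)]] \<sigma>(2) by simp
  ultimately have n: "n = 2" by simp
  have inj: "corner_edge \<sigma> 0 \<noteq> corner_edge \<sigma> 1" using npc_inj[OF \<sigma>X(1)] n by (auto simp: lessThan_2)
  have set: "{corner_edge \<sigma> 0, corner_edge \<sigma> 1} = {corner_edge \<rho> 0, corner_edge \<rho> 1}"
    using \<sigma>(2) n by (simp add: S_def lessThan_2)
  have same: "\<tau> = \<rho>" if \<tau>: "\<tau> \<in> X 2" "\<tau> origin = p v" "corner_edge \<tau> 0 = corner_edge \<rho> 0"
      "corner_edge \<tau> 1 = corner_edge \<rho> 1" for \<tau>
    by (rule npc_unique[OF \<tau>(1) \<rho>(1)]) (use \<tau> \<rho>(2) in \<open>auto simp: less_2_cases_iff\<close>)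
  have "\<rho> ` cube 2 \<subseteq> A"
  proof (cases "corner_edge \<sigma> 0 = corner_edge \<rho> 0")
    case True
    then have "corner_edge \<sigma> 1 = corner_edge \<rho> 1" using set inj by (auto simp: doubleton_eq_iff)
    then have "\<sigma> = \<rho>" using same[of \<sigma>] \<sigma>X n \<sigma>(3) True by simp
    then show ?thesis using \<sigma>X n by simp
  next
    case False
    then have *: "corner_edge \<sigma> 0 = corner_edge \<rho> 1" "corner_edge \<sigma> 1 = corner_edge \<rho> 0"
      using set by (auto simp: doubleton_eq_iff)
    obtain \<tau> where \<tau>: "\<tau> \<in> X 2" "\<tau> ` cube 2 = \<sigma> ` cube 2" "\<tau> origin = \<sigma> origin"
      "corner_edge \<tau> 0 = corner_edge \<sigma> 1" "corner_edge \<tau> 1 = corner_edge \<sigma> 0"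
      using square_swap[of \<sigma>] \<sigma>X n by blast
    have "\<tau> = \<rho>" using same[OF \<tau>(1)] \<tau> \<sigma>(3) * by simp
    then show ?thesis using \<sigma>X n \<tau>(2) by simp
  qed
  then show ?thesis
    using At_cube[OF s(1) origin_cube] s(2) v(1) by (simp add: \<rho>_def image_compose_cube)
qed

sublocale part: convex_part ed mv sq "verts_in At" "edge_in At"
proof
  fix v c d
  show "edge_in At v c \<Longrightarrow> ed v c" by (simp add: edge_in_def)
  show "edge_in At v c \<Longrightarrow> edge_in At (mv v c) c" by (simp only: edge_in_def edge_image_rev C.ed_mv simp_thms)
  show "edge_in At v c \<Longrightarrow> v \<in> verts_in At" by (rule edge_in_V)
  show "edge_in At (mv v c) d" if K: "edge_in At v c" "edge_in At v d" and sq: "sq v c d"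
  proof -
    obtain s where s: "s \<in> Y 2" "v = s origin" "c = ccol s 0" "d = ccol s 1" using sq_corner[OF sq] .
    have sub: "s ` cube 2 \<subseteq> At" 
      by (rule edge_in_square[OF s(1) s(2)[symmetric] s(3)[symmetric] s(4)[symmetric] K])
    have f: "flip origin 0 \<in> corners 2" using flip_corner[OF origin_corner, of 0 2] by simp
    have m: "mv v c = s (flip origin 0)" using cube_ed(3)[OF s(1) origin_corner, of 0] s by simp
    have "edge (mv v c) d = cedge s (flip origin 0) 1" using cube_ed(2)[OF s(1) f, of 1] s m by simp
    moreover have "cedge s (flip origin 0) 1 ` cube 1 \<subseteq> At"
      unfolding cedge_def image_compose_cube
      using sub face_map_cube[OF face_map_edge_param[OF f, of 1]] by auto
    ultimately show ?thesis using C.sq_ed_mv[OF sq] by (simp add: edge_in_def)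
  qed
qed

lemma At_words:
  assumes "u \<in> verts_in At" "v \<in> verts_in At"
  shows "\<exists>w. part.path_in u w \<and> C.end_of u w = v"
proof -
  have "(u, v) \<in> (edges_within Y At)\<^sup>*"
    by (rule edge_connected[OF Y_cc At_subcomplex At_connected]) (use assms in \<open>auto simp: verts_in_def\<close>)
  then show ?thesis
  proof (induction rule: rtrancl_induct)
    case base
    show ?case using assms(1) by (intro exI[of _ "[]"]) simp
  next
    case (step x y)
    then obtain w d where w: "part.path_in u w" "C.end_of u w = x"
      and d: "d \<in> Y 1" "x = d origin" "y = d unit_end" "d ` cube 1 \<subseteq> At"
      unfolding edges_within_def by blast
    have k: "edge_in At x (col d)" "mv x (col d) = y"
      using d mv_eq[OF d(1)] edge_eq[OF d(1)] by (auto simp: ed_def edge_in_def)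
    then have "y \<in> verts_in At" using part.K_V part.K_mv by blast
    then show ?case using w k by (intro exI[of _ "w @ [col d]"]) (simp add: part.path_in_append C.end_of_append)
  qed
qed

lemma verts_in_nonempty: "verts_in At \<noteq> {}"
proof -
  obtain x where "x \<in> At" using At_nonempty by blast
  then obtain n s t where s: "s \<in> Y n" "s ` cube n \<subseteq> At" by (rule At_carrier)
  then have "s origin \<in> verts_in At" using cube_vertex[OF s(1) origin_corner] by (auto simp: verts_in_def)
  then show ?thesis by blast
qed

end

context special_cover
begin

lemma adjacent_words: "(u, v) \<in> adjacent Y ^^ k \<longleftrightarrow> (\<exists>w. C.is_path u w \<and> C.end_of u w = v \<and> length w = k)"
proof (induction k arbitrary: v)
  case (Suc k)
  have step: "(x, v) \<in> adjacent Y \<longleftrightarrow> (\<exists>c. ed x c \<and> mv x c = v)" for x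
  proof
    assume "(x, v) \<in> adjacent Y"
    then obtain d where "d \<in> Y 1" "x = d origin" "v = d unit_end" unfolding adjacent_def by auto
    then show "\<exists>c. ed x c \<and> mv x c = v" using mv_eq[of d] by (intro exI[of _ "col d"]) (auto simp: ed_def)
  next
    assume "\<exists>c. ed x c \<and> mv x c = v"
    then obtain c where "ed x c" "mv x c = v" by blast
    then show "(x, v) \<in> adjacent Y"
      using edge_props[of x c] unfolding adjacent_def
      by (intro image_eqI[of _ _ "edge x c"]) (auto simp: mv_def)
  qed
  have "(u, v) \<in> adjacent Y ^^ Suc k \<longleftrightarrow> (\<exists>x. (u, x) \<in> adjacent Y ^^ k \<and> (x, v) \<in> adjacent Y)"
    by auto
  also have "\<dots> \<longleftrightarrow> (\<exists>w c. C.is_path u w \<and> length w = k \<and> ed (C.end_of u w) c \<and> mv (C.end_of u w) c = v)"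
    unfolding Suc.IH step by blast
  also have "\<dots> \<longleftrightarrow> (\<exists>w. C.is_path u w \<and> C.end_of u w = v \<and> length w = Suc k)"
  proof
    assume "\<exists>w c. C.is_path u w \<and> length w = k \<and> ed (C.end_of u w) c \<and> mv (C.end_of u w) c = v"
    then obtain w c where "C.is_path u w" "length w = k" "ed (C.end_of u w) c" "mv (C.end_of u w) c = v" by blast
    then show "\<exists>w. C.is_path u w \<and> C.end_of u w = v \<and> length w = Suc k"
      by (intro exI[of _ "w @ [c]"]) (simp add: C.is_path_append C.end_of_append)
  next
    assume "\<exists>w. C.is_path u w \<and> C.end_of u w = v \<and> length w = Suc k"
    then obtain w' where w': "C.is_path u w'" "C.end_of u w' = v" "length w' = Suc k" by blast
    then obtain w c where "w' = w @ [c]" by (metis length_Suc_conv_rev)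
    then show "\<exists>w c. C.is_path u w \<and> length w = k \<and> ed (C.end_of u w) c \<and> mv (C.end_of u w) c = v"
      using w' by (intro exI[of _ w] exI[of _ c]) (simp add: C.is_path_append C.end_of_append)
  qed
  finally show ?case .
qed auto

lemma edge_dist_le: "C.is_path u w \<Longrightarrow> edge_dist Y u (C.end_of u w) \<le> length w"
  unfolding edge_dist_def by (rule Least_le) (auto simp: adjacent_words)

lemma edge_dist_word:
  assumes "u \<in> vertices Y" "v \<in> vertices Y"
  obtains w where "C.is_path u w" "C.end_of u w = v" "length w = edge_dist Y u v"
proof -
  obtain w0 where "C.is_path u w0" "C.end_of u w0 = v" using words_exist[OF assms] .
  then have "(u, v) \<in> adjacent Y ^^ length w0" by (auto simp: adjacent_words)
  then have "(u, v) \<in> adjacent Y ^^ edge_dist Y u v" unfolding edge_dist_def by (rule LeastI)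
  then have "\<exists>w. C.is_path u w \<and> C.end_of u w = v \<and> length w = edge_dist Y u v" by (simp only: adjacent_words)
  then show thesis by (elim exE conjE) (rule that)
qed

lemma deck_edge_dist:
  assumes g: "g \<in> G" and "u \<in> vertices Y" "v \<in> vertices Y"
  shows "edge_dist Y (g u) (g v) = edge_dist Y u v"
proof -
  have le: "edge_dist Y (g u) (g v) \<le> edge_dist Y u v"
    if g: "g \<in> G" and uv: "u \<in> vertices Y" "v \<in> vertices Y" for g u v
  proof -
    obtain w where w: "C.is_path u w" "C.end_of u w = v" "length w = edge_dist Y u v" using edge_dist_word[OF uv] .
    then show ?thesis using deck_word[OF g w(1)] edge_dist_le[of "g u" w] by simp
  qed
  obtain h where h: "h \<in> G" "\<forall>x\<in>points Y. h (g x) = x" "\<forall>x\<in>points Y. g (h x) = x"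
    using deck_inverse[OF g] .
  have hu: "h (g u) = u" "h (g v) = v" using h(2) assms(2,3) vertices_points by blast+
  have "edge_dist Y u v \<le> edge_dist Y (g u) (g v)"
    using le[OF h(1) deck_vertex[OF g assms(2)] deck_vertex[OF g assms(3)]] unfolding hu .
  then show ?thesis using le[OF assms] by simp
qed

end

section \<open>The projection\<close>

lemma image_inverse: "\<forall>x\<in>P. f (k x) = x \<Longrightarrow> D \<subseteq> P \<Longrightarrow> f ` k ` D = D"
  unfolding image_image by (rule trans[OF image_cong[OF refl] image_ident]) auto

lemma collapse_mapE:
  assumes "collapse_map n m q"
  obtains \<iota> where "inj_on \<iota> {..<m}" "\<And>j. j < m \<Longrightarrow> \<iota> j < n"
    "\<And>t. t \<in> cube n \<Longrightarrow> q t = (\<lambda>j. if j < m then t (\<iota> j) else 0)"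
  using assms unfolding collapse_map_def by (auto simp: image_subset_iff)

lemma collapse_map_section:
  assumes "collapse_map n m q" "u \<in> cube m"
  obtains t where "t \<in> cube n" "q t = u" "u \<in> corners m \<longrightarrow> t \<in> corners n"
proof -
  obtain \<iota> where i: "inj_on \<iota> {..<m}" "\<And>j. j < m \<Longrightarrow> \<iota> j < n"
    "\<And>t. t \<in> cube n \<Longrightarrow> q t = (\<lambda>j. if j < m then t (\<iota> j) else 0)"
    using assms(1) by (rule collapse_mapE) blast
  define t where "t l = (if l \<in> \<iota> ` {..<m} then u (inv_into {..<m} \<iota> l) else 0)" for l
  have out: "l \<notin> \<iota> ` {..<m}" if "l \<ge> n" for l
    using i(2) that by (metis imageE lessThan_iff linorder_not_less)
  have t: "t \<in> cube n"
    using out cube_coord[OF assms(2)] by (simp add: t_def cube_def)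
  have "q t = u"
    using assms(2) i(1) unfolding i(3)[OF t] by (auto simp: t_def cube_def inv_into_f_f)
  moreover have "t \<in> corners n" if "u \<in> corners m"
    using out corner_01[OF that] by (simp add: t_def corners_def)
  ultimately show thesis using that t by blast
qed

lemma collapse_map_cube:
  assumes "collapse_map n m q" "t \<in> cube n"
  shows "q t \<in> cube m"
proof -
  obtain \<iota> where "q t = (\<lambda>j. if j < m then t (\<iota> j) else 0)"
    using collapse_mapE[OF assms(1)] assms(2) by metis
  then show ?thesis using cube_coord[OF assms(2)] by (auto simp: cube_def)
qed

locale projected_elevation = special_cover X Y p +
  EA: elevation X Y p A At + EB: elevation X Y p B Bt
  for X :: "'a cube_complex" and Y :: "'b cube_complex" and p A At B Bt +
  fixes pr :: "'b \<Rightarrow> 'b"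
  assumes pr: "is_projection Y At pr"
begin

sublocale CP: convex_pair ed mv sq "verts_in At" "edge_in At" "verts_in Bt" "edge_in Bt"
  by unfold_locales (use EA.At_words EB.At_words in blast)+

lemma pr_vertex: "v \<in> vertices Y \<Longrightarrow> pr v \<in> verts_in At"
  using pr by (simp add: is_projection_def verts_in_def)

lemma pr_closest: "v \<in> vertices Y \<Longrightarrow> a \<in> verts_in At \<Longrightarrow> a \<noteq> pr v \<Longrightarrow> edge_dist Y v (pr v) < edge_dist Y v a"
  using pr by (simp add: is_projection_def verts_in_def)

lemma pr_cube:
  assumes "s \<in> Y n"
  obtains m \<tau> q where "\<tau> \<in> Y m" "\<tau> ` cube m \<subseteq> At" "collapse_map n m q" "\<forall>t\<in>cube n. pr (s t) = \<tau> (q t)"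
proof -
  have "combinatorial_map Y (sub_cc Y At) pr" using pr by (simp add: is_projection_def)
  from this[unfolded combinatorial_map_def, rule_format, OF assms]
  obtain m \<tau> q where "\<tau> \<in> sub_cc Y At m" "collapse_map n m q" "\<forall>t\<in>cube n. pr (s t) = \<tau> (q t)"
    by (elim exE bexE conjE)
  then show thesis using that[of \<tau> m q] by (simp add: sub_cc_iff)
qed

text \<open>By definition \<open>pr b\<close> is a vertex of \<open>At\<close> nearest to \<open>b\<close>.\<close>

lemma bridge_word:
  obtains w0 where "\<And>b. b \<in> verts_in Bt \<Longrightarrow> C.is_path (pr b) w0 \<and> C.end_of (pr b) w0 \<in> verts_in Bt"
proof -
  obtain a b where ab: "a \<in> verts_in At" "b \<in> verts_in Bt" using EA.verts_in_nonempty EB.verts_in_nonempty by blast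
  then have "a \<in> vertices Y" "b \<in> vertices Y" by (auto simp: verts_in_def)
  then obtain w where "C.is_path a w" "C.end_of a w = b" by (rule words_exist)
  then have "CP.bridge a w" using ab by (simp add: CP.bridge_def)
  then obtain z where z: "CP.bridge (fst z) (snd z)"
    "\<And>z'. CP.bridge (fst z') (snd z') \<Longrightarrow> length (snd z) \<le> length (snd z')"
    using ex_has_least_nat[of "\<lambda>z. CP.bridge (fst z) (snd z)" "(a, w)" "\<lambda>z. length (snd z)"] by auto
  define w0 where "w0 = snd z"
  have w0: "CP.bridge (fst z) w0" "\<And>a w. CP.bridge a w \<Longrightarrow> length w0 \<le> length w"
    using z(1) z(2)[of "(_, _)"] by (auto simp: w0_def)
  have "C.is_path (pr b) w0 \<and> C.end_of (pr b) w0 \<in> verts_in Bt" if b: "b \<in> verts_in Bt" for b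
  proof -
    have bv: "b \<in> vertices Y" using b by (simp add: verts_in_def)
    have pv: "pr b \<in> verts_in At" "pr b \<in> vertices Y" using pr_vertex[OF bv] by (auto simp: verts_in_def)
    obtain r where r: "C.is_path b r" "C.end_of b r = pr b" "length r = edge_dist Y b (pr b)"
      using edge_dist_word[OF bv pv(2)] .
    have "CP.bridge (pr b) w0"
    proof (rule CP.shortest_bridge_everywhere[OF w0 b pv(1), where g = "rev r"])
      show "C.is_path (pr b) (rev r)" "C.end_of (pr b) (rev r) = b" using C.is_path_rev[OF r(1)] r(2) by auto
      fix a w assume a: "a \<in> verts_in At" "C.is_path a w" "C.end_of a w = b"
      have "edge_dist Y b a \<le> length w"
        using C.is_path_rev[OF a(2)] a(3) edge_dist_le[of b "rev w"] by simp
      moreover have "edge_dist Y b (pr b) \<le> edge_dist Y b a"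
        using pr_closest[OF bv a(1)] by (cases "a = pr b") auto
      ultimately show "length (rev r) \<le> length w" using r(3) by simp
    qed
    then show ?thesis by (simp add: CP.bridge_def)
  qed
  then show thesis using that by blast
qed

text \<open>\<open>w0\<close> leads from \<open>pr b\<close> to a vertex of \<open>Bt\<close> and from \<open>g (pr b)\<close> to the image of that vertex, which is again in
\<open>Bt\<close>.\<close>

lemma deck_stabilizes:
  assumes g: "g \<in> G" and b: "b \<in> verts_in Bt" "b' \<in> verts_in Bt" and eq: "g (pr b) = pr b'"
  shows "g ` At = At \<and> g ` Bt = Bt"
proof -
  obtain w0 where w0: "\<And>b. b \<in> verts_in Bt \<Longrightarrow> C.is_path (pr b) w0 \<and> C.end_of (pr b) w0 \<in> verts_in Bt"
    using bridge_word by blast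
  have v: "pr b \<in> At" "pr b' \<in> At" using pr_vertex b by (auto simp: verts_in_def)
  define y where "y = C.end_of (pr b) w0"
  have "g y = C.end_of (pr b') w0" using deck_word[OF g conjunct1[OF w0[OF b(1)]]] eq by (simp add: y_def)
  then have "y \<in> Bt" "g y \<in> Bt" using w0[OF b(1)] w0[OF b(2)] by (auto simp: y_def verts_in_def)
  then show ?thesis using EB.deck_At[OF g] EA.deck_At[OF g v(1)] v(2) eq by simp
qed

abbreviation Ct :: "'b set" where "Ct \<equiv> pr ` Bt"

lemma Ct_At: "Ct \<subseteq> At"
proof clarify
  fix z assume "z \<in> Bt"
  then obtain n s t where s: "s \<in> Y n" "t \<in> cube n" "z = s t" by (rule EB.At_carrier)
  obtain m \<tau> q where \<tau>: "\<tau> ` cube m \<subseteq> At" "collapse_map n m q" "\<forall>t\<in>cube n. pr (s t) = \<tau> (q t)"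
    using pr_cube[OF s(1)] .
  then show "pr z \<in> At" using collapse_map_cube[OF \<tau>(2) s(2)] s by auto
qed

text \<open>Collapse maps have sections that preserve corners, so each point of \<open>Ct\<close> lies in a cube all of whose corners
are projections of vertices of \<open>Bt\<close>.\<close>

lemma Ct_carrier:
  assumes "x \<in> Ct"
  obtains k \<kappa> a where "\<kappa> \<in> Y k" "a \<in> open_cube k" "\<kappa> a = x"
    "\<forall>w\<in>corners k. \<exists>b\<in>verts_in Bt. \<kappa> w = pr b"
proof -
  obtain z where z: "z \<in> Bt" "x = pr z" using assms by blast
  obtain n s t where s: "s \<in> Y n" "t \<in> cube n" "z = s t" "s ` cube n \<subseteq> Bt" using z(1) by (rule EB.At_carrier)
  obtain m \<tau> q where \<tau>: "\<tau> \<in> Y m" "collapse_map n m q" "\<forall>t\<in>cube n. pr (s t) = \<tau> (q t)"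
    using pr_cube[OF s(1)] .
  obtain k f a where f: "face_map k m f" "a \<in> open_cube k" "f a = q t"
    using carrier_face[OF collapse_map_cube[OF \<tau>(2) s(2)]] .
  have "\<exists>b\<in>verts_in Bt. compose (cube k) \<tau> f w = pr b" if w: "w \<in> corners k" for w
  proof -
    have fw: "f w \<in> corners m" using face_map_corner[OF f(1) w] .
    obtain t' where t': "t' \<in> cube n" "q t' = f w" "f w \<in> corners m \<longrightarrow> t' \<in> corners n"
      using collapse_map_section[OF \<tau>(2) corners_cube[OF fw]] .
    have "s t' \<in> verts_in Bt" using cube_vertex[OF s(1) t'(3)[rule_format, OF fw]] s(4) t'(1) by (auto simp: verts_in_def)
    moreover have "compose (cube k) \<tau> f w = pr (s t')" using \<tau>(3) t' corners_cube[OF w] by (simp add: compose_def)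
    ultimately show ?thesis by blast
  qed
  moreover have "compose (cube k) \<tau> f a = x"
    using f z s \<tau>(3) open_cube_subset[OF f(2)] by (simp add: compose_def)
  ultimately show thesis using that[OF cc_face[OF Y_cc \<tau>(1) f(1)] f(2)] by blast
qed

text \<open>The cubes that carry \<open>x\<close> and \<open>g x\<close> have the same image in the base up to a symmetry, so \<open>g\<close> takes one to the
other, and in particular corners to corners.\<close>

lemma deck_Ct_point:
  assumes g: "g \<in> G" and x: "x \<in> Ct" "g x \<in> Ct"
  shows "g ` At = At \<and> g ` Bt = Bt"
proof -
  obtain k \<kappa> a where k: "\<kappa> \<in> Y k" "a \<in> open_cube k" "\<kappa> a = x"
    "\<forall>w\<in>corners k. \<exists>b\<in>verts_in Bt. \<kappa> w = pr b" using Ct_carrier[OF x(1)] .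
  obtain l \<mu> a' where l: "\<mu> \<in> Y l" "a' \<in> open_cube l" "\<mu> a' = g x"
    "\<forall>w\<in>corners l. \<exists>b\<in>verts_in Bt. \<mu> w = pr b" using Ct_carrier[OF x(2)] .
  have ac: "a \<in> cube k" "a' \<in> cube l" using k(2) l(2) open_cube_subset by auto
  have xp: "x \<in> points Y" using pointsI[of \<kappa> Y k, OF k(1) ac(1)] k(3) by simp
  have "compose (cube k) p \<kappa> a = compose (cube l) p \<mu> a'"
    using ac k(3) l(3) deck_p[OF g xp] by (simp add: compose_def)
  from cc_open[OF X_cc proj[OF k(1)] proj[OF l(1)] k(2) l(2) this]
  obtain h where h: "k = l" "face_map l l h" "compose (cube l) p \<mu> = compose (cube l) (compose (cube k) p \<kappa>) h" .
  have hc: "h t \<in> cube l" if "t \<in> cube l" for t using face_map_cube[OF h(2) that] .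
  have p_eq: "p (\<mu> t) = p (\<kappa> (h t))" if "t \<in> cube l" for t
    using fun_cong[OF h(3), of t] that hc h(1) by (simp add: compose_def)
  have "h a' \<in> open_cube k" using face_map_open[OF h(2) l(2)] h(1) by simp
  moreover have "compose (cube k) p \<kappa> (h a') = compose (cube k) p \<kappa> a"
    using p_eq[OF ac(2)] ac hc h(1) k(3) l(3) deck_p[OF g xp] by (simp add: compose_def)
  ultimately have ha: "h a' = a" using cc_inj[OF X_cc proj[OF k(1)]] k(2) by (auto dest: inj_onD)
  define \<nu> where "\<nu> = compose (cube l) g (compose (cube l) \<kappa> h)"
  have "compose (cube l) \<kappa> h \<in> Y l" using cc_face[OF Y_cc k(1)] h(1,2) by simp
  then have \<nu>: "\<nu> \<in> Y l" unfolding \<nu>_def by (rule deck_cube[OF g])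
  have "\<nu> = \<mu>"
  proof (rule unique[OF \<nu> l(1) ac(2)])
    show "\<nu> a' = \<mu> a'" using ac ha k(3) l(3) by (simp add: \<nu>_def compose_def)
    show "p (\<nu> t) = p (\<mu> t)" if t: "t \<in> cube l" for t
      using p_eq[OF t] t deck_p[OF g, of "\<kappa> (h t)"] pointsI[of \<kappa> Y k "h t", OF k(1)] hc[OF t] h(1)
      by (simp add: \<nu>_def compose_def)
  qed
  then have "\<mu> origin = g (\<kappa> (h origin))" by (auto simp: \<nu>_def compose_def)
  moreover have "h origin \<in> corners k" using face_map_corner[OF h(2) origin_corner] h(1) by simp
  then obtain b where b: "b \<in> verts_in Bt" "\<kappa> (h origin) = pr b" using k(4) by blast
  moreover obtain b' where b': "b' \<in> verts_in Bt" "\<mu> origin = pr b'" using bspec[OF l(4) origin_corner] by blast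
  ultimately show ?thesis using deck_stabilizes[OF g b(1) b'(1)] by simp
qed

text \<open>Deck transformations preserve distances, and the nearest vertex is unique.\<close>

lemma deck_pr_vertex:
  assumes g: "g \<in> G" "g ` At = At" and b: "b \<in> vertices Y"
  shows "g (pr b) = pr (g b)"
proof (rule ccontr)
  assume ne: "g (pr b) \<noteq> pr (g b)"
  obtain h where h: "h \<in> G" "\<forall>x\<in>points Y. h (g x) = x" "\<forall>x\<in>points Y. g (h x) = x"
    using deck_inverse[OF g(1)] .
  have v: "pr b \<in> verts_in At" "pr b \<in> vertices Y" "g b \<in> vertices Y" using pr_vertex[OF b] deck_vertex[OF g(1) b] by (auto simp: verts_in_def)
  define u where "u = h (pr (g b))"
  have pu: "pr (g b) \<in> verts_in At" "pr (g b) \<in> vertices Y" "pr (g b) \<in> points Y"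
    using pr_vertex[OF v(3)] vertices_points by (auto simp: verts_in_def)
  have gu: "g u = pr (g b)" using h(3) pu by (simp add: u_def)
  have uv: "u \<in> vertices Y" unfolding u_def by (rule deck_vertex[OF h(1) pu(2)])
  have "u \<in> At"
  proof -
    have "pr (g b) \<in> g ` At" using pu g(2) by (simp add: verts_in_def)
    then obtain a where "a \<in> At" "pr (g b) = g a" by blast
    then show ?thesis using h(2) EA.At_points by (auto simp: u_def)
  qed
  then have uA: "u \<in> verts_in At" using uv by (simp add: verts_in_def)
  have "g (pr b) \<in> verts_in At" using deck_vertex[OF g(1) v(2)] v(1) g(2) by (auto simp: verts_in_def)
  then have "edge_dist Y (g b) (g u) < edge_dist Y (g b) (g (pr b))"
    using pr_closest[OF v(3)] ne gu by simp
  then have "edge_dist Y b u < edge_dist Y b (pr b)"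
    using deck_edge_dist[OF g(1)] b uv v by simp
  moreover have "u \<noteq> pr b" using ne gu by auto
  ultimately show False using pr_closest[OF b uA] by simp
qed

text \<open>A loop would be a reduced word of length one with the endpoints of the empty word.\<close>

lemma no_loop: "ed v c \<Longrightarrow> mv v c \<noteq> v"
proof
  assume "ed v c" "mv v c = v"
  then have "C.eqv v [c] []" by (intro C.reduced_unique) auto
  then show False using C.eqv_initial[of v "[c]" "[]" c] by simp
qed

text \<open>A collapsed cube is determined by the images of the corners. Since there are no loops, a direction is
collapsed exactly if it does not move the origin; so both maps keep the same directions. Since edges are
determined by their endpoints, the two cubes have the same edges at the origin, in an order changed by \<open>\<rho>\<close>,
and by non-positive curvature they are equal after re-parametrisation by \<open>h\<close>.\<close>

lemma collapsed_cubes_agree: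
  assumes th: "\<theta> \<in> Y m" and ta: "\<tau> \<in> Y l" and q: "collapse_map n m q" and r: "collapse_map n l r"
    and corners: "\<And>w. w \<in> corners n \<Longrightarrow> \<theta> (q w) = \<tau> (r w)" and t: "t \<in> cube n"
  shows "\<theta> (q t) = \<tau> (r t)"
proof -
  obtain \<iota> where i: "inj_on \<iota> {..<m}" "\<And>j. j < m \<Longrightarrow> \<iota> j < n"
    "\<And>t. t \<in> cube n \<Longrightarrow> q t = (\<lambda>j. if j < m then t (\<iota> j) else 0)"
    using q by (rule collapse_mapE) blast
  obtain \<kappa> where k: "inj_on \<kappa> {..<l}" "\<And>j. j < l \<Longrightarrow> \<kappa> j < n"
    "\<And>t. t \<in> cube n \<Longrightarrow> r t = (\<lambda>j. if j < l then t (\<kappa> j) else 0)"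
    using r by (rule collapse_mapE) blast
  have qo: "q origin = origin" "r origin = origin" using i(3) k(3) by auto
  have o: "\<theta> origin = \<tau> origin" using corners[OF origin_corner] qo by simp
  have e: "origin(x := 1) \<in> corners n" "origin(x := 1) \<in> cube n" if "x < n" for x
    using that by (auto simp: corners_def cube_def)
  have fe: "flip origin j = origin(j := 1)" for j by simp
  have qe: "q (origin(\<iota> j := 1)) = flip origin j" if "j < m" for j
    using i(3)[OF e(2)[OF i(2)[OF that]]] that i(1) by (auto simp: fun_eq_iff dest: inj_onD)
  have re: "r (origin(\<kappa> j := 1)) = flip origin j" if "j < l" for j
    using k(3)[OF e(2)[OF k(2)[OF that]]] that k(1) by (auto simp: fun_eq_iff dest: inj_onD)
  have qn: "q (origin(x := 1)) = origin" if "x < n" "x \<notin> \<iota> ` {..<m}" for x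
    using i(3)[OF e(2)[OF that(1)]] that by (auto simp: fun_eq_iff)
  have rn: "r (origin(x := 1)) = origin" if "x < n" "x \<notin> \<kappa> ` {..<l}" for x
    using k(3)[OF e(2)[OF that(1)]] that by (auto simp: fun_eq_iff)
  have moved: "\<sigma> (flip origin j) \<noteq> \<sigma> origin" if "\<sigma> \<in> Y n'" "j < n'" for \<sigma> n' j
    using cube_ed[OF that(1) origin_corner that(2)] no_loop by metis
  have im: "\<iota> ` {..<m} = \<kappa> ` {..<l}"
  proof (intro equalityI subsetI)
    fix x assume x: "x \<in> \<iota> ` {..<m}"
    then obtain j where j: "j < m" "x = \<iota> j" by blast
    show "x \<in> \<kappa> ` {..<l}"
    proof (rule ccontr)
      assume "x \<notin> \<kappa> ` {..<l}"
      then have "r (origin(x := 1)) = origin" using rn i(2) j by blast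
      then have "\<theta> (flip origin j) = \<theta> origin" using corners[OF e(1)[OF i(2)[OF j(1)]]] qe[OF j(1)] j(2) o by simp
      then show False using moved[OF th j(1)] by blast
    qed
  next
    fix x assume x: "x \<in> \<kappa> ` {..<l}"
    then obtain j where j: "j < l" "x = \<kappa> j" by blast
    show "x \<in> \<iota> ` {..<m}"
    proof (rule ccontr)
      assume "x \<notin> \<iota> ` {..<m}"
      then have "q (origin(x := 1)) = origin" using qn k(2) j by blast
      then have "\<tau> (flip origin j) = \<tau> origin" using corners[OF e(1)[OF k(2)[OF j(1)]]] re[OF j(1)] j(2) o by simp
      then show False using moved[OF ta j(1)] by blast
    qed
  qed
  have ml: "l = m" using card_image[OF i(1)] card_image[OF k(1)] im by simp
  define \<rho> where "\<rho> j = inv_into {..<m} \<kappa> (\<iota> j)" for j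
  have \<rho>: "\<rho> j < m" "\<kappa> (\<rho> j) = \<iota> j" if "j < m" for j
  proof -
    have "\<iota> j \<in> \<kappa> ` {..<m}" using im ml that by auto
    then show "\<rho> j < m" "\<kappa> (\<rho> j) = \<iota> j"
      using inv_into_into[of "\<iota> j" \<kappa> "{..<m}"] f_inv_into_f[of "\<iota> j" \<kappa> "{..<m}"] by (auto simp: \<rho>_def)
  qed
  have \<rho>_inj: "inj_on \<rho> {..<m}"
  proof (rule inj_onI)
    fix x y assume "x \<in> {..<m}" "y \<in> {..<m}" "\<rho> x = \<rho> y"
    then have "\<iota> x = \<iota> y" using \<rho>(2)[of x] \<rho>(2)[of y] by auto
    then show "x = y" using i(1) \<open>x \<in> {..<m}\<close> \<open>y \<in> {..<m}\<close> by (auto dest: inj_onD)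
  qed
  have \<rho>_im: "\<rho> ` {..<m} = {..<m}" using \<rho>(1) \<rho>_inj by (intro endo_inj_surj) auto
  define h where "h x j = (if j < m then x (inv_into {..<m} \<rho> j) else 0)" for x :: "nat \<Rightarrow> real" and j
  have h\<rho>: "h x (\<rho> j) = x j" if "j < m" for x j
    using that \<rho>(1)[OF that] \<rho>_inj by (simp add: h_def inv_into_f_f)
  have h: "face_map m m h"
    by (rule face_mapI[of \<rho>]) (use \<rho>_inj \<rho>_im \<rho>(1) h\<rho> in \<open>auto simp: h_def\<close>)
  have hq: "h (q t) = r t" if t: "t \<in> cube n" for t
  proof
    fix x
    show "h (q t) x = r t x"
    proof (cases "x < m")
      case True
      then obtain j where j: "j < m" "x = \<rho> j" using \<rho>_im by (metis imageE lessThan_iff)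
      then show ?thesis using h\<rho>[OF j(1)] i(3)[OF t] k(3)[OF t] \<rho>[OF j(1)] ml by simp
    next
      case False
      then show ?thesis using k(3)[OF t] ml by (simp add: h_def)
    qed
  qed
  have ho: "h origin = origin" using hq[OF origin_cube] qo by simp
  define \<nu> where "\<nu> = compose (cube m) \<tau> h"
  have \<nu>: "\<nu> \<in> Y m" unfolding \<nu>_def by (rule cc_face[OF Y_cc _ h]) (use ta ml in simp)
  have \<nu>o: "\<nu> origin = \<theta> origin" using o ho by (simp add: \<nu>_def compose_def)
  have ce: "cedge \<nu> origin j = cedge \<theta> origin j" if j: "j < m" for j
  proof (rule edge_det)
    show "cedge \<nu> origin j \<in> Y 1" "cedge \<theta> origin j \<in> Y 1"
      using cedge_in[OF Y_cc \<nu> origin_corner j] cedge_in[OF Y_cc th origin_corner j] by auto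
    show "cedge \<nu> origin j origin = cedge \<theta> origin j origin" using \<nu>o by simp
    have fc: "flip origin j \<in> cube m" using corners_cube[OF flip_corner[OF origin_corner j]] .
    have "\<nu> (flip origin j) = \<tau> (h (q (origin(\<iota> j := 1))))"
      using qe[OF j] fc by (simp only: \<nu>_def compose_eq)
    also have "\<dots> = \<theta> (flip origin j)"
      using hq[OF e(2)[OF i(2)[OF j]]] corners[OF e(1)[OF i(2)[OF j]]] qe[OF j] by simp
    finally have "mv (\<nu> origin) (ccol \<nu> j) = mv (\<nu> origin) (ccol \<theta> j)"
      using cube_ed(3)[OF \<nu> origin_corner j] cube_ed(3)[OF th origin_corner j] \<nu>o by simp
    moreover have "ed (\<nu> origin) (ccol \<nu> j)" "ed (\<nu> origin) (ccol \<theta> j)"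
      using cube_ed(1)[OF \<nu> origin_corner j] cube_ed(1)[OF th origin_corner j] \<nu>o by simp_all
    ultimately have "ccol \<nu> j = ccol \<theta> j" using C.edge_unique by blast
    then show "col (cedge \<nu> origin j) = col (cedge \<theta> origin j)" by (simp add: ccol_def)
  qed
  have "compose (cube m) p \<nu> = compose (cube m) p \<theta>"
    by (rule npc_unique[OF proj[OF \<nu>] proj[OF th]])
       (use \<nu>o ce in \<open>simp_all add: compose_eq proj_edge_corner\<close>)
  then have "p (\<nu> x) = p (\<theta> x)" if "x \<in> cube m" for x
    using that by (metis compose_eq)
  then have "\<nu> = \<theta>" using unique[OF \<nu> th origin_cube \<nu>o] by blast
  moreover have "\<nu> (q t) = \<tau> (r t)"
    using hq[OF t] collapse_map_cube[OF q t] by (simp add: \<nu>_def compose_eq)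
  ultimately show ?thesis by simp
qed

text \<open>On vertices \<open>g\<close> commutes with \<open>pr\<close>, and \<open>pr\<close> on a cube is determined by its values at the corners.\<close>

lemma deck_Ct_sub:
  assumes g: "g \<in> G" "g ` At = At" "g ` Bt = Bt"
  shows "g ` Ct \<subseteq> Ct"
proof clarify
  fix z assume "z \<in> Bt"
  then obtain n s t where s: "s \<in> Y n" "t \<in> cube n" "z = s t" "s ` cube n \<subseteq> Bt" by (rule EB.At_carrier)
  define s' where "s' = compose (cube n) g s"
  have s': "s' \<in> Y n" unfolding s'_def by (rule deck_cube[OF g(1) s(1)])
  obtain m \<tau> q where \<tau>: "\<tau> \<in> Y m" "collapse_map n m q" "\<forall>t\<in>cube n. pr (s t) = \<tau> (q t)"
    using pr_cube[OF s(1)] .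
  obtain l \<mu> r where \<mu>: "\<mu> \<in> Y l" "collapse_map n l r" "\<forall>t\<in>cube n. pr (s' t) = \<mu> (r t)"
    using pr_cube[OF s'] .
  have \<theta>: "compose (cube m) g \<tau> \<in> Y m" by (rule deck_cube[OF g(1) \<tau>(1)])
  have "compose (cube m) g \<tau> (q t) = \<mu> (r t)"
  proof (rule collapsed_cubes_agree[OF \<theta> \<mu>(1) \<tau>(2) \<mu>(2) _ s(2)])
    fix w assume w: "w \<in> corners n"
    note wc = corners_cube[OF w]
    have "compose (cube m) g \<tau> (q w) = g (pr (s w))"
      using \<tau>(3) wc collapse_map_cube[OF \<tau>(2) wc] by (simp add: compose_eq)
    also have "\<dots> = pr (g (s w))" by (rule deck_pr_vertex[OF g(1,2) cube_vertex[OF s(1) w]])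
    also have "\<dots> = \<mu> (r w)" using \<mu>(3) wc by (simp add: s'_def compose_eq)
    finally show "compose (cube m) g \<tau> (q w) = \<mu> (r w)" .
  qed
  then have "g (pr z) = pr (g z)"
    using \<tau>(3) \<mu>(3) s collapse_map_cube[OF \<tau>(2) s(2)] by (simp add: compose_eq s'_def)
  then show "g (pr z) \<in> Ct" using \<open>z \<in> Bt\<close> g(3) by blast
qed

lemma deck_Ct:
  assumes g: "g \<in> G" "g ` At = At" "g ` Bt = Bt"
  shows "g ` Ct = Ct"
proof -
  obtain h where h: "h \<in> G" "\<forall>x\<in>points Y. h (g x) = x" "\<forall>x\<in>points Y. g (h x) = x"
    using deck_inverse[OF g(1)] .
  have inv: "h ` D = D" if "g ` D = D" "D \<subseteq> points Y" for D
    using image_inverse[where f = h and k = g, OF h(2) that(2)] that(1) by simp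
  have "h ` Ct \<subseteq> Ct"
    by (rule deck_Ct_sub[OF h(1) inv[OF g(2) EA.At_points] inv[OF g(3) EB.At_points]])
  moreover have "g ` h ` Ct = Ct" using Ct_At EA.At_points by (intro image_inverse[where f = g and k = h, OF h(3)]) blast
  ultimately show ?thesis using deck_Ct_sub[OF g] by blast
qed

lemma stabilizer_Ct: "stabilizer G Ct = stabilizer G At \<inter> stabilizer G Bt"
proof (intro equalityI subsetI)
  fix g assume "g \<in> stabilizer G Ct"
  then have g: "g \<in> G" "g ` Ct = Ct" by (auto simp: stabilizer_def)
  obtain x where "x \<in> Ct" using EB.At_nonempty by blast
  then have "g ` At = At \<and> g ` Bt = Bt" using deck_Ct_point[OF g(1)] g(2) by blast
  then show "g \<in> stabilizer G At \<inter> stabilizer G Bt" using g by (simp add: stabilizer_def)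
next
  fix g assume "g \<in> stabilizer G At \<inter> stabilizer G Bt"
  then show "g \<in> stabilizer G Ct" using deck_Ct[of g] by (simp add: stabilizer_def)
qed

text \<open>Points with the same image are related by a deck transformation, which lies in the stabiliser.\<close>

lemma orbit_injective: "inj_on (orbit_to_base p) (orbit_space (stabilizer G Ct) Ct)"
proof (rule inj_onI)
  let ?S = "stabilizer G Ct"
  have C: "Ct \<subseteq> points Y" using Ct_At EA.At_points by blast
  have S: "g \<in> ?S" if "g \<in> G" "x \<in> Ct" "g x \<in> Ct" for g x
    using deck_Ct_point[OF that] deck_Ct[OF that(1)] that(1) by (simp add: stabilizer_def)
  have base: "orbit_to_base p ((\<lambda>g. g x) ` ?S) = p x" if "x \<in> Ct" for x
  proof -
    have "restrict id (points Y) \<in> ?S"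
      by (rule S[OF deck_id that]) (use that C in auto)
    moreover have "p (g x) = p x" if "g \<in> ?S" for g
      using that deck_p[of g x] \<open>x \<in> Ct\<close> C by (auto simp: stabilizer_def)
    ultimately have "p ` (\<lambda>g. g x) ` ?S = {p x}" by (auto simp: image_image intro!: image_eqI)
    then show ?thesis by (simp add: orbit_to_base_def)
  qed
  have orbit_sub: "(\<lambda>g. g (h x)) ` ?S \<subseteq> (\<lambda>g. g x) ` ?S" if h: "h \<in> ?S" "x \<in> Ct" for h x
  proof clarify
    fix g assume g: "g \<in> ?S"
    have xp: "x \<in> points Y" using h C by blast
    have gh: "g \<in> G" "h \<in> G" "h x \<in> Ct" using g h by (auto simp: stabilizer_def)
    have "g (h x) \<in> Ct" using g gh(3) by (auto simp: stabilizer_def)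
    then have "compose (points Y) g h \<in> ?S"
      by (intro S[OF deck_compose[OF gh(2,1)] h(2)]) (simp add: compose_eq xp)
    moreover have "compose (points Y) g h x = g (h x)" using xp by (simp add: compose_eq)
    ultimately show "g (h x) \<in> (\<lambda>g. g x) ` ?S" by (metis imageI)
  qed
  fix Q R assume "Q \<in> orbit_space ?S Ct" "R \<in> orbit_space ?S Ct" and eq: "orbit_to_base p Q = orbit_to_base p R"
  then obtain x y where x: "x \<in> Ct" "Q = (\<lambda>g. g x) ` ?S" and y: "y \<in> Ct" "R = (\<lambda>g. g y) ` ?S"
    unfolding orbit_space_def by blast
  have xy: "x \<in> points Y" "y \<in> points Y" "p x = p y" using base[OF x(1)] base[OF y(1)] eq x y C by auto
  obtain g where g: "g \<in> G" "g x = y" using deck_transitive[OF xy] .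
  obtain h where h: "h \<in> G" "\<forall>x\<in>points Y. h (g x) = x" using deck_inverse[OF g(1)] by metis
  have hy: "h y = x" using h g xy by auto
  have "g \<in> ?S" "h \<in> ?S" using S[OF g(1) x(1)] S[OF h(1) y(1)] g(2) hy x(1) y(1) by auto
  then have "R \<subseteq> Q" "Q \<subseteq> R" using orbit_sub[of g x] orbit_sub[of h y] g(2) hy x y by auto
  then show "Q = R" by blast
qed

end

theorem proposition3p11:
  fixes X :: "'a cube_complex" and Xt :: "'b cube_complex" and p :: "'b \<Rightarrow> 'a"
    and A B :: "'a set" and At Bt Ct :: "'b set" and pr :: "'b \<Rightarrow> 'b"
    and G :: "('b \<Rightarrow> 'b) set"
  assumes "weakly_special X" and "connected_space (cc_topology X)"
    and "locally_convex X A" and "connectedin (cc_topology X) A"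
    and "locally_convex X B" and "connectedin (cc_topology X) B"
    and "universal_cover Xt p X" and "G = deck_group Xt p"
    and "At \<in> elevations Xt p A" and "Bt \<in> elevations Xt p B"
    and "is_projection Xt At pr" and "Ct = pr ` Bt"
  shows "stabilizer G Ct = stabilizer G At \<inter> stabilizer G Bt \<and>
    inj_on (orbit_to_base p) (orbit_space (stabilizer G Ct) Ct)"
proof -
  interpret projected_elevation X Xt p A At B Bt pr
    using assms by unfold_locales
  show ?thesis
    unfolding \<open>G = deck_group Xt p\<close> \<open>Ct = pr ` Bt\<close> using stabilizer_Ct orbit_injective by blast
qed

end
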